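(* Let $d\ge1$, $\beta>1$ and $C>0$. There exist constants $K_2=K_2(C,\beta)>0$ and $T_0=T_0(C,\beta)>1$ such that for every interval $[t_1,t_2]$ with $T:=t_2-t_1\ge T_0$ and every $y\in\mathbf{R}^d$ there is a potential $U(x,t)$, defined for $x\in\mathbf{R}^d$, $t\in[t_1,t_2]$, such that $U(\cdot,t)$ is $C^1$ for every $t$, $$0\le U(x,t)\le C,\qquad |\nabla U(x,t)|\le C\qquad\text{for all }x\in\mathbf{R}^d,\ t\in[t_1,t_2],$$ and $$|\dot\gamma^x_{t_1,t_2}(t_2)|\ge\frac{K_2(\log T)^{2/\beta}}{2^{\beta/(\beta-1)}}$$ for every $x\in\mathbf{R}^d$ with $|x-y|\le R_T:=\frac{K_2}{2}(\log T)^{2/\beta}$ and every minimizer $\gamma^x_{t_1,t_2}$.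
   Context: $\nabla$ denotes the gradient with respect to $x\in\mathbf{R}^d$; potentials $U$ are assumed measurable in $(x,t)$ so that the action is defined. For $t_1<t_2$ and an absolutely continuous curve $\gamma:[t_1,t_2]\to\mathbf{R}^d$, the action is $$A_{t_1,t_2}[\gamma]=\int_{t_1}^{t_2}\Bigl(\tfrac1\beta|\dot\gamma(s)|^\beta-U(\gamma(s),s)\Bigr)ds .$$ For $x\in\mathbf{R}^d$, $\gamma^x_{t_1,t_2}:[t_1,t_2]\to\mathbf{R}^d$ denotes a (not necessarily unique) minimizer of $A_{t_1,t_2}$ among all absolutely continuous curves $\gamma$ on $[t_1,t_2]$ with $\gamma(t_2)=x$ (the initial point $\gamma(t_1)$ being free). Such minimizers are $C^1$ curves satisfying the Euler--Lagrange equation $\frac{d}{dt}(\dot\gamma|\dot\gamma|^{\beta-2})=-\nabla U(\gamma(t),t)$ (in integrated form if $U$ is merely measurable in $t$) and $\dot\gamma^x_{t_1,t_2}(t_1)=0$. *)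

theory Defs
  imports "HOL-Analysis.Analysis"
begin

text \<open>
  The dimension \<open>d\<close> has to be quantified inside a formula, after constants that do not depend on
  it.  Therefore \<open>\<real>\<^sup>d\<close> is the carrier of the library's \<open>Euclidean_space d\<close>, that is, the set of
  sequences \<open>x :: nat \<Rightarrow> real\<close> with \<open>x i = 0\<close> for \<open>i \<ge> d\<close>.  The type \<open>nat \<Rightarrow> real\<close> carries the
  product topology, which induces the usual topology on this set.
\<close>

abbreviation Rd :: "nat \<Rightarrow> (nat \<Rightarrow> real) set"
  where "Rd d \<equiv> topspace (Euclidean_space d)"

definition enorm :: "nat \<Rightarrow> (nat \<Rightarrow> real) \<Rightarrow> real"
  where "enorm d v = L2_set v {..<d}"

definition edist :: "nat \<Rightarrow> (nat \<Rightarrow> real) \<Rightarrow> (nat \<Rightarrow> real) \<Rightarrow> real"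
  where "edist d x y = enorm d (\<lambda>i. x i - y i)"

definition gradient :: "nat \<Rightarrow> ((nat \<Rightarrow> real) \<Rightarrow> real) \<Rightarrow> (nat \<Rightarrow> real) \<Rightarrow> (nat \<Rightarrow> real)"
  where "gradient d f x = (\<lambda>i. if i < d then deriv (\<lambda>h. f (x(i := h))) (x i) else 0)"

text \<open>Continuous differentiability on all of \<open>\<real>\<^sup>d\<close>: the partial derivatives exist and are continuous.\<close>

definition C1_on_Rd :: "nat \<Rightarrow> ((nat \<Rightarrow> real) \<Rightarrow> real) \<Rightarrow> bool"
  where "C1_on_Rd d f \<longleftrightarrow>
    (\<forall>x\<in>Rd d. \<forall>i<d. (\<lambda>h. f (x(i := h))) field_differentiable (at (x i))) \<and>
    (\<forall>i<d. continuous_on (Rd d) (\<lambda>x. gradient d f x i))"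

definition abs_cont_curve :: "nat \<Rightarrow> real \<Rightarrow> real \<Rightarrow> (real \<Rightarrow> nat \<Rightarrow> real) \<Rightarrow> bool"
  where "abs_cont_curve d a b \<gamma> \<longleftrightarrow>
    (\<forall>s\<in>{a..b}. \<gamma> s \<in> Rd d) \<and>
    (\<forall>\<epsilon>>0. \<exists>\<delta>>0. \<forall>P :: (real \<times> real) set.
       finite P \<longrightarrow>
       (\<forall>(u, v)\<in>P. a \<le> u \<and> u < v \<and> v \<le> b) \<longrightarrow>
       pairwise (\<lambda>p q. {fst p<..<snd p} \<inter> {fst q<..<snd q} = {}) P \<longrightarrow>
       (\<Sum>(u, v)\<in>P. v - u) < \<delta> \<longrightarrow>
       (\<Sum>(u, v)\<in>P. edist d (\<gamma> v) (\<gamma> u)) < \<epsilon>)"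

text \<open>At the end points of \<open>[a, b]\<close> the derivative of a curve is one-sided.\<close>

definition velocity_exists :: "nat \<Rightarrow> real \<Rightarrow> real \<Rightarrow> (real \<Rightarrow> nat \<Rightarrow> real) \<Rightarrow> real \<Rightarrow> bool"
  where "velocity_exists d a b \<gamma> s \<longleftrightarrow>
    (\<forall>i<d. (\<lambda>r. \<gamma> r i) differentiable (at s within {a..b}))"

definition velocity :: "nat \<Rightarrow> real \<Rightarrow> real \<Rightarrow> (real \<Rightarrow> nat \<Rightarrow> real) \<Rightarrow> real \<Rightarrow> (nat \<Rightarrow> real)"
  where "velocity d a b \<gamma> s =
    (\<lambda>i. if i < d then vector_derivative (\<lambda>r. \<gamma> r i) (at s within {a..b}) else 0)"

definition lagrangian ::
  "nat \<Rightarrow> real \<Rightarrow> real \<Rightarrow> real \<Rightarrow> ((nat \<Rightarrow> real) \<Rightarrow> real \<Rightarrow> real) \<Rightarrow> (real \<Rightarrow> nat \<Rightarrow> real) \<Rightarrow> real \<Rightarrow> real"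
  where "lagrangian d \<beta> a b U \<gamma> s =
    1 / \<beta> * enorm d (velocity d a b \<gamma> s) powr \<beta> - U (\<gamma> s) s"

text \<open>
  For an absolutely continuous curve and a bounded measurable potential the integrand is measurable
  and bounded below on \<open>[a, b]\<close>; so if it is not integrable, then its integral is \<open>\<infinity>\<close>.
\<close>

definition action ::
  "nat \<Rightarrow> real \<Rightarrow> real \<Rightarrow> real \<Rightarrow> ((nat \<Rightarrow> real) \<Rightarrow> real \<Rightarrow> real) \<Rightarrow> (real \<Rightarrow> nat \<Rightarrow> real) \<Rightarrow> ereal"
  where "action d \<beta> a b U \<gamma> =
    (if integrable (lebesgue_on {a..b}) (lagrangian d \<beta> a b U \<gamma>)
     then ereal (integral\<^sup>L (lebesgue_on {a..b}) (lagrangian d \<beta> a b U \<gamma>))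
     else \<infinity>)"

definition is_minimizer ::
  "nat \<Rightarrow> real \<Rightarrow> real \<Rightarrow> real \<Rightarrow> ((nat \<Rightarrow> real) \<Rightarrow> real \<Rightarrow> real) \<Rightarrow> (nat \<Rightarrow> real) \<Rightarrow>
    (real \<Rightarrow> nat \<Rightarrow> real) \<Rightarrow> bool"
  where "is_minimizer d \<beta> a b U x \<gamma> \<longleftrightarrow>
    abs_cont_curve d a b \<gamma> \<and> \<gamma> b = x \<and>
    (\<forall>\<eta>. abs_cont_curve d a b \<eta> \<and> \<eta> b = x \<longrightarrow> action d \<beta> a b U \<gamma> \<le> action d \<beta> a b U \<eta>)"

end

theory Submission
  imports Defs
begin

text \<open>
  The potential depends only on the first coordinate and on the time \<open>r = t2 - t\<close> left until the
  end.  It rewards, in the windows \<open>s \<le> r \<le> 2 s\<close> with \<open>s = 4 ^ (m + j)\<close>, a position at distance at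
  least \<open>w j * r\<close> from the end point, where \<open>w j\<close> is a small multiple of \<open>l powr (2 / \<beta>)\<close> and \<open>l\<close>
  is the number of windows from there to the largest one, up to a shift.  A minimizer meets the front
  \<open>w j * r\<close> in every window: if it does so in window \<open>j + 1\<close> but not in window \<open>j\<close>, then bending it
  towards window \<open>j\<close> changes the velocity by \<open>O(w j / l)\<close>, so by convexity the kinetic energy per unit
  time grows by \<open>O((w j) powr \<beta> / l\<^sup>2) = O(1)\<close> with a small constant, while the reward of window \<open>j\<close>
  exceeds all rewards of the smaller windows together.  The exponent \<open>2 / \<beta>\<close> is the one for which this
  balance does not depend on \<open>l\<close>.  After meeting the front in window \<open>0\<close> for the first time the
  minimizer collects no reward, hence moves on a straight line, and its final velocity is at least
  about \<open>w 0\<close>.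
\<close>

subsection \<open>Differentiability of absolutely continuous functions\<close>

text \<open>A minimizer is given only as an absolutely continuous curve, so the energy estimates
  rest on almost everywhere differentiability and on the fundamental theorem of calculus for such
  curves. The final velocity exists because the curve turns out to be affine near the end. The ratio
  4 between windows has two effects. All smaller windows lie in remaining time at most
  \<open>s j / 2\<close>, so together they pay at most half of window \<open>j\<close>. And the gap
  before window \<open>j\<close> is as long as the time from its far edge to the end, so there is
  room for bending. The bound on the gradient forces the reward to be switched on over a layer of
  fixed width in space. Crossing it costs a velocity of order \<open>1 / s j\<close>, which must be
  small against \<open>w j / l\<close>. Therefore only the upper half of the logarithmic scales
  carries windows: the smallest has \<open>s 0 = 4 ^ m\<close>, of the order of the square root of
  \<open>t2 - t1\<close>, and the number of windows is still of the order of the logarithm.\<close>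

definition interval_family :: "real \<Rightarrow> real \<Rightarrow> (real \<times> real) set \<Rightarrow> bool"
  where "interval_family a b P \<longleftrightarrow> finite P \<and> (\<forall>(u, v)\<in>P. a \<le> u \<and> u < v \<and> v \<le> b) \<and>
    pairwise (\<lambda>p q. {fst p<..<snd p} \<inter> {fst q<..<snd q} = {}) P"

definition abs_cont :: "real \<Rightarrow> real \<Rightarrow> (real \<Rightarrow> real) \<Rightarrow> bool"
  where "abs_cont a b f \<longleftrightarrow> (\<forall>\<epsilon>>0. \<exists>\<delta>>0. \<forall>P. interval_family a b P \<longrightarrow>
    (\<Sum>(u, v)\<in>P. v - u) < \<delta> \<longrightarrow> (\<Sum>(u, v)\<in>P. \<bar>f v - f u\<bar>) < \<epsilon>)"

lemma interval_family_bounds: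
  "interval_family a b P \<Longrightarrow> (u, v) \<in> P \<Longrightarrow> a \<le> u \<and> u < v \<and> v \<le> b"
  by (auto simp: interval_family_def)

lemma open_intervals_disjoint:
  fixes u v u' v' :: real
  assumes "{u<..<v} \<inter> {u'<..<v'} = {}" "u < v" "u' < v'"
  shows "v \<le> u' \<or> v' \<le> u"
proof (rule ccontr)
  assume "\<not> ?thesis"
  then have "max u u' < min v v'" using assms by auto
  then obtain z where "max u u' < z" "z < min v v'" using dense by blast
  then have "z \<in> {u<..<v} \<inter> {u'<..<v'}" by auto
  then show False using assms by auto
qed

lemma closed_intervals_disjoint:
  fixes u v u' v' :: real
  assumes "{u..v} \<inter> {u'..v'} = {}" "u \<le> v" "u' \<le> v'"
  shows "v < u' \<or> v' < u"
proof (rule ccontr)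
  assume "\<not> ?thesis"
  then have "max u u' \<in> {u..v} \<inter> {u'..v'}" using assms by auto
  then show False using assms by auto
qed

lemma interval_family_length_le:
  assumes "interval_family a b P" "T \<in> lmeasurable" "\<And>u v. (u, v) \<in> P \<Longrightarrow> {u<..<v} \<subseteq> T"
  shows "(\<Sum>(u, v)\<in>P. v - u) \<le> measure lebesgue T"
proof -
  have fin: "finite P" using assms(1) by (simp add: interval_family_def)
  have "(\<Sum>(u, v)\<in>P. v - u) = (\<Sum>p\<in>P. measure lebesgue {fst p<..<snd p})"
    using assms(1) by (intro sum.cong) (auto simp: interval_family_def split_beta)
  also have "\<dots> = measure lebesgue (\<Union>p\<in>P. {fst p<..<snd p})"
    using assms(1) fin
    by (intro measure_UNION'[symmetric])
       (auto simp: interval_family_def disjnt_def pairwise_def box_real[symmetric] simp del: box_real)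
  also have "\<dots> \<le> measure lebesgue T"
  proof (rule measure_mono_fmeasurable)
    show "(\<Union>p\<in>P. {fst p<..<snd p}) \<subseteq> T" using assms(3) by (intro UN_least) auto
  qed (use assms fin in auto)
  finally show ?thesis .
qed

text \<open>Vitali's theorem extracts a countable disjoint subfamily that covers \<open>S\<close> up
  to a null set; the bound for finite subfamilies passes to the countable union. \<open>S\<close> is
  an arbitrary set, hence the conclusion about a measurable superset.\<close>

lemma Vitali_outer_bound:
  fixes S :: "real set"
  assumes cover: "\<And>x e. x \<in> S \<Longrightarrow> e > 0 \<Longrightarrow> \<exists>u v. Q u v \<and> u < v \<and> u \<le> x \<and> x \<le> v \<and> v - u < e"
    and bound: "\<And>P. finite P \<Longrightarrow> (\<And>u v. (u, v) \<in> P \<Longrightarrow> u < v \<and> Q u v) \<Longrightarrow>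
      pairwise (\<lambda>p q. {fst p..snd p} \<inter> {fst q..snd q} = {}) P \<Longrightarrow> (\<Sum>(u, v)\<in>P. v - u) \<le> \<kappa>"
  shows "\<exists>T\<in>lmeasurable. S \<subseteq> T \<and> measure lebesgue T \<le> \<kappa>"
proof -
  define K where "K = {(u, v). u < v \<and> Q u v}"
  \<comment> \<open>The covering theorem speaks of balls, so intervals are encoded by centre and
    radius.\<close>
  define ce where "ce = (\<lambda>p. (fst p + snd p) / 2 :: real)"
  define ra where "ra = (\<lambda>p. (snd p - fst p) / 2 :: real)"
  have cb: "cball (ce p) (ra p) = {fst p..snd p}" for p
    by (auto simp: ce_def ra_def cball_eq_atLeastAtMost field_simps)
  have *: "\<exists>i. i \<in> K \<and> x \<in> cball (ce i) (ra i) \<and> ra i < e" if xe: "x \<in> S" "e > 0" for x e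
  proof -
    obtain u v where uv: "Q u v" "u < v" "u \<le> x" "x \<le> v" "v - u < e"
      using cover[OF xe] by blast
    then have "(u, v) \<in> K" "x \<in> cball (ce (u, v)) (ra (u, v))" "ra (u, v) < e"
      unfolding cb by (auto simp: K_def ra_def)
    then show ?thesis by blast
  qed
  have pos: "\<And>i. i \<in> K \<Longrightarrow> 0 < ra i" by (auto simp: K_def ra_def)
  obtain F where F: "countable F" "F \<subseteq> K"
    "pairwise (\<lambda>i j. disjnt (cball (ce i) (ra i)) (cball (ce j) (ra j))) F"
    "negligible (S - (\<Union>i\<in>F. cball (ce i) (ra i)))"
    using Vitali_covering_theorem_cballs[of K ra S ce, OF pos *] by blast
  have fin: "measure lebesgue (\<Union>i\<in>P. {fst i..snd i}) \<le> \<kappa>" if P: "P \<subseteq> F" "finite P" for P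
  proof -
    have "measure lebesgue (\<Union>i\<in>P. {fst i..snd i}) = (\<Sum>p\<in>P. measure lebesgue {fst p..snd p})"
      using F(3) P unfolding cb
      by (intro measure_UNION') (auto intro: pairwise_subset)
    also have "\<dots> = (\<Sum>(u, v)\<in>P. v - u)"
      using P F(2) by (intro sum.cong) (auto simp: K_def split_beta)
    also have "\<dots> \<le> \<kappa>"
      using P F(2,3) unfolding cb disjnt_def
      by (intro bound) (auto simp: K_def intro: pairwise_subset)
    finally show ?thesis .
  qed
  have "(\<Union>i\<in>F. {fst i..snd i}) \<in> lmeasurable \<and> measure lebesgue (\<Union>i\<in>F. {fst i..snd i}) \<le> \<kappa>"
    using fmeasurable_UN_bound[OF F(1), of "\<lambda>i. {fst i..snd i}" lebesgue \<kappa>]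
      measure_UN_bound[OF F(1), of "\<lambda>i. {fst i..snd i}" lebesgue \<kappa>] fin by auto
  moreover have "negligible (S - (\<Union>i\<in>F. {fst i..snd i}))" using F(4) unfolding cb .
  ultimately show ?thesis
    by (intro bexI[of _ "(\<Union>i\<in>F. {fst i..snd i}) \<union> (S - (\<Union>i\<in>F. {fst i..snd i}))"])
       (auto simp: negligible_imp_measurable measure_Un_null_set negligible_iff_null_sets
          simp del: Un_Diff_cancel Un_Diff_cancel2)
qed

text \<open>Cutting \<open>[u, v]\<close> out of a member \<open>(c, d)\<close> leaves
  \<open>(c, u)\<close> and \<open>(v, d)\<close>, and the increments telescope. The last conjunct
  is the induction invariant: intervals disjoint from those already removed still lie strictly
  inside some member, so they can be removed next. Strictness keeps both leftover pieces
  nondegenerate.\<close>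

lemma interval_family_remove:
  fixes g :: "real \<Rightarrow> real"
  assumes D: "interval_family a b D" and "finite P"
    and "\<And>u v. (u, v) \<in> P \<Longrightarrow> u < v \<and> (\<exists>(c, d)\<in>D. c < u \<and> v < d)"
    and "pairwise (\<lambda>p q. {fst p..snd p} \<inter> {fst q..snd q} = {}) P"
  shows "\<exists>D'. interval_family a b D' \<and>
    (\<Sum>(u, v)\<in>D'. g v - g u) = (\<Sum>(u, v)\<in>D. g v - g u) - (\<Sum>(u, v)\<in>P. g v - g u) \<and>
    (\<forall>u v. u < v \<and> (\<exists>(c, d)\<in>D. c < u \<and> v < d) \<and> (\<forall>(u', v')\<in>P. {u..v} \<inter> {u'..v'} = {}) \<longrightarrow>
      (\<exists>(c, d)\<in>D'. c < u \<and> v < d))"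
  using assms(2-)
proof (induction P rule: finite_induct)
  case empty
  then show ?case using D by (intro exI[of _ D]) auto
next
  case (insert p P)
  obtain u v where p: "p = (u, v)" by force
  have "\<And>u v. (u, v) \<in> P \<Longrightarrow> u < v \<and> (\<exists>(c, d)\<in>D. c < u \<and> v < d)"
    "pairwise (\<lambda>p q. {fst p..snd p} \<inter> {fst q..snd q} = {}) P"
    using insert.prems by (blast intro: pairwise_subset)+
  from insert.IH[OF this] obtain D' where D': "interval_family a b D'"
    "(\<Sum>(u, v)\<in>D'. g v - g u) = (\<Sum>(u, v)\<in>D. g v - g u) - (\<Sum>(u, v)\<in>P. g v - g u)"
    and cov: "\<And>u v. u < v \<Longrightarrow> (\<exists>(c, d)\<in>D. c < u \<and> v < d) \<Longrightarrow>
       (\<forall>(u', v')\<in>P. {u..v} \<inter> {u'..v'} = {}) \<Longrightarrow> (\<exists>(c, d)\<in>D'. c < u \<and> v < d)"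
    by blast
  have uv: "u < v" "\<exists>(c, d)\<in>D. c < u \<and> v < d" using insert.prems(1)[of u v] p by auto
  have dj: "\<forall>(u', v')\<in>P. {u..v} \<inter> {u'..v'} = {}"
    using insert.prems(2) insert.hyps(2) unfolding p pairwise_insert by auto
  obtain c d where cd: "(c, d) \<in> D'" "c < u" "v < d" using cov[OF uv dj] by blast
  have finD': "finite D'" using D'(1) by (simp add: interval_family_def)
  define E where "E = D' - {(c, d)}"
  have other: "d' \<le> c \<or> d \<le> c'" if "(c', d') \<in> E" for c' d'
  proof -
    have "{c'<..<d'} \<inter> {c<..<d} = {}" "c' < d'" "c < d"
      using D'(1) that cd unfolding interval_family_def pairwise_def E_def by force+
    then show ?thesis by (rule open_intervals_disjoint)
  qed
  have Eb: "a \<le> c' \<and> c' < d' \<and> d' \<le> b" if "(c', d') \<in> E" for c' d'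
    using D'(1) that unfolding interval_family_def E_def by auto
  have ab: "a \<le> c" "d \<le> b" using interval_family_bounds[OF D'(1) cd(1)] by auto
  have pwE: "pairwise (\<lambda>p q. {fst p<..<snd p} \<inter> {fst q<..<snd q} = {}) E"
    using D'(1) unfolding interval_family_def E_def by (auto intro: pairwise_subset)
  define D'' where "D'' = insert (c, u) (insert (v, d) E)"
  have nin: "(c, u) \<notin> insert (v, d) E" "(v, d) \<notin> E"
    using other[of c u] other[of v d] cd uv by auto
  have fam: "interval_family a b D''"
    unfolding interval_family_def
  proof (intro conjI)
    show "finite D''" using finD' by (simp add: D''_def E_def)
    show "\<forall>(u, v)\<in>D''. a \<le> u \<and> u < v \<and> v \<le> b"
      using Eb cd uv ab by (auto simp: D''_def)
    show "pairwise (\<lambda>p q. {fst p<..<snd p} \<inter> {fst q<..<snd q} = {}) D''"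
      unfolding D''_def pairwise_insert
      using pwE other cd uv by (force simp: disjoint_iff)
  qed
  have "(\<Sum>(u, v)\<in>D''. g v - g u) = (g u - g c) + (g d - g v) + (\<Sum>(u, v)\<in>E. g v - g u)"
    unfolding D''_def using nin finD' by (simp add: E_def)
  also have "(\<Sum>(u, v)\<in>E. g v - g u) = (\<Sum>(u, v)\<in>D'. g v - g u) - (g d - g c)"
    unfolding E_def using finD' cd by (simp add: sum_diff1)
  finally have "(\<Sum>(u, v)\<in>D''. g v - g u) = (\<Sum>(u, v)\<in>D. g v - g u) - (\<Sum>(u, v)\<in>insert p P. g v - g u)"
    using D'(2) insert.hyps by (simp add: p)
  moreover have "\<exists>(c, d)\<in>D''. c < x \<and> y < d"
    if xy: "x < y" "\<exists>(c, d)\<in>D. c < x \<and> y < d" "\<forall>(u', v')\<in>insert p P. {x..y} \<inter> {u'..v'} = {}" for x y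
  proof -
    obtain c' d' where c'd': "(c', d') \<in> D'" "c' < x" "y < d'" using cov[of x y] xy by blast
    show ?thesis
    proof (cases "(c', d') = (c, d)")
      case False
      then show ?thesis using c'd' by (auto simp: D''_def E_def)
    next
      case True
      have "{x..y} \<inter> {u..v} = {}" using xy(3) by (auto simp: p)
      then have "y < u \<or> v < x" using closed_intervals_disjoint xy uv by force
      then show ?thesis using True c'd' by (auto simp: D''_def)
    qed
  qed
  ultimately show ?case using fam by blast
qed

text \<open>Chebyshev's argument: disjoint intervals of slope above \<open>K\<close> have total
  length at most \<open>B / K\<close>, and \<open>K\<close> can be taken arbitrarily large.\<close>

lemma negligible_steep_points:
  fixes f :: "real \<Rightarrow> real"
  assumes bdd: "\<And>P. interval_family a b P \<Longrightarrow> (\<Sum>(u, v)\<in>P. \<bar>f v - f u\<bar>) \<le> B"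
    and S: "S \<subseteq> {a<..<b}"
    and steep: "\<And>x e K. x \<in> S \<Longrightarrow> e > 0 \<Longrightarrow>
      \<exists>u v. u \<le> x \<and> x \<le> v \<and> u < v \<and> v - u < e \<and> \<bar>f v - f u\<bar> > K * (v - u)"
  shows "negligible S"
  unfolding negligible_outer_le
proof (intro allI impI)
  fix \<epsilon> :: real assume "\<epsilon> > 0"
  define B' where "B' = max B 1"
  define K where "K = B' / \<epsilon>"
  have "K > 0" using \<open>\<epsilon> > 0\<close> by (simp add: K_def B'_def)
  have "\<exists>T\<in>lmeasurable. S \<subseteq> T \<and> measure lebesgue T \<le> \<epsilon>"
  proof (rule Vitali_outer_bound[where Q="\<lambda>u v. a \<le> u \<and> v \<le> b \<and> \<bar>f v - f u\<bar> > K * (v - u)"])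
    fix x e :: real assume x: "x \<in> S" "e > 0"
    then have "min e (min (x - a) (b - x)) > 0" using S by auto
    from steep[OF x(1) this, of K] obtain u v where "u \<le> x" "x \<le> v" "u < v"
      "v - u < min e (min (x - a) (b - x))" "K * (v - u) < \<bar>f v - f u\<bar>" by blast
    moreover from this have "v - u < e" "a \<le> u" "v \<le> b" by linarith+
    ultimately show "\<exists>u v. (a \<le> u \<and> v \<le> b \<and> \<bar>f v - f u\<bar> > K * (v - u)) \<and> u < v \<and> u \<le> x \<and> x \<le> v \<and> v - u < e"
      by blast
  next
    fix P :: "(real \<times> real) set"
    assume P: "finite P"
      "\<And>u v. (u, v) \<in> P \<Longrightarrow> u < v \<and> a \<le> u \<and> v \<le> b \<and> \<bar>f v - f u\<bar> > K * (v - u)"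
      "pairwise (\<lambda>p q. {fst p..snd p} \<inter> {fst q..snd q} = {}) P"
    have "interval_family a b P"
      using P unfolding interval_family_def
      by (auto elim!: pairwise_mono simp: disjoint_iff)
    then have "(\<Sum>(u, v)\<in>P. \<bar>f v - f u\<bar>) \<le> B'" using bdd unfolding B'_def by fastforce
    moreover have "K * (\<Sum>(u, v)\<in>P. v - u) \<le> (\<Sum>(u, v)\<in>P. \<bar>f v - f u\<bar>)"
      unfolding sum_distrib_left using P(2) by (intro sum_mono) (force simp: split_beta)
    ultimately have "K * (\<Sum>(u, v)\<in>P. v - u) \<le> K * \<epsilon>"
      using \<open>\<epsilon> > 0\<close> by (simp add: K_def)
    then show "(\<Sum>(u, v)\<in>P. v - u) \<le> \<epsilon>" using \<open>K > 0\<close> by simp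
  qed
  then show "\<exists>T. S \<subseteq> T \<and> T \<in> lmeasurable \<and> measure lebesgue T \<le> \<epsilon>" by blast
qed

text \<open>
  Take a family \<open>D\<close> whose sum of increments is almost maximal.  Outside \<open>D\<close>, disjoint intervals of
  steep increase can be added to it; inside \<open>D\<close>, disjoint intervals of steep decrease can be cut out.
  Neither gains much, so by Vitali covering both parts of \<open>S\<close> have small outer measure.
\<close>

lemma negligible_oscillation_points:
  fixes g :: "real \<Rightarrow> real"
  assumes bdd: "\<And>P. interval_family a b P \<Longrightarrow> (\<Sum>(u, v)\<in>P. g v - g u) \<le> B"
    and S: "S \<subseteq> {a<..<b}" and r: "r > 0"
    and up: "\<And>x e. x \<in> S \<Longrightarrow> e > 0 \<Longrightarrow>
      \<exists>u v. u \<le> x \<and> x \<le> v \<and> u < v \<and> v - u < e \<and> g v - g u > r * (v - u)"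
    and down: "\<And>x e. x \<in> S \<Longrightarrow> e > 0 \<Longrightarrow>
      \<exists>u v. u \<le> x \<and> x \<le> v \<and> u < v \<and> v - u < e \<and> g v - g u < - r * (v - u)"
  shows "negligible S"
  unfolding negligible_outer_le
proof (intro allI impI)
  fix \<epsilon> :: real assume "\<epsilon> > 0"
  define V where "V = (\<lambda>P. \<Sum>(u, v)\<in>P. g v - g u :: real)"
  define M where "M = (SUP P\<in>Collect (interval_family a b). V P)"
  have bA: "bdd_above (V ` Collect (interval_family a b))"
    using bdd by (auto simp: bdd_above_def V_def)
  have VM: "V P \<le> M" if "interval_family a b P" for P
    unfolding M_def by (intro cSUP_upper bA) (simp add: that)
  have "interval_family a b {}" by (simp add: interval_family_def)
  then have "Collect (interval_family a b) \<noteq> {}" by blast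
  moreover have "M - r * \<epsilon> / 2 < M" using r \<open>\<epsilon> > 0\<close> by simp
  ultimately obtain D where D: "interval_family a b D" "M - r * \<epsilon> / 2 < V D"
    unfolding M_def by (auto simp: less_cSUP_iff[OF _ bA])
  have finD: "finite D" using D by (simp add: interval_family_def)
  \<comment> \<open>Cutting out needs intervals strictly inside a member of \<open>D\<close>, adding
    needs intervals that avoid the closed members. \<open>J\<close> exceeds \<open>I\<close> only by
    finitely many end points, so the two cases together miss only a null set.\<close>
  define I where "I = (\<Union>(c, d)\<in>D. {c<..<d})"
  define J where "J = (\<Union>(c, d)\<in>D. {c..d})"
  have "\<exists>T\<in>lmeasurable. S \<inter> I \<subseteq> T \<and> measure lebesgue T \<le> \<epsilon> / 2"
  proof (rule Vitali_outer_bound[where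
        Q="\<lambda>u v. (\<exists>(c, d)\<in>D. c < u \<and> v < d) \<and> g v - g u < - r * (v - u)"])
    fix x e :: real assume x: "x \<in> S \<inter> I" "e > 0"
    then obtain c d where cd: "(c, d) \<in> D" "c < x" "x < d" by (auto simp: I_def)
    then have "min e (min (x - c) (d - x)) > 0" using x by auto
    from down[OF _ this, of x] x
    obtain u v where "u \<le> x" "x \<le> v" "u < v" "v - u < min e (min (x - c) (d - x))"
      "g v - g u < - r * (v - u)" by blast
    then show "\<exists>u v. ((\<exists>(c, d)\<in>D. c < u \<and> v < d) \<and> g v - g u < - r * (v - u)) \<and>
        u < v \<and> u \<le> x \<and> x \<le> v \<and> v - u < e"
      using cd by (intro exI[of _ u] exI[of _ v]) (auto intro!: bexI[of _ "(c, d)"])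
  next
    fix P :: "(real \<times> real) set"
    assume P: "finite P"
      "\<And>u v. (u, v) \<in> P \<Longrightarrow> u < v \<and> (\<exists>(c, d)\<in>D. c < u \<and> v < d) \<and> g v - g u < - r * (v - u)"
      "pairwise (\<lambda>p q. {fst p..snd p} \<inter> {fst q..snd q} = {}) P"
    have "\<And>u v. (u, v) \<in> P \<Longrightarrow> u < v \<and> (\<exists>(c, d)\<in>D. c < u \<and> v < d)" using P(2) by blast
    from interval_family_remove[OF D(1) P(1) this P(3), of g]
    obtain D' where "interval_family a b D'" "V D' = V D - V P"
      unfolding V_def by blast
    then have "- V P < r * \<epsilon> / 2" using VM[of D'] D(2) by simp
    moreover have "r * (\<Sum>(u, v)\<in>P. v - u) \<le> - V P"
      unfolding sum_distrib_left V_def sum_negf[symmetric]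
      using P(2) by (intro sum_mono) (force simp: split_beta)
    ultimately have "r * (\<Sum>(u, v)\<in>P. v - u) \<le> r * (\<epsilon> / 2)" by simp
    then show "(\<Sum>(u, v)\<in>P. v - u) \<le> \<epsilon> / 2" using r by simp
  qed
  then obtain T1 where T1: "T1 \<in> lmeasurable" "S \<inter> I \<subseteq> T1" "measure lebesgue T1 \<le> \<epsilon> / 2" by blast
  have "closed J" unfolding J_def using finD by auto
  have "\<exists>T\<in>lmeasurable. S - J \<subseteq> T \<and> measure lebesgue T \<le> \<epsilon> / 2"
  proof (rule Vitali_outer_bound[where
        Q="\<lambda>u v. a \<le> u \<and> v \<le> b \<and> {u..v} \<inter> J = {} \<and> g v - g u > r * (v - u)"])
    fix x e :: real assume x: "x \<in> S - J" "e > 0"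
    then obtain e' where e': "e' > 0" "ball x e' \<subseteq> - J"
      using \<open>closed J\<close> by (metis ComplI DiffD2 open_Compl openE)
    then have "min (min e e') (min (x - a) (b - x)) > 0" using x S by auto
    from up[OF _ this, of x] x
    obtain u v where uv: "u \<le> x" "x \<le> v" "u < v" "v - u < min (min e e') (min (x - a) (b - x))"
      "g v - g u > r * (v - u)" by blast
    then have "{u..v} \<subseteq> ball x e'" by (auto simp: dist_real_def)
    with e' have "{u..v} \<inter> J = {}" by blast
    moreover have "v - u < e" "a \<le> u" "v \<le> b" using uv by linarith+
    ultimately show "\<exists>u v. (a \<le> u \<and> v \<le> b \<and> {u..v} \<inter> J = {} \<and> g v - g u > r * (v - u)) \<and>
        u < v \<and> u \<le> x \<and> x \<le> v \<and> v - u < e"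
      using uv by blast
  next
    fix P :: "(real \<times> real) set"
    assume P: "finite P"
      "\<And>u v. (u, v) \<in> P \<Longrightarrow> u < v \<and> a \<le> u \<and> v \<le> b \<and> {u..v} \<inter> J = {} \<and> g v - g u > r * (v - u)"
      "pairwise (\<lambda>p q. {fst p..snd p} \<inter> {fst q..snd q} = {}) P"
    have pwP: "pairwise (\<lambda>p q. {fst p<..<snd p} \<inter> {fst q<..<snd q} = {}) P"
      using P(3) by (rule pairwise_mono) (auto simp: disjoint_iff less_imp_le)
    have sep: "{u..v} \<inter> {c..d} = {}" if "(u, v) \<in> P" "(c, d) \<in> D" for u v c d
    proof -
      have "{c..d} \<subseteq> J" using that(2) unfolding J_def by force
      then show ?thesis using P(2)[OF that(1)] by blast
    qed
    have sep': "{fst p<..<snd p} \<inter> {fst q<..<snd q} = {}" if "p \<in> P" "q \<in> D" for p q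
      using sep[of "fst p" "snd p" "fst q" "snd q"] that by (auto simp: disjoint_iff less_imp_le)
    have "interval_family a b (D \<union> P)"
      unfolding interval_family_def
    proof (intro conjI)
      show "pairwise (\<lambda>p q. {fst p<..<snd p} \<inter> {fst q<..<snd q} = {}) (D \<union> P)"
        using D(1) pwP sep' unfolding interval_family_def pairwise_def by (metis Un_iff inf_commute)
    qed (use D(1) P in \<open>auto simp: interval_family_def\<close>)
    moreover have "D \<inter> P = {}"
    proof -
      have False if "(u, v) \<in> D" "(u, v) \<in> P" for u v
        using sep[OF that(2,1)] conjunct1[OF P(2)[OF that(2)]] by simp
      then show ?thesis by auto
    qed
    then have "V (D \<union> P) = V D + V P"
      unfolding V_def using P(1) finD by (simp add: sum.union_disjoint)
    ultimately have "V P < r * \<epsilon> / 2" using VM[of "D \<union> P"] D(2) by simp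
    moreover have "r * (\<Sum>(u, v)\<in>P. v - u) \<le> V P"
      unfolding sum_distrib_left V_def
      using P(2) by (intro sum_mono) (force simp: split_beta)
    ultimately have "r * (\<Sum>(u, v)\<in>P. v - u) \<le> r * (\<epsilon> / 2)" by simp
    then show "(\<Sum>(u, v)\<in>P. v - u) \<le> \<epsilon> / 2" using r by simp
  qed
  then obtain T2 where T2: "T2 \<in> lmeasurable" "S - J \<subseteq> T2" "measure lebesgue T2 \<le> \<epsilon> / 2" by blast
  have "finite (fst ` D \<union> snd ` D)" using finD by simp
  then have neg: "negligible (fst ` D \<union> snd ` D)" by (rule negligible_finite)
  have "J \<subseteq> I \<union> (fst ` D \<union> snd ` D)"
    by (force simp: I_def J_def image_iff)
  then have "S \<subseteq> (T1 \<union> T2) \<union> (fst ` D \<union> snd ` D)" using T1(2) T2(2) by blast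
  moreover have "measure lebesgue ((T1 \<union> T2) \<union> (fst ` D \<union> snd ` D)) = measure lebesgue (T1 \<union> T2)"
    using T1 T2 neg by (simp add: measure_Un_null_set negligible_iff_null_sets)
  moreover have "measure lebesgue (T1 \<union> T2) \<le> \<epsilon>"
    using measure_Un_le[of T1 lebesgue T2] T1 T2 by (auto simp: fmeasurableD)
  moreover have "(T1 \<union> T2) \<union> (fst ` D \<union> snd ` D) \<in> lmeasurable"
    using T1 T2 negligible_imp_measurable[OF neg] by blast
  ultimately show "\<exists>T. S \<subseteq> T \<and> T \<in> lmeasurable \<and> measure lebesgue T \<le> \<epsilon>"
    by (metis (no_types, lifting))
qed

section \<open>Absolute continuity: derivative almost everywhere and the fundamental theorem of
  calculus\<close>

lemma interval_family_mono:
  "interval_family a' b' P \<Longrightarrow> a \<le> a' \<Longrightarrow> b' \<le> b \<Longrightarrow> interval_family a b P"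
  by (force simp: interval_family_def)

lemma abs_cont_subinterval:
  "abs_cont a b f \<Longrightarrow> a \<le> a' \<Longrightarrow> b' \<le> b \<Longrightarrow> abs_cont a' b' f"
  unfolding abs_cont_def by (meson interval_family_mono)

lemma abs_cont_continuous_on:
  assumes "abs_cont a b f"
  shows "continuous_on {a..b} f"
  unfolding continuous_on_iff
proof (intro ballI allI impI)
  fix x e :: real assume x: "x \<in> {a..b}" and e: "e > 0"
  obtain d where d: "d > 0" "\<And>P. interval_family a b P \<Longrightarrow> (\<Sum>(u, v)\<in>P. v - u) < d \<Longrightarrow>
      (\<Sum>(u, v)\<in>P. \<bar>f v - f u\<bar>) < e"
    using assms e unfolding abs_cont_def by meson
  have "dist (f y) (f x) < e" if "y \<in> {a..b}" "dist y x < d" for y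
  proof (cases "y = x")
    case False
    then have "interval_family a b {(min x y, max x y)}"
      using x that by (auto simp: interval_family_def)
    from d(2)[OF this] show ?thesis using that
      by (cases "x \<le> y") (auto simp: dist_real_def abs_minus_commute)
  qed (use e in simp)
  then show "\<exists>d>0. \<forall>x'\<in>{a..b}. dist x' x < d \<longrightarrow> dist (f x') (f x) < e" using d(1) by blast
qed

text \<open>If the difference quotients are bounded near 0, their lower and upper limits are finite
  and must differ, so two rationals fit in between. Rational thresholds reduce the second case to
  countably many exceptional sets.\<close>

lemma not_differentiable_real_cases:
  fixes f :: "real \<Rightarrow> real"
  assumes "\<not> f differentiable (at x)"
  defines "F \<equiv> \<lambda>h. (f (x + h) - f x) / h"
  shows "(\<forall>K. \<exists>\<^sub>F h in at 0. \<bar>F h\<bar> > K) \<or>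
    (\<exists>p\<in>\<rat>. \<exists>q\<in>\<rat>. p < q \<and> (\<exists>\<^sub>F h in at 0. F h < p) \<and> (\<exists>\<^sub>F h in at 0. F h > q))"
proof (rule ccontr)
  assume neg: "\<not> ?thesis"
  then obtain K where K: "\<forall>\<^sub>F h in at 0. \<bar>F h\<bar> \<le> K"
    by (auto simp: not_frequently not_less)
  let ?L = "Liminf (at 0) (\<lambda>h. ereal (F h))" and ?U = "Limsup (at 0) (\<lambda>h. ereal (F h))"
  have nb: "at (0::real) \<noteq> bot" by simp
  have L: "ereal (- K) \<le> ?L" by (rule Liminf_bounded) (use K in \<open>auto elim!: eventually_mono\<close>)
  have U: "?U \<le> ereal K" by (rule Limsup_bounded) (use K in \<open>auto elim!: eventually_mono\<close>)
  have LU: "?L \<le> ?U" by (rule Liminf_le_Limsup[OF nb])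
  show False
  proof (cases "?L = ?U")
    case True
    have "\<exists>l. z = ereal l" if "ereal (- K) \<le> z" "z \<le> ereal K" for z
      using that by (cases z) auto
    then obtain l where l: "?L = ereal l" using L U True by metis
    then have "((\<lambda>h. ereal (F h)) \<longlongrightarrow> ereal l) (at 0)"
      using True by (subst tendsto_iff_Liminf_eq_Limsup[OF nb]) simp
    then have "(F \<longlongrightarrow> l) (at 0)" by simp
    then have "(f has_real_derivative l) (at x)" unfolding F_def DERIV_def .
    then show False using assms(1) real_differentiable_def by blast
  next
    case False
    then have lt: "?L < ?U" using LU by simp
    obtain q where q: "?L < ereal (real_of_rat q)" "ereal (real_of_rat q) < ?U"
      using ereal_dense3[OF lt] by blast
    obtain p where p: "?L < ereal (real_of_rat p)" "real_of_rat p < real_of_rat q"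
      using ereal_dense3[OF q(1)] by auto
    have "\<exists>\<^sub>F h in at 0. F h > real_of_rat q"
    proof (rule ccontr)
      assume "\<not> ?thesis"
      then have "?U \<le> ereal (real_of_rat q)"
        by (intro Limsup_bounded) (auto simp: not_frequently not_less elim!: eventually_mono)
      then show False using q by simp
    qed
    moreover have "\<exists>\<^sub>F h in at 0. F h < real_of_rat p"
    proof (rule ccontr)
      assume "\<not> ?thesis"
      then have "ereal (real_of_rat p) \<le> ?L"
        by (intro Liminf_bounded) (auto simp: not_frequently not_less elim!: eventually_mono)
      then show False using p by simp
    qed
    ultimately show False using neg p(2) Rats_of_rat by blast
  qed
qed

text \<open>The point \<open>x\<close> becomes one end of the interval; the slope is symmetric in
  the two ends, so negative increments are covered too.\<close>

lemma frequently_slope_interval: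
  fixes f :: "real \<Rightarrow> real"
  assumes "\<exists>\<^sub>F h in at 0. R ((f (x + h) - f x) / h)" "e > 0"
  shows "\<exists>u v. u \<le> x \<and> x \<le> v \<and> u < v \<and> v - u < e \<and> R ((f v - f u) / (v - u))"
proof -
  have "\<exists>h. h \<noteq> 0 \<and> \<bar>h\<bar> < e \<and> R ((f (x + h) - f x) / h)"
    using assms unfolding frequently_def eventually_at by (auto simp: dist_real_def)
  then obtain h where h: "h \<noteq> 0" "\<bar>h\<bar> < e" "R ((f (x + h) - f x) / h)" by blast
  show ?thesis
  proof (cases "h > 0")
    case True
    then show ?thesis using h by (intro exI[of _ x] exI[of _ "x + h"]) auto
  next
    case False
    have "(f (x + h) - f x) / h = (f x - f (x + h)) / (x - (x + h))"
      using h by (simp add: field_simps)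
    then show ?thesis using h False by (intro exI[of _ "x + h"] exI[of _ x]) auto
  qed
qed

lemma negligible_not_differentiable_bounded_variation:
  fixes f :: "real \<Rightarrow> real"
  assumes bdd: "\<And>P. interval_family a b P \<Longrightarrow> (\<Sum>(u, v)\<in>P. \<bar>f v - f u\<bar>) \<le> B"
  shows "negligible {x \<in> {a<..<b}. \<not> f differentiable (at x)}"
proof -
  define F where "F = (\<lambda>x h. (f (x + h) - f x) / h)"
  define A where "A = {x \<in> {a<..<b}. \<forall>K. \<exists>\<^sub>F h in at 0. \<bar>F x h\<bar> > K}"
  define E where "E = (\<lambda>p q. {x \<in> {a<..<b}. (\<exists>\<^sub>F h in at 0. F x h < p) \<and> (\<exists>\<^sub>F h in at 0. F x h > q)})"
  have "negligible A"
  proof (rule negligible_steep_points[OF bdd])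
    fix x e K :: real assume x: "x \<in> A" "e > 0"
    then have "\<exists>\<^sub>F h in at 0. \<bar>F x h\<bar> > K" by (auto simp: A_def)
    from frequently_slope_interval[of "\<lambda>s. \<bar>s\<bar> > K", OF this[unfolded F_def] x(2)]
    show "\<exists>u v. u \<le> x \<and> x \<le> v \<and> u < v \<and> v - u < e \<and> \<bar>f v - f u\<bar> > K * (v - u)"
      by (fastforce simp: field_simps)
  qed (auto simp: A_def)
  moreover have "negligible (E p q)" if "p < q" for p q
  proof -
    \<comment> \<open>Subtracting the line of slope \<open>m\<close> makes the two thresholds
      symmetric: slopes below \<open>p\<close> and above \<open>q\<close> of \<open>f\<close> become
      slopes below \<open>- r\<close> and above \<open>r\<close> of \<open>g\<close>.\<close>
    define m where "m = (p + q) / 2"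
    define r where "r = (q - p) / 2"
    define g where "g = (\<lambda>x. f x - m * x)"
    have pq: "p = m - r" "q = m + r" by (auto simp: m_def r_def field_simps)
    show ?thesis
    proof (rule negligible_oscillation_points[where g=g and r=r and a=a and b=b and B="B + \<bar>m\<bar> * \<bar>b - a\<bar>"])
      fix P assume P: "interval_family a b P"
      have "(\<Sum>(u, v)\<in>P. g v - g u) \<le> (\<Sum>(u, v)\<in>P. \<bar>f v - f u\<bar> + \<bar>m\<bar> * (v - u))"
      proof (rule sum_mono, clarify)
        fix u v assume "(u, v) \<in> P"
        then have "u < v" using interval_family_bounds[OF P] by blast
        then have "- m * (v - u) \<le> \<bar>m\<bar> * (v - u)" by (intro mult_right_mono) auto
        then show "g v - g u \<le> \<bar>f v - f u\<bar> + \<bar>m\<bar> * (v - u)"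
          by (simp add: g_def algebra_simps)
      qed
      also have "\<dots> = (\<Sum>(u, v)\<in>P. \<bar>f v - f u\<bar>) + \<bar>m\<bar> * (\<Sum>(u, v)\<in>P. v - u)"
        by (simp add: split_beta sum.distrib sum_distrib_left)
      also have "\<dots> \<le> B + \<bar>m\<bar> * \<bar>b - a\<bar>"
      proof (intro add_mono mult_left_mono)
        have "{u<..<v} \<subseteq> {a..b}" if "(u, v) \<in> P" for u v
          using interval_family_bounds[OF P that] by auto
        then have "(\<Sum>(u, v)\<in>P. v - u) \<le> measure lebesgue {a..b}"
          by (intro interval_family_length_le[OF P]) auto
        moreover have "measure lebesgue {a..b} \<le> \<bar>b - a\<bar>" by (cases "a \<le> b") auto
        ultimately show "(\<Sum>(u, v)\<in>P. v - u) \<le> \<bar>b - a\<bar>" by (rule order_trans)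
      qed (use bdd[OF P] in auto)
      finally show "(\<Sum>(u, v)\<in>P. g v - g u) \<le> B + \<bar>m\<bar> * \<bar>b - a\<bar>" .
    next
      fix x e :: real assume x: "x \<in> E p q" "e > 0"
      then have "\<exists>\<^sub>F h in at 0. F x h > q" "\<exists>\<^sub>F h in at 0. F x h < p" by (auto simp: E_def)
      from frequently_slope_interval[of "\<lambda>s. s > q", OF this(1)[unfolded F_def] x(2)]
           frequently_slope_interval[of "\<lambda>s. s < p", OF this(2)[unfolded F_def] x(2)]
      show "\<exists>u v. u \<le> x \<and> x \<le> v \<and> u < v \<and> v - u < e \<and> g v - g u > r * (v - u)"
        "\<exists>u v. u \<le> x \<and> x \<le> v \<and> u < v \<and> v - u < e \<and> g v - g u < - r * (v - u)"
        unfolding g_def pq by (fastforce simp: field_simps)+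
    qed (use that in \<open>auto simp: E_def r_def\<close>)
  qed
  then have "negligible (\<Union>pq \<in> {(p, q). p \<in> \<rat> \<and> q \<in> \<rat> \<and> p < q}. E (fst pq) (snd pq))"
    by (intro negligible_countable_Union countable_image countable_subset[OF _ countable_SIGMA[OF countable_rat countable_rat]]) auto
  ultimately have "negligible (A \<union> (\<Union>pq \<in> {(p, q). p \<in> \<rat> \<and> q \<in> \<rat> \<and> p < q}. E (fst pq) (snd pq)))"
    by (rule negligible_Un)
  then show ?thesis
  proof (rule negligible_subset, clarify)
    fix x assume "x \<in> {a<..<b}" "\<not> f differentiable (at x)"
      and "x \<notin> (\<Union>pq \<in> {(p, q). p \<in> \<rat> \<and> q \<in> \<rat> \<and> p < q}. E (fst pq) (snd pq))"
    then show "x \<in> A"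
      using not_differentiable_real_cases[of f x] unfolding A_def E_def F_def by auto
  qed
qed

text \<open>On an interval shorter than the \<open>\<delta>\<close> belonging to
  \<open>\<epsilon> = 1\<close> the variation is at most 1. Negligibility is a local property, so
  such short neighbourhoods suffice.\<close>

lemma abs_cont_differentiable_ae:
  assumes "abs_cont a b f"
  shows "negligible {x \<in> {a<..<b}. \<not> f differentiable (at x)}" (is "negligible ?S")
  unfolding locally_negligible_alt[of ?S]
proof
  fix c assume c: "c \<in> ?S"
  obtain d where d: "d > 0" "\<And>P. interval_family a b P \<Longrightarrow> (\<Sum>(u, v)\<in>P. v - u) < d \<Longrightarrow>
      (\<Sum>(u, v)\<in>P. \<bar>f v - f u\<bar>) < 1"
    using assms unfolding abs_cont_def by (meson zero_less_one)
  \<comment> \<open>A third on either side keeps the total length at most \<open>2 * d / 3\<close>,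
    strictly below \<open>d\<close>.\<close>
  define a' where "a' = max a (c - d / 3)"
  define b' where "b' = min b (c + d / 3)"
  have ab: "a \<le> a'" "b' \<le> b" "a' < c" "c < b'" "b' - a' < d"
    using c d(1) by (auto simp: a'_def b'_def)
  have "negligible {x \<in> {a'<..<b'}. \<not> f differentiable (at x)}"
  proof (rule negligible_not_differentiable_bounded_variation)
    fix P assume P: "interval_family a' b' P"
    have "{u<..<v} \<subseteq> {a'..b'}" if "(u, v) \<in> P" for u v
      using interval_family_bounds[OF P that] by auto
    then have "(\<Sum>(u, v)\<in>P. v - u) \<le> measure lebesgue {a'..b'}"
      by (intro interval_family_length_le[OF P]) auto
    moreover have "measure lebesgue {a'..b'} = b' - a'" using ab(3,4) by simp
    ultimately have "(\<Sum>(u, v)\<in>P. v - u) < d" using ab(5) by linarith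
    then show "(\<Sum>(u, v)\<in>P. \<bar>f v - f u\<bar>) \<le> 1"
      using d(2)[OF interval_family_mono[OF P ab(1,2)]] by simp
  qed
  moreover have "{x \<in> {a'<..<b'}. \<not> f differentiable (at x)} = ?S \<inter> {a'<..<b'}"
    using ab by auto
  ultimately show "\<exists>U. openin (top_of_set ?S) U \<and> c \<in> U \<and> negligible U"
    using ab c by (metis (no_types, lifting) IntI greaterThanLessThan_iff open_greaterThanLessThan openin_open_Int)
qed

text \<open>The gauge integral needs no prior integrability of \<open>k\<close>. At tags outside
  \<open>N\<close> differentiability controls the error linearly in the length. At tags in
  \<open>N\<close> the gauge confines the interval to an open set of measure below the
  \<open>\<delta>\<close> of absolute continuity, so the increments of \<open>f\<close> there add up
  to little.\<close>

lemma abs_cont_has_integral_deriv: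
  assumes ac: "abs_cont a b f" and ab: "a \<le> b" and N: "negligible N"
    and der: "\<And>x. x \<in> {a..b} - N \<Longrightarrow> (f has_real_derivative k x) (at x)"
  shows "(k has_integral (f b - f a)) {a..b}"
proof -
  \<comment> \<open>With value 0 on \<open>N\<close> the Riemann terms tagged there vanish, and only
    the increments of \<open>f\<close> remain to be bounded.\<close>
  define k' where "k' = (\<lambda>x. if x \<in> N then 0 else k x)"
  have "(k' has_integral (f b - f a)) {a..b}"
    unfolding has_integral_real
  proof (intro allI impI)
    fix e :: real assume e: "e > 0"
    \<comment> \<open>The summand 1 keeps the denominator positive when
      \<open>a = b\<close>.\<close>
    define e' where "e' = e / (2 * (b - a + 1))"
    have e': "e' > 0" "e' * (b - a) \<le> e / 2" using e ab by (auto simp: e'_def field_simps)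
    obtain d where d: "d > 0" "\<And>P. interval_family a b P \<Longrightarrow> (\<Sum>(u, v)\<in>P. v - u) < d \<Longrightarrow>
        (\<Sum>(u, v)\<in>P. \<bar>f v - f u\<bar>) < e / 2"
      using ac e unfolding abs_cont_def by (meson half_gt_zero)
    obtain T where T: "open T" "N \<subseteq> T" "T \<in> lmeasurable" "measure lebesgue T < d"
    proof -
      obtain T where T: "open T" "N \<subseteq> T" "T - N \<in> lmeasurable" "emeasure lebesgue (T - N) < ennreal d"
        using sets_lebesgue_outer_open[OF negligible_imp_sets[OF N] d(1)] by blast
      have eq: "T = (T - N) \<union> N" using T by blast
      have "measure lebesgue (T - N) < d"
        using T(3,4) by (simp add: emeasure_eq_measure2 d(1) less_imp_le ennreal_less_iff)
      moreover have "measure lebesgue ((T - N) \<union> N) = measure lebesgue (T - N)"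
        using T N by (simp add: measure_Un_null_set negligible_iff_null_sets del: Un_Diff_cancel2)
      moreover have "(T - N) \<union> N \<in> lmeasurable"
        using T negligible_imp_measurable[OF N] by blast
      ultimately show ?thesis using T eq that by metis
    qed
    have "\<exists>r>0. \<forall>y. \<bar>y - x\<bar> < r \<longrightarrow> \<bar>f y - f x - k' x * (y - x)\<bar> \<le> e' * \<bar>y - x\<bar>"
      if x: "x \<in> {a..b} - N" for x
    proof -
      have "(f has_derivative (\<lambda>h. k x * h)) (at x)"
        using der[OF x] by (simp add: has_field_derivative_def)
      then show ?thesis
        using e'(1) x unfolding has_derivative_at_alt k'_def by auto
    qed
    then obtain r where r: "\<And>x. x \<in> {a..b} - N \<Longrightarrow> r x > 0"
      "\<And>x y. x \<in> {a..b} - N \<Longrightarrow> \<bar>y - x\<bar> < r x \<Longrightarrow> \<bar>f y - f x - k' x * (y - x)\<bar> \<le> e' * \<bar>y - x\<bar>"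
      by metis
    define \<gamma> where "\<gamma> = (\<lambda>x. if x \<in> N then T else if x \<in> {a..b} then ball x (r x) else UNIV)"
    have g: "gauge \<gamma>" unfolding gauge_def \<gamma>_def using T r by auto
    have fine_bound: "norm ((\<Sum>(x, K)\<in>p. measure lborel K *\<^sub>R k' x) - (f b - f a)) < e"
      if p: "p tagged_division_of {a..b}" and fine: "\<gamma> fine p" for p
    proof -
      have finp: "finite p" using p by auto
      have K: "\<exists>u v. K = {u..v} \<and> u \<le> v \<and> u \<le> x \<and> x \<le> v \<and> a \<le> u \<and> v \<le> b"
        if "(x, K) \<in> p" for x K
      proof -
        have "x \<in> K" "K \<subseteq> {a..b}" "\<exists>u v. K = cbox u v" using p that by blast+
        then show ?thesis by auto
      qed
      define J where "J = (\<lambda>(x::real, K). (Inf K, Sup K) :: real \<times> real)"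
      define p1 where "p1 = {(x, K) \<in> p. x \<notin> N}"
      define p2 where "p2 = {(x, K) \<in> p. x \<in> N}"
      \<comment> \<open>Degenerate intervals contribute nothing to the increments. Without them
        \<open>J\<close> is injective and its image is an \<open>interval_family\<close>.\<close>
      define p3 where "p3 = {(x, K) \<in> p2. Inf K < Sup K}"
      have fin: "finite p1" "finite p2" "finite p3" and sub: "p1 \<subseteq> p" "p3 \<subseteq> p2" "p2 \<subseteq> p"
        and p12: "p = p1 \<union> p2" "p1 \<inter> p2 = {}"
        using finp by (auto simp: p1_def p2_def p3_def intro: rev_finite_subset)
      have disj: "{Inf K<..<Sup K} \<inter> {Inf K'<..<Sup K'} = {}"
        if xK: "(x, K) \<in> p" "(x', K') \<in> p" "(x, K) \<noteq> (x', K')" for x K x' K'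
      proof -
        have "interior K \<inter> interior K' = {}" using p xK by blast
        moreover obtain u v where "K = {u..v}" "u \<le> v" using K[OF xK(1)] by blast
        moreover obtain u' v' where "K' = {u'..v'}" "u' \<le> v'" using K[OF xK(2)] by blast
        ultimately show ?thesis by simp
      qed
      have inj: "inj_on J p3"
      proof (rule inj_onI, clarify)
        fix x K x' K' assume a: "(x, K) \<in> p3" "(x', K') \<in> p3" "J (x, K) = J (x', K')"
        show "x = x' \<and> K = K'"
        proof (rule ccontr)
          assume "\<not> ?thesis"
          then have "{Inf K<..<Sup K} \<inter> {Inf K'<..<Sup K'} = {}"
            using disj[of x K x' K'] a sub by auto
          then show False using a by (auto simp: J_def p3_def)
        qed
      qed
      have fam: "interval_family a b (J ` p3)"
        unfolding interval_family_def
      proof (intro conjI)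
        show "\<forall>(u, v)\<in>J ` p3. a \<le> u \<and> u < v \<and> v \<le> b"
        proof
          fix i assume "i \<in> J ` p3"
          then obtain x K where xK: "(x, K) \<in> p" "i = (Inf K, Sup K)" "Inf K < Sup K"
            using sub by (auto simp: J_def p3_def)
          then show "case i of (u, v) \<Rightarrow> a \<le> u \<and> u < v \<and> v \<le> b" using K[OF xK(1)] by auto
        qed
        show "pairwise (\<lambda>p q. {fst p<..<snd p} \<inter> {fst q<..<snd q} = {}) (J ` p3)"
        proof (rule pairwiseI)
          fix i j assume ij: "i \<in> J ` p3" "j \<in> J ` p3" "i \<noteq> j"
          then obtain x K x' K' where "(x, K) \<in> p3" "(x', K') \<in> p3" "i = J (x, K)" "j = J (x', K')"
            by auto
          moreover from this have "(x, K) \<in> p" "(x', K') \<in> p" "(x, K) \<noteq> (x', K')"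
            using ij(3) sub by auto
          ultimately show "{fst i<..<snd i} \<inter> {fst j<..<snd j} = {}"
            using disj[of x K x' K'] by (simp add: J_def)
        qed
      qed (use fin in simp)
      have "(\<Sum>(u, v)\<in>J ` p3. v - u) \<le> measure lebesgue T"
      proof (rule interval_family_length_le[OF fam T(3)])
        fix u v assume "(u, v) \<in> J ` p3"
        then obtain x K where xK: "(x, K) \<in> p2" "u = Inf K" "v = Sup K" by (auto simp: J_def p3_def)
        then have p: "(x, K) \<in> p" "x \<in> N" using sub by (auto simp: p2_def)
        then have "K \<subseteq> T" using fineD[OF fine p(1)] by (simp add: \<gamma>_def)
        moreover have "{u<..<v} \<subseteq> K" using K[OF p(1)] xK by auto
        ultimately show "{u<..<v} \<subseteq> T" by blast
      qed
      then have "(\<Sum>(u, v)\<in>J ` p3. v - u) < d" using T by simp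
      from d(2)[OF fam this] have s3: "(\<Sum>(x, K)\<in>p3. \<bar>f (Sup K) - f (Inf K)\<bar>) < e / 2"
        unfolding sum.reindex[OF inj] by (simp add: J_def o_def split_beta)
      have s2b: "(\<Sum>(x, K)\<in>p2. \<bar>f (Sup K) - f (Inf K)\<bar>) = (\<Sum>(x, K)\<in>p3. \<bar>f (Sup K) - f (Inf K)\<bar>)"
      proof (rule sum.mono_neutral_right)
        show "\<forall>i\<in>p2 - p3. (case i of (x, K) \<Rightarrow> \<bar>f (Sup K) - f (Inf K)\<bar>) = 0"
        proof clarify
          fix x K assume xK: "(x, K) \<in> p2" "(x, K) \<notin> p3"
          then have "(x, K) \<in> p" using sub by blast
          then obtain u v where "K = {u..v}" "u \<le> v" using K by blast
          then show "\<bar>f (Sup K) - f (Inf K)\<bar> = 0" using xK by (simp add: p3_def)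
        qed
      qed (use fin sub in auto)
      have s2: "\<bar>\<Sum>(x, K)\<in>p2. measure lborel K *\<^sub>R k' x - (f (Sup K) - f (Inf K))\<bar>
          \<le> (\<Sum>(x, K)\<in>p2. \<bar>f (Sup K) - f (Inf K)\<bar>)"
        by (rule order_trans[OF sum_abs]) (auto intro!: sum_mono simp: p2_def k'_def)
      have s1: "\<bar>\<Sum>(x, K)\<in>p1. measure lborel K *\<^sub>R k' x - (f (Sup K) - f (Inf K))\<bar>
          \<le> (\<Sum>(x, K)\<in>p1. e' * (Sup K - Inf K))"
      proof (rule order_trans[OF sum_abs], rule sum_mono, clarify)
        fix x K assume xK: "(x, K) \<in> p1"
        then obtain u v where uv: "K = {u..v}" "u \<le> v" "u \<le> x" "x \<le> v" "a \<le> u" "v \<le> b"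
          using K sub by blast
        have x: "x \<in> {a..b} - N" using xK uv by (auto simp: p1_def)
        then have "K \<subseteq> ball x (r x)"
          using fineD[OF fine, of x K] xK x unfolding \<gamma>_def p1_def by auto
        moreover have "u \<in> K" "v \<in> K" using uv by auto
        ultimately have "u \<in> ball x (r x)" "v \<in> ball x (r x)" by blast+
        then have "\<bar>u - x\<bar> < r x" "\<bar>v - x\<bar> < r x" by (simp_all add: dist_real_def abs_minus_commute)
        from this[THEN r(2)[OF x]]
        have "\<bar>f u - f x - k' x * (u - x)\<bar> \<le> e' * (x - u)" "\<bar>f v - f x - k' x * (v - x)\<bar> \<le> e' * (v - x)"
          using uv by auto
        then show "\<bar>measure lborel K *\<^sub>R k' x - (f (Sup K) - f (Inf K))\<bar> \<le> e' * (Sup K - Inf K)"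
          using uv by (simp add: abs_le_iff algebra_simps)
      qed
      have s1b: "(\<Sum>(x, K)\<in>p1. e' * (Sup K - Inf K)) \<le> e / 2"
      proof -
        have "(\<Sum>(x, K)\<in>p1. e' * (Sup K - Inf K)) \<le> (\<Sum>(x, K)\<in>p. e' * (Sup K - Inf K))"
        proof (rule sum_mono2[OF finp sub(1)], clarify)
          fix x K assume "(x, K) \<in> p"
          then obtain u v where "K = {u..v}" "u \<le> v" using K by blast
          then show "0 \<le> e' * (Sup K - Inf K)" using e'(1) by simp
        qed
        also have "\<dots> = e' * (b - a)"
          using additive_tagged_division_1[OF ab p, of "\<lambda>x. x"]
          by (simp add: split_beta sum_distrib_left[symmetric])
        finally show ?thesis using e' by simp
      qed
      have sp: "(\<Sum>(x, K)\<in>p. measure lborel K *\<^sub>R k' x) - (f b - f a) =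
         (\<Sum>(x, K)\<in>p. measure lborel K *\<^sub>R k' x - (f (Sup K) - f (Inf K)))"
        using additive_tagged_division_1[OF ab p, of f] by (simp add: split_beta sum_subtractf)
      also have "\<dots> = (\<Sum>(x, K)\<in>p1. measure lborel K *\<^sub>R k' x - (f (Sup K) - f (Inf K))) +
          (\<Sum>(x, K)\<in>p2. measure lborel K *\<^sub>R k' x - (f (Sup K) - f (Inf K)))"
        using fin p12 by (simp add: sum.union_disjoint)
      finally show ?thesis
        unfolding real_norm_def by (simp only:) (rule le_less_trans[OF abs_triangle_ineq add_le_less_mono[OF order_trans[OF s1 s1b]
          le_less_trans[OF s2[unfolded s2b] s3]], THEN less_le_trans], simp)
    qed
    show "\<exists>\<gamma>. gauge \<gamma> \<and> (\<forall>\<D>. \<D> tagged_division_of {a..b} \<and> \<gamma> fine \<D> \<longrightarrow>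
        norm ((\<Sum>(x, K)\<in>\<D>. measure lborel K *\<^sub>R k' x) - (f b - f a)) < e)"
      by (rule exI[of _ \<gamma>], intro conjI allI impI, rule g, elim conjE, rule fine_bound)
  qed
  then show ?thesis by (rule has_integral_spike[OF N, rotated]) (simp add: k'_def)
qed

text \<open>The null set is fixed before \<open>k\<close>, so it serves every function that agrees
  with the derivative off it. It contains \<open>a\<close> and \<open>b\<close>, where only a
  one-sided derivative is meaningful.\<close>

lemma abs_cont_ftc:
  assumes ac: "abs_cont a b f"
  obtains N where "negligible N" "\<And>x. x \<in> {a..b} - N \<Longrightarrow> x \<in> {a<..<b} \<and> f differentiable (at x)"
    "\<And>k u v. (\<And>x. x \<in> {a..b} - N \<Longrightarrow> (f has_real_derivative k x) (at x)) \<Longrightarrow>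
      a \<le> u \<Longrightarrow> u \<le> v \<Longrightarrow> v \<le> b \<Longrightarrow> (k has_integral (f v - f u)) {u..v}"
proof -
  define N where "N = {x \<in> {a<..<b}. \<not> f differentiable (at x)} \<union> {a, b}"
  have N: "negligible N"
    unfolding N_def using abs_cont_differentiable_ae[OF ac] by (intro negligible_Un) auto
  show thesis
  proof (rule that[OF N])
    fix k u v assume "\<And>x. x \<in> {a..b} - N \<Longrightarrow> (f has_real_derivative k x) (at x)"
      "a \<le> u" "u \<le> v" "v \<le> b"
    then show "(k has_integral (f v - f u)) {u..v}"
      by (intro abs_cont_has_integral_deriv[OF abs_cont_subinterval[OF ac] _ N]) auto
  qed (auto simp: N_def less_le)
qed

subsection \<open>Reduction to the first coordinate\<close>

lemma enorm_nonneg: "enorm d v \<ge> 0"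
  by (simp add: enorm_def L2_set_nonneg)

lemma abs_component_le_enorm: "i < d \<Longrightarrow> \<bar>v i\<bar> \<le> enorm d v"
  using member_le_L2_set[of "{..<d}" i "\<lambda>i. \<bar>v i\<bar>"] by (simp add: enorm_def L2_set_def)

lemma enorm_power2: "(enorm d v)\<^sup>2 = (\<Sum>i<d. (v i)\<^sup>2)"
  by (simp add: enorm_def L2_set_def sum_nonneg)

lemma enorm_eq_abs_first:
  assumes "1 \<le> d" "\<And>i. i < d \<Longrightarrow> i \<noteq> 0 \<Longrightarrow> v i = 0"
  shows "enorm d v = \<bar>v 0\<bar>"
proof -
  have "(\<Sum>i<d. (v i)\<^sup>2) = (\<Sum>i\<in>{0}. (v i)\<^sup>2)"
    using assms by (intro sum.mono_neutral_right) auto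
  then show ?thesis by (simp add: enorm_def L2_set_def)
qed

lemma enorm_eq_abs_first_imp_zero:
  assumes "enorm d v = \<bar>v 0\<bar>" "i < d" "i \<noteq> 0"
  shows "v i = 0"
proof -
  have "(v 0)\<^sup>2 + (v i)\<^sup>2 = (\<Sum>j\<in>{0, i}. (v j)\<^sup>2)" using assms by simp
  also have "\<dots> \<le> (\<Sum>j<d. (v j)\<^sup>2)" using assms by (intro sum_mono2) auto
  also have "\<dots> = (v 0)\<^sup>2" using assms(1) enorm_power2[of d v] by simp
  finally show ?thesis by simp
qed

lemma abs_cont_curve_component:
  assumes "abs_cont_curve d a b \<gamma>" "i < d"
  shows "abs_cont a b (\<lambda>t. \<gamma> t i)"
  unfolding abs_cont_def
proof (intro allI impI)
  fix \<epsilon> :: real assume "\<epsilon> > 0"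
  then obtain \<delta> where \<delta>: "\<delta> > 0" "\<And>P. finite P \<Longrightarrow>
       (\<forall>(u, v)\<in>P. a \<le> u \<and> u < v \<and> v \<le> b) \<Longrightarrow>
       pairwise (\<lambda>p q. {fst p<..<snd p} \<inter> {fst q<..<snd q} = {}) P \<Longrightarrow>
       (\<Sum>(u, v)\<in>P. v - u) < \<delta> \<Longrightarrow>
       (\<Sum>(u, v)\<in>P. edist d (\<gamma> v) (\<gamma> u)) < \<epsilon>"
    using assms(1) unfolding abs_cont_curve_def by meson
  have "(\<Sum>(u, v)\<in>P. \<bar>\<gamma> v i - \<gamma> u i\<bar>) < \<epsilon>"
    if P: "interval_family a b P" "(\<Sum>(u, v)\<in>P. v - u) < \<delta>" for P
  proof (rule le_less_trans[OF _ \<delta>(2)])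
    show "(\<Sum>(u, v)\<in>P. \<bar>\<gamma> v i - \<gamma> u i\<bar>) \<le> (\<Sum>(u, v)\<in>P. edist d (\<gamma> v) (\<gamma> u))"
      using abs_component_le_enorm[OF assms(2), of "\<lambda>i. \<gamma> v i - \<gamma> u i" for u v]
      by (intro sum_mono) (auto simp: edist_def)
  qed (use P in \<open>auto simp: interval_family_def\<close>)
  then show "\<exists>\<delta>>0. \<forall>P. interval_family a b P \<longrightarrow> (\<Sum>(u, v)\<in>P. v - u) < \<delta> \<longrightarrow>
      (\<Sum>(u, v)\<in>P. \<bar>\<gamma> v i - \<gamma> u i\<bar>) < \<epsilon>" using \<delta>(1) by blast
qed

lemma abs_cont_curve_first:
  assumes "abs_cont a b h" "1 \<le> d" "x \<in> Rd d"
  shows "abs_cont_curve d a b (\<lambda>t. x(0 := h t))"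
  unfolding abs_cont_curve_def
proof (intro conjI ballI)
  show "x(0 := h s) \<in> Rd d" for s
    using assms by (auto simp: topspace_Euclidean_space)
  have "edist d (x(0 := h v)) (x(0 := h u)) = \<bar>h v - h u\<bar>" for u v
    unfolding edist_def using assms(2) by (subst enorm_eq_abs_first) auto
  then show "\<forall>\<epsilon>>0. \<exists>\<delta>>0. \<forall>P :: (real \<times> real) set.
       finite P \<longrightarrow>
       (\<forall>(u, v)\<in>P. a \<le> u \<and> u < v \<and> v \<le> b) \<longrightarrow>
       pairwise (\<lambda>p q. {fst p<..<snd p} \<inter> {fst q<..<snd q} = {}) P \<longrightarrow>
       (\<Sum>(u, v)\<in>P. v - u) < \<delta> \<longrightarrow>
       (\<Sum>(u, v)\<in>P. edist d (x(0 := h v)) (x(0 := h u))) < \<epsilon>"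
    using assms(1) unfolding abs_cont_def interval_family_def by (simp only: imp_conjL)
qed

lemma velocity_component:
  assumes "((\<lambda>r. \<gamma> r i) has_real_derivative k) (at t)" "a < t" "t < b" "i < d"
  shows "velocity d a b \<gamma> t i = k"
proof -
  have "at t within {a..b} = at t" using assms(2,3) by (intro at_within_interior) simp
  then show ?thesis
    using assms by (simp add: velocity_def vector_derivative_at has_real_derivative_iff_has_vector_derivative)
qed

lemma abs_cont_curve_velocity:
  assumes "abs_cont_curve d a b \<gamma>"
  obtains N where "negligible N"
    "\<And>t i. t \<in> {a..b} - N \<Longrightarrow> i < d \<Longrightarrow>
      ((\<lambda>r. \<gamma> r i) has_real_derivative velocity d a b \<gamma> t i) (at t)"
    "\<And>i s t. i < d \<Longrightarrow> a \<le> s \<Longrightarrow> s \<le> t \<Longrightarrow> t \<le> b \<Longrightarrow>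
      ((\<lambda>t. velocity d a b \<gamma> t i) has_integral (\<gamma> t i - \<gamma> s i)) {s..t}"
proof -
  have "\<forall>i\<in>{..<d}. \<exists>N. negligible N \<and> (\<forall>x\<in>{a..b} - N. x \<in> {a<..<b} \<and> (\<lambda>t. \<gamma> t i) differentiable (at x)) \<and>
    (\<forall>k u v. (\<forall>x\<in>{a..b} - N. ((\<lambda>t. \<gamma> t i) has_real_derivative k x) (at x)) \<longrightarrow>
      a \<le> u \<longrightarrow> u \<le> v \<longrightarrow> v \<le> b \<longrightarrow> (k has_integral (\<gamma> v i - \<gamma> u i)) {u..v})"
  proof
    fix i assume "i \<in> {..<d}"
    then have "abs_cont a b (\<lambda>t. \<gamma> t i)" using abs_cont_curve_component[OF assms] by simp
    from abs_cont_ftc[OF this] obtain N where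
      "negligible N" "\<And>x. x \<in> {a..b} - N \<Longrightarrow> x \<in> {a<..<b} \<and> (\<lambda>t. \<gamma> t i) differentiable (at x)"
      "\<And>k u v. (\<And>x. x \<in> {a..b} - N \<Longrightarrow> ((\<lambda>t. \<gamma> t i) has_real_derivative k x) (at x)) \<Longrightarrow>
      a \<le> u \<Longrightarrow> u \<le> v \<Longrightarrow> v \<le> b \<Longrightarrow> (k has_integral (\<gamma> v i - \<gamma> u i)) {u..v}" by blast
    then show "\<exists>N. negligible N \<and> (\<forall>x\<in>{a..b} - N. x \<in> {a<..<b} \<and> (\<lambda>t. \<gamma> t i) differentiable (at x)) \<and>
      (\<forall>k u v. (\<forall>x\<in>{a..b} - N. ((\<lambda>t. \<gamma> t i) has_real_derivative k x) (at x)) \<longrightarrow>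
      a \<le> u \<longrightarrow> u \<le> v \<longrightarrow> v \<le> b \<longrightarrow> (k has_integral (\<gamma> v i - \<gamma> u i)) {u..v})"
      by (intro exI[of _ N]) blast
  qed
  then obtain N where N: "\<And>i. i < d \<Longrightarrow> negligible (N i)"
    "\<And>i x. i < d \<Longrightarrow> x \<in> {a..b} - N i \<Longrightarrow> x \<in> {a<..<b} \<and> (\<lambda>t. \<gamma> t i) differentiable (at x)"
    "\<And>i k u v. i < d \<Longrightarrow> (\<And>x. x \<in> {a..b} - N i \<Longrightarrow> ((\<lambda>t. \<gamma> t i) has_real_derivative k x) (at x)) \<Longrightarrow>
      a \<le> u \<Longrightarrow> u \<le> v \<Longrightarrow> v \<le> b \<Longrightarrow> (k has_integral (\<gamma> v i - \<gamma> u i)) {u..v}"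
    unfolding bchoice_iff by (metis lessThan_iff)
  have der: "((\<lambda>r. \<gamma> r i) has_real_derivative velocity d a b \<gamma> t i) (at t)"
    if t: "i < d" "t \<in> {a..b} - N i" for t i
  proof -
    obtain k where k: "((\<lambda>r. \<gamma> r i) has_real_derivative k) (at t)" "a < t" "t < b"
      using N(2)[OF t] by (auto simp: real_differentiable_def)
    have "velocity d a b \<gamma> t i = k" by (rule velocity_component) (use k t in auto)
    then show ?thesis using k by simp
  qed
  show thesis
  \<comment> \<open>Each coordinate has its own null set; their finite union serves the whole
    curve.\<close>
  proof (rule that[of "\<Union>i<d. N i"])
    show "negligible (\<Union>i<d. N i)" using N(1) by (intro negligible_Union) auto
    fix i s t assume i: "i < d" "a \<le> s" "s \<le> t" "t \<le> b"
    show "((\<lambda>t. velocity d a b \<gamma> t i) has_integral (\<gamma> t i - \<gamma> s i)) {s..t}"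
      by (rule N(3)[OF i(1) der[OF i(1)] i(2-)])
  next
    fix t i assume "t \<in> {a..b} - (\<Union>i<d. N i)" "i < d"
    then show "((\<lambda>r. \<gamma> r i) has_real_derivative velocity d a b \<gamma> t i) (at t)"
      by (intro der) auto
  qed
qed

section \<open>From the Lebesgue action to gauge integrals in one dimension\<close>

lemma integrable_lebesgue_on_iff:
  "integrable (lebesgue_on {a..b::real}) f \<longleftrightarrow> f absolutely_integrable_on {a..b}" for f :: "real \<Rightarrow> real"
  by (simp add: integrable_restrict_space set_integrable_def)

lemma action_eq:
  "action d \<beta> a b U \<gamma> = (if lagrangian d \<beta> a b U \<gamma> absolutely_integrable_on {a..b}
    then ereal (integral {a..b} (lagrangian d \<beta> a b U \<gamma>)) else \<infinity>)"
  unfolding action_def by (simp add: lebesgue_integral_eq_integral flip: integrable_lebesgue_on_iff)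

lemma negligible_nonzero_of_integral_0:
  fixes f :: "real \<Rightarrow> real"
  assumes "f absolutely_integrable_on {a..b}" "\<And>x. x \<in> {a..b} \<Longrightarrow> 0 \<le> f x" "integral {a..b} f = 0"
  shows "negligible {x \<in> {a..b}. f x \<noteq> 0}"
proof -
  have int: "integrable (lebesgue_on {a..b}) f" using assms(1) by (simp add: integrable_lebesgue_on_iff)
  have "AE x in lebesgue_on {a..b}. f x = 0"
  proof (subst integral_nonneg_eq_0_iff_AE[OF int, symmetric])
    show "AE x in lebesgue_on {a..b}. 0 \<le> f x" by (rule AE_I2) (simp add: assms(2))
    show "integral\<^sup>L (lebesgue_on {a..b}) f = 0"
      using assms(3) int by (simp add: lebesgue_integral_eq_integral)
  qed
  then have "AE x in lebesgue. x \<in> {a..b} \<longrightarrow> f x = 0"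
    by (subst (asm) AE_restrict_space_iff) auto
  then show ?thesis
    by (auto simp: eventually_ae_filter_negligible elim!: negligible_subset)
qed

text \<open>Joint measurability makes \<open>u (h t) t\<close> measurable along a continuous
  \<open>h\<close>, and the bounds make it integrable, so the kinetic and the potential part of an
  action can be treated separately.\<close>

locale potential_profile =
  fixes u :: "real \<Rightarrow> real \<Rightarrow> real" and C :: real
  assumes u_measurable: "(\<lambda>(z, t). u z t) \<in> borel_measurable borel"
    and u_nonneg: "0 \<le> u z t" and u_le: "u z t \<le> C"
begin

lemma u_absolutely_integrable:
  assumes "continuous_on {a..b} h"
  shows "(\<lambda>t. u (h t) t) absolutely_integrable_on {a..b}"
proof (rule measurable_bounded_by_integrable_imp_absolutely_integrable)
  have "(\<lambda>t. (h t, t)) \<in> borel_measurable (lebesgue_on {a..b})"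
    using assms by (intro continuous_imp_measurable_on_sets_lebesgue continuous_intros) auto
  from measurable_compose[OF this u_measurable]
  show "(\<lambda>t. u (h t) t) \<in> borel_measurable (lebesgue_on {a..b})" by simp
  show "(\<lambda>_. C) integrable_on {a..b}" by (rule integrable_continuous_interval) simp
  show "norm (u (h t) t) \<le> C" for t using u_nonneg[of "h t" t] u_le[of "h t" t] by simp
qed auto

lemma action_first:
  assumes h: "continuous_on {a..b} h" and d: "1 \<le> d" and N: "negligible N"
    and der: "\<And>t. t \<in> {a..b} - N \<Longrightarrow> (h has_real_derivative k t) (at t)"
    and int: "(\<lambda>t. \<bar>k t\<bar> powr \<beta>) integrable_on {a..b}"
  shows "action d \<beta> a b (\<lambda>x t. u (x 0) t) (\<lambda>t. x(0 := h t)) =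
    ereal (integral {a..b} (\<lambda>t. \<bar>k t\<bar> powr \<beta> / \<beta> - u (h t) t))"
proof -
  let ?L = "lagrangian d \<beta> a b (\<lambda>x t. u (x 0) t) (\<lambda>t. x(0 := h t))"
  let ?f = "\<lambda>t. \<bar>k t\<bar> powr \<beta> / \<beta> - u (h t) t"
  have "(\<lambda>t. \<bar>k t\<bar> powr \<beta>) absolutely_integrable_on {a..b}"
    by (rule nonnegative_absolutely_integrable_1[OF int]) simp
  then have f: "?f absolutely_integrable_on {a..b}"
    by (intro set_integral_diff(1) u_absolutely_integrable[OF h])
      (simp add: divide_inverse mult.commute[of _ "inverse \<beta>"])
  \<comment> \<open>At \<open>a\<close> and \<open>b\<close> the velocity is one-sided, whereas
    \<open>k\<close> comes from two-sided derivatives.\<close>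
  have N': "negligible (N \<union> {a, b})" using N by simp
  have eq: "?L t = ?f t" if t: "t \<in> {a..b} - (N \<union> {a, b})" for t
  proof -
    have ab: "a < t" "t < b" using t by auto
    have 0: "velocity d a b (\<lambda>t. x(0 := h t)) t 0 = k t"
      using der[of t] t ab d by (intro velocity_component) auto
    have i: "velocity d a b (\<lambda>t. x(0 := h t)) t i = 0" if "i < d" "i \<noteq> 0" for i
      using ab that by (intro velocity_component) auto
    have "enorm d (velocity d a b (\<lambda>t. x(0 := h t)) t) = \<bar>k t\<bar>"
      using i by (subst enorm_eq_abs_first[OF d]) (auto simp: 0)
    then show ?thesis by (simp add: lagrangian_def)
  qed
  have "?L absolutely_integrable_on {a..b}"
    using absolutely_integrable_spike[OF f N' eq] by blast
  moreover have "integral {a..b} ?L = integral {a..b} ?f"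
    by (rule integral_spike[OF N']) (use eq in auto)
  ultimately show ?thesis by (simp add: action_eq)
qed

text \<open>
  The other coordinates are constant because freezing them at their terminal values does not change
  the potential energy.
\<close>

lemma minimizer_reduction:
  assumes min: "is_minimizer d \<beta> a b (\<lambda>x t. u (x 0) t) x \<gamma>"
    and d: "1 \<le> d" and \<beta>: "\<beta> > 1" and ab: "a < b" and x: "x \<in> Rd d"
  obtains k N where
    "\<And>s t. a \<le> s \<Longrightarrow> s \<le> t \<Longrightarrow> t \<le> b \<Longrightarrow> (k has_integral (\<gamma> t 0 - \<gamma> s 0)) {s..t}"
    "(\<lambda>t. \<bar>k t\<bar> powr \<beta>) integrable_on {a..b}"
    "negligible N" "\<And>t. t \<in> {a..b} - N \<Longrightarrow> ((\<lambda>t. \<gamma> t 0) has_real_derivative k t) (at t)"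
    "\<And>i t. 0 < i \<Longrightarrow> i < d \<Longrightarrow> t \<in> {a..b} \<Longrightarrow> \<gamma> t i = x i"
    "abs_cont a b (\<lambda>t. \<gamma> t 0)" "\<gamma> b 0 = x 0"
    "\<And>h kh M. abs_cont a b h \<Longrightarrow> negligible M \<Longrightarrow>
      (\<And>t. t \<in> {a..b} - M \<Longrightarrow> (h has_real_derivative kh t) (at t)) \<Longrightarrow>
      (\<lambda>t. \<bar>kh t\<bar> powr \<beta>) integrable_on {a..b} \<Longrightarrow> h b = x 0 \<Longrightarrow>
      integral {a..b} (\<lambda>t. \<bar>k t\<bar> powr \<beta> / \<beta> - u (\<gamma> t 0) t) \<le>
      integral {a..b} (\<lambda>t. \<bar>kh t\<bar> powr \<beta> / \<beta> - u (h t) t)"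
proof -
  let ?U = "\<lambda>x t. u (x 0) t"
  define v where "v = velocity d a b \<gamma>"
  define e where "e = (\<lambda>t. enorm d (v t) powr \<beta>)"
  have ac: "abs_cont_curve d a b \<gamma>" and \<gamma>b: "\<gamma> b = x"
    and opt: "\<And>\<eta>. abs_cont_curve d a b \<eta> \<Longrightarrow> \<eta> b = x \<Longrightarrow>
      action d \<beta> a b ?U \<gamma> \<le> action d \<beta> a b ?U \<eta>"
    using min by (auto simp: is_minimizer_def)
  obtain N where N: "negligible N"
    "\<And>t i. t \<in> {a..b} - N \<Longrightarrow> i < d \<Longrightarrow> ((\<lambda>r. \<gamma> r i) has_real_derivative v t i) (at t)"
    "\<And>i s t. i < d \<Longrightarrow> a \<le> s \<Longrightarrow> s \<le> t \<Longrightarrow> t \<le> b \<Longrightarrow>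
      ((\<lambda>t. v t i) has_integral (\<gamma> t i - \<gamma> s i)) {s..t}"
    using abs_cont_curve_velocity[OF ac] unfolding v_def by blast
  have ac0: "abs_cont a b (\<lambda>t. \<gamma> t 0)" using abs_cont_curve_component[OF ac] d by simp
  have cont: "continuous_on {a..b} (\<lambda>t. \<gamma> t 0)" by (rule abs_cont_continuous_on[OF ac0])
  have competitor: "action d \<beta> a b ?U \<gamma> \<le> ereal (integral {a..b} (\<lambda>t. \<bar>kh t\<bar> powr \<beta> / \<beta> - u (h t) t))"
    if "abs_cont a b h" "negligible M" "\<And>t. t \<in> {a..b} - M \<Longrightarrow> (h has_real_derivative kh t) (at t)"
      "(\<lambda>t. \<bar>kh t\<bar> powr \<beta>) integrable_on {a..b}" "h b = x 0" for h kh M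
    using opt[OF abs_cont_curve_first[OF that(1) d x]]
      action_first[OF abs_cont_continuous_on[OF that(1)] d that(2-4), of x] that(5) by simp
  \<comment> \<open>The curve resting at \<open>x\<close> has finite action, so the minimizer has
    finite action and its Lagrangian is integrable.\<close>
  have "abs_cont a b (\<lambda>_. x 0)" by (auto simp: abs_cont_def intro!: exI[of _ 1])
  from competitor[OF this negligible_empty, of "\<lambda>_. 0"]
  have "action d \<beta> a b ?U \<gamma> \<noteq> \<infinity>" using integrable_continuous_interval[of a b "\<lambda>_. 0"] by auto
  then have Lint: "lagrangian d \<beta> a b ?U \<gamma> absolutely_integrable_on {a..b}"
    and act: "action d \<beta> a b ?U \<gamma> = ereal (integral {a..b} (lagrangian d \<beta> a b ?U \<gamma>))"
    by (auto simp: action_eq split: if_splits)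
  have uint: "(\<lambda>t. u (\<gamma> t 0) t) absolutely_integrable_on {a..b}"
    by (rule u_absolutely_integrable[OF cont])
  have Leq: "lagrangian d \<beta> a b ?U \<gamma> = (\<lambda>t. e t / \<beta> - u (\<gamma> t 0) t)"
    by (auto simp: lagrangian_def e_def v_def)
  \<comment> \<open>Adding the integrable potential back isolates the kinetic term.\<close>
  have "(\<lambda>t. \<beta> * ((e t / \<beta> - u (\<gamma> t 0) t) + u (\<gamma> t 0) t)) absolutely_integrable_on {a..b}"
    using Lint uint unfolding Leq by (intro set_integrable_mult_right set_integral_add(1))
  then have eint: "e absolutely_integrable_on {a..b}" using \<beta> by simp
  have v0: "(\<lambda>t. v t 0) integrable_on {a..b}"
    using N(3)[of 0 a b] d ab by auto
  have "(\<lambda>t. \<bar>v t 0\<bar> powr \<beta>) absolutely_integrable_on {a..b}"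
  proof (rule measurable_bounded_by_integrable_imp_absolutely_integrable)
    have "(\<lambda>t. v t 0) \<in> borel_measurable (lebesgue_on {a..b})"
      using v0 by (rule integrable_imp_measurable)
    then show "(\<lambda>t. \<bar>v t 0\<bar> powr \<beta>) \<in> borel_measurable (lebesgue_on {a..b})" by measurable
    show "e integrable_on {a..b}" using eint absolutely_integrable_on_def by blast
    show "norm (\<bar>v t 0\<bar> powr \<beta>) \<le> e t" for t
      using abs_component_le_enorm[of 0 d "v t"] d \<beta> by (simp add: e_def powr_mono2)
  qed auto
  then have v0int: "(\<lambda>t. \<bar>v t 0\<bar> powr \<beta>) absolutely_integrable_on {a..b}"
    "(\<lambda>t. \<bar>v t 0\<bar> powr \<beta>) integrable_on {a..b}"
    using absolutely_integrable_on_def by blast+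
  have der0: "\<And>t. t \<in> {a..b} - N \<Longrightarrow> ((\<lambda>t. \<gamma> t 0) has_real_derivative v t 0) (at t)"
    using N(2) d by auto
  \<comment> \<open>The competitor keeps coordinate 0 of the minimizer. As pointwise
    \<open>e t\<close> is at least \<open>\<bar>v t 0\<bar> powr \<beta>\<close>, this inequality
    forces equality almost everywhere, that is, vanishing of the other velocity components.\<close>
  have le: "integral {a..b} (\<lambda>t. e t / \<beta> - u (\<gamma> t 0) t) \<le>
      integral {a..b} (\<lambda>t. \<bar>v t 0\<bar> powr \<beta> / \<beta> - u (\<gamma> t 0) t)"
    using competitor[OF ac0 N(1) der0 v0int(2)] \<gamma>b by (simp add: act Leq)
  have ui: "(\<lambda>t. u (\<gamma> t 0) t) integrable_on {a..b}" and ei: "e integrable_on {a..b}"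
    using uint eint absolutely_integrable_on_def by blast+
  have diffint: "(\<lambda>t. e t - \<bar>v t 0\<bar> powr \<beta>) absolutely_integrable_on {a..b}"
    by (rule set_integral_diff(1)[OF eint v0int(1)])
  have nonneg: "0 \<le> e t - \<bar>v t 0\<bar> powr \<beta>" for t
    using abs_component_le_enorm[of 0 d "v t"] d \<beta> by (simp add: e_def powr_mono2)
  have "integral {a..b} (\<lambda>t. e t - \<bar>v t 0\<bar> powr \<beta>) = 0"
  proof (rule antisym)
    have "(\<lambda>t. e t / \<beta>) integrable_on {a..b}" "(\<lambda>t. \<bar>v t 0\<bar> powr \<beta> / \<beta>) integrable_on {a..b}"
      using ei v0int(2) by (auto intro: integrable_on_divide)
    then have "integral {a..b} e / \<beta> \<le> integral {a..b} (\<lambda>t. \<bar>v t 0\<bar> powr \<beta>) / \<beta>"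
      using le ui by (simp add: integral_diff)
    then have "integral {a..b} e \<le> integral {a..b} (\<lambda>t. \<bar>v t 0\<bar> powr \<beta>)"
      using \<beta> by (simp add: divide_le_cancel)
    then show "integral {a..b} (\<lambda>t. e t - \<bar>v t 0\<bar> powr \<beta>) \<le> 0"
      using ei v0int(2) by (simp add: integral_diff)
    show "0 \<le> integral {a..b} (\<lambda>t. e t - \<bar>v t 0\<bar> powr \<beta>)"
      using nonneg by (intro Henstock_Kurzweil_Integration.integral_nonneg integrable_diff ei v0int(2)) auto
  qed
  then have Z: "negligible {t \<in> {a..b}. e t - \<bar>v t 0\<bar> powr \<beta> \<noteq> 0}" (is "negligible ?Z")
    using negligible_nonzero_of_integral_0[OF diffint] nonneg by blast
  have vi: "v t i = 0" if "t \<in> {a..b} - ?Z" "0 < i" "i < d" for t i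
  proof -
    have "enorm d (v t) powr \<beta> = \<bar>v t 0\<bar> powr \<beta>" using that(1) by (auto simp: e_def)
    then have "(enorm d (v t) powr \<beta>) powr (1 / \<beta>) = (\<bar>v t 0\<bar> powr \<beta>) powr (1 / \<beta>)" by simp
    then have "enorm d (v t) = \<bar>v t 0\<bar>" using \<beta> by (simp add: powr_powr enorm_nonneg)
    then show ?thesis using enorm_eq_abs_first_imp_zero that by blast
  qed
  have perp: "\<gamma> t i = x i" if i: "0 < i" "i < d" and t: "t \<in> {a..b}" for i t
  proof -
    have "((\<lambda>t. v t i) has_integral (\<gamma> b i - \<gamma> t i)) {t..b}" using N(3) i t by auto
    moreover have "((\<lambda>t. v t i) has_integral 0) {t..b}"
    proof (rule has_integral_spike[OF Z _ has_integral_0])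
      fix s assume "s \<in> {t..b} - ?Z"
      then have "s \<in> {a..b} - ?Z" using t by auto
      from vi[OF this i] show "v s i = 0" .
    qed
    ultimately have "\<gamma> b i - \<gamma> t i = 0" by (rule has_integral_unique)
    then show ?thesis using \<gamma>b by simp
  qed
  have eq: "integral {a..b} (\<lambda>t. e t / \<beta> - u (\<gamma> t 0) t) =
      integral {a..b} (\<lambda>t. \<bar>v t 0\<bar> powr \<beta> / \<beta> - u (\<gamma> t 0) t)"
    by (rule integral_spike[OF Z]) auto
  show thesis
  proof (rule that[of "\<lambda>t. v t 0" N])
    show "integral {a..b} (\<lambda>t. \<bar>v t 0\<bar> powr \<beta> / \<beta> - u (\<gamma> t 0) t) \<le>
      integral {a..b} (\<lambda>t. \<bar>kh t\<bar> powr \<beta> / \<beta> - u (h t) t)"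
      if "abs_cont a b h" "negligible M"
      "\<And>t. t \<in> {a..b} - M \<Longrightarrow> (h has_real_derivative kh t) (at t)"
      "(\<lambda>t. \<bar>kh t\<bar> powr \<beta>) integrable_on {a..b}" "h b = x 0" for h kh M
      using competitor[OF that] eq by (simp add: act Leq)
    show "((\<lambda>t. v t 0) has_integral \<gamma> t 0 - \<gamma> s 0) {s..t}" if "a \<le> s" "s \<le> t" "t \<le> b" for s t
      using N(3)[of 0 s t] d that by simp
    show "\<gamma> b 0 = x 0" using \<gamma>b by simp
  qed (fact v0int(2) N(1) der0 perp ac0)+
qed

end

subsection \<open>Convexity of the kinetic term\<close>

text \<open>For \<open>w > 0\<close>, multiply
  \<open>w powr (\<beta> - 1) > 1 + (\<beta> - 1) * (1 - 1 / w)\<close> by \<open>w\<close>; this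
  follows from \<open>1 - 1 / w < ln w\<close> and \<open>1 + x \<le> exp x\<close>. For
  \<open>w \<le> 0\<close> the right side is at most \<open>1 - \<beta> < 0\<close>.\<close>

lemma powr_tangent_one:
  fixes w \<beta> :: real
  assumes "\<beta> > 1" "w \<noteq> 1"
  shows "\<bar>w\<bar> powr \<beta> > 1 + \<beta> * (w - 1)"
proof (cases "w > 0")
  case False
  then have "\<beta> * (w - 1) \<le> - \<beta>" using assms by (simp add: algebra_simps mult_nonneg_nonpos)
  moreover have "0 \<le> \<bar>w\<bar> powr \<beta>" by simp
  ultimately show ?thesis using assms(1) by linarith
next
  case True
  have "ln (1 / w) < 1 / w - 1"
    using ln_le_minus_one[of "1 / w"] ln_eq_minus_one[of "1 / w"] True assms(2) by force
  then have "1 - 1 / w < ln w" using True by (simp add: ln_div)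
  then have "(\<beta> - 1) * (1 - 1 / w) < (\<beta> - 1) * ln w" using assms(1) by simp
  also have "\<dots> \<le> exp ((\<beta> - 1) * ln w) - 1" using exp_ge_add_one_self[of "(\<beta> - 1) * ln w"] by linarith
  also have "exp ((\<beta> - 1) * ln w) = w powr (\<beta> - 1)" using True by (simp add: powr_def)
  finally have "w * (1 + (\<beta> - 1) * (1 - 1 / w)) < w * w powr (\<beta> - 1)" using True by simp
  also have "w * w powr (\<beta> - 1) = w powr \<beta>" using True by (simp add: powr_mult_base)
  finally have "w * (1 + (\<beta> - 1) * (1 - 1 / w)) < w powr \<beta>" .
  moreover have "w * (1 + (\<beta> - 1) * (1 - 1 / w)) = 1 + \<beta> * (w - 1)"
    using True by (simp add: field_simps)
  ultimately show ?thesis using True by simp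
qed

lemma powr_tangent_pos:
  fixes z v \<beta> :: real
  assumes "\<beta> > 1" "v > 0" "z \<noteq> v"
  shows "\<bar>z\<bar> powr \<beta> > v powr \<beta> + \<beta> * v powr (\<beta> - 1) * (z - v)"
proof -
  have "v powr \<beta> * (1 + \<beta> * (z / v - 1)) < v powr \<beta> * \<bar>z / v\<bar> powr \<beta>"
    using powr_tangent_one[OF assms(1), of "z / v"] assms by simp
  also have "\<dots> = \<bar>z\<bar> powr \<beta>" using assms by (simp add: powr_mult[symmetric] abs_divide)
  also have "v powr \<beta> * (1 + \<beta> * (z / v - 1)) = v powr \<beta> + \<beta> * v powr (\<beta> - 1) * (z - v)"
  proof -
    have "v powr \<beta> = v * v powr (\<beta> - 1)" using assms by (simp add: powr_mult_base)
    then show ?thesis using assms by (simp add: field_simps)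
  qed
  finally show ?thesis .
qed

text \<open>Homogeneity and reflection reduce this to the tangent at 1. Strictness is what later
  identifies the equality case of Jensen's inequality.\<close>

lemma powr_strict_tangent:
  fixes z v \<beta> :: real
  assumes "\<beta> > 1" "z \<noteq> v"
  shows "\<bar>z\<bar> powr \<beta> > \<bar>v\<bar> powr \<beta> + \<beta> * \<bar>v\<bar> powr (\<beta> - 1) * sgn v * (z - v)"
proof -
  consider "v > 0" | "v = 0" | "v < 0" by linarith
  then show ?thesis
  proof cases
    case 1
    then show ?thesis using powr_tangent_pos[OF assms(1) 1 assms(2)] by simp
  next
    case 3
    then show ?thesis using powr_tangent_pos[OF assms(1), of "- v" "- z"] assms(2)
      by (simp add: algebra_simps)
  qed (use assms in simp)
qed

lemma powr_tangent:
  fixes z v \<beta> :: real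
  assumes "\<beta> > 1"
  shows "\<bar>z\<bar> powr \<beta> \<ge> \<bar>v\<bar> powr \<beta> + \<beta> * \<bar>v\<bar> powr (\<beta> - 1) * sgn v * (z - v)"
  using powr_strict_tangent[OF assms, of z v] by (cases "z = v") auto

text \<open>The extra energy of a broken line over the straight one with the same ends. The tangents
  at \<open>v0\<close> and \<open>v1\<close>, evaluated at the mean slope \<open>v\<close>, have
  linear terms that combine because \<open>\<sigma> * (v0 - v) = \<rho> * (v - v1)\<close>.\<close>

lemma powr_two_slope_gap:
  fixes \<beta> \<sigma> \<rho> v0 v1 v :: real
  assumes \<beta>: "\<beta> > 1" and "\<sigma> > 0" "\<rho> > 0" "0 < v1" "v1 \<le> v0"
    and v: "(\<sigma> + \<rho>) * v = \<sigma> * v0 + \<rho> * v1"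
  shows "\<sigma> * v0 powr \<beta> + \<rho> * v1 powr \<beta> - (\<sigma> + \<rho>) * v powr \<beta> \<le>
    \<beta> * \<sigma> * (v0 - v1) * (v0 powr (\<beta> - 1) - v1 powr (\<beta> - 1))"
proof -
  have "(\<sigma> + \<rho>) * v > 0" unfolding v using assms by (intro add_pos_pos mult_pos_pos) auto
  then have vpos: "v > 0" using assms by (intro zero_less_mult_pos[of "\<sigma> + \<rho>" v]) auto
  define A where "A = v0 powr (\<beta> - 1)"
  define B where "B = v1 powr (\<beta> - 1)"
  have AB: "B \<le> A" unfolding A_def B_def using assms by (intro powr_mono2) auto
  have "v powr \<beta> \<ge> v0 powr \<beta> + \<beta> * A * (v - v0)" "v powr \<beta> \<ge> v1 powr \<beta> + \<beta> * B * (v - v1)"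
    using powr_tangent[OF \<beta>, of v0 v] powr_tangent[OF \<beta>, of v1 v] assms vpos
    by (simp_all add: A_def B_def)
  then have "\<sigma> * (v0 powr \<beta> + \<beta> * A * (v - v0)) + \<rho> * (v1 powr \<beta> + \<beta> * B * (v - v1)) \<le>
      \<sigma> * v powr \<beta> + \<rho> * v powr \<beta>"
    using assms by (intro add_mono mult_left_mono) auto
  moreover define x where "x = \<sigma> * (v0 - v)"
  have x': "x = \<rho> * (v - v1)" using v by (simp add: x_def algebra_simps)
  have "x \<le> \<sigma> * (v0 - v1)"
  proof -
    have "(\<sigma> + \<rho>) * v1 \<le> (\<sigma> + \<rho>) * v" unfolding v using assms by (simp add: algebra_simps)
    moreover have "\<sigma> + \<rho> > 0" using assms by simp
    ultimately have "v1 \<le> v" by (rule mult_left_le_imp_le)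
    then show ?thesis unfolding x_def using assms by simp
  qed
  then have "\<beta> * (A - B) * x \<le> \<beta> * (A - B) * (\<sigma> * (v0 - v1))"
    using AB \<beta> by (intro mult_left_mono) auto
  moreover have "\<sigma> * (\<beta> * A * (v - v0)) = - \<beta> * A * x" by (simp add: x_def algebra_simps)
  moreover have "\<rho> * (\<beta> * B * (v - v1)) = \<beta> * B * x" by (simp add: x' algebra_simps)
  ultimately show ?thesis by (simp add: A_def[symmetric] B_def[symmetric] algebra_simps)
qed

text \<open>For \<open>\<beta> < 2\<close> the power \<open>\<beta> - 1\<close> is concave and its
  tangent inequality points the wrong way. Bernoulli's inequality for the exponent
  \<open>\<beta>\<close> together with \<open>y powr \<beta> \<le> y powr (\<beta> - 1)\<close> for
  \<open>y \<le> 1\<close> treats all \<open>\<beta> > 1\<close> alike.\<close>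

lemma powr_diff_le:
  fixes w D \<beta> :: real
  assumes "\<beta> > 1" "0 \<le> D" "D < w"
  shows "w powr (\<beta> - 1) - (w - D) powr (\<beta> - 1) \<le> w powr (\<beta> - 1) * (\<beta> * (D / w))"
proof -
  define y where "y = (w - D) / w"
  have y: "0 < y" "y \<le> 1" using assms by (auto simp: y_def)
  have "1 - \<beta> * (D / w) \<le> y powr \<beta>"
    using powr_tangent[OF assms(1), of 1 y] y assms by (simp add: y_def diff_divide_distrib)
  also have "\<dots> \<le> y powr (\<beta> - 1)" using y by (intro powr_mono') auto
  finally have "w powr (\<beta> - 1) * (1 - \<beta> * (D / w)) \<le> w powr (\<beta> - 1) * y powr (\<beta> - 1)"
    by (intro mult_left_mono) auto
  also have "\<dots> = (w - D) powr (\<beta> - 1)"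
    using y assms by (subst powr_mult[symmetric]) (auto simp: y_def)
  finally show ?thesis by (simp add: algebra_simps)
qed

section \<open>Operations that preserve absolute continuity\<close>

text \<open>Intervals starting at or after \<open>c\<close> contribute nothing, the others are
  truncated at \<open>c\<close>. Truncation is injective because disjoint intervals have different
  left ends.\<close>

lemma abs_cont_clip:
  assumes ac: "abs_cont a b g" and c: "a \<le> c"
  shows "abs_cont a b (\<lambda>t. g (min t c))"
  unfolding abs_cont_def
proof (intro allI impI)
  fix \<epsilon> :: real assume "\<epsilon> > 0"
  then obtain \<delta> where \<delta>: "\<delta> > 0" "\<And>P. interval_family a b P \<Longrightarrow> (\<Sum>(u, v)\<in>P. v - u) < \<delta> \<Longrightarrow>
      (\<Sum>(u, v)\<in>P. \<bar>g v - g u\<bar>) < \<epsilon>"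
    using ac unfolding abs_cont_def by meson
  have "(\<Sum>(u, v)\<in>P. \<bar>g (min v c) - g (min u c)\<bar>) < \<epsilon>"
    if P: "interval_family a b P" and len: "(\<Sum>(u, v)\<in>P. v - u) < \<delta>" for P
  proof -
    define P' where "P' = {p \<in> P. fst p < c}"
    define F where "F = (\<lambda>(u, v). (u, min v c) :: real \<times> real)"
    have fin: "finite P" "finite P'" using P by (auto simp: interval_family_def P'_def)
    have Pb: "a \<le> u \<and> u < v \<and> v \<le> b" if "(u, v) \<in> P" for u v
      using interval_family_bounds[OF P that] .
    have dj: "{u<..<v} \<inter> {u'<..<v'} = {}" if "(u, v) \<in> P" "(u', v') \<in> P" "(u, v) \<noteq> (u', v')" for u v u' v'
    proof -
      have "pairwise (\<lambda>p q. {fst p<..<snd p} \<inter> {fst q<..<snd q} = {}) P"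
        using P by (simp add: interval_family_def)
      from pairwiseD[OF this that] show ?thesis by simp
    qed
    have inj: "inj_on F P'"
    proof (rule inj_onI, clarify)
      fix u v u' v' assume uv: "(u, v) \<in> P'" "(u', v') \<in> P'" "F (u, v) = F (u', v')"
      then have inP: "(u, v) \<in> P" "(u', v') \<in> P" by (auto simp: P'_def)
      show "u = u' \<and> v = v'"
      proof (rule ccontr)
        assume "\<not> ?thesis"
        then have "{u<..<v} \<inter> {u'<..<v'} = {}" using dj inP by auto
        from open_intervals_disjoint[OF this] show False
          using Pb inP uv(3) by (fastforce simp: F_def)
      qed
    qed
    have fam: "interval_family a b (F ` P')"
      unfolding interval_family_def
    proof (intro conjI)
      show "\<forall>(u, v)\<in>F ` P'. a \<le> u \<and> u < v \<and> v \<le> b"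
        using Pb by (auto simp: F_def P'_def) (meson Pb min.coboundedI1)
      show "pairwise (\<lambda>p q. {fst p<..<snd p} \<inter> {fst q<..<snd q} = {}) (F ` P')"
      proof (rule pairwiseI)
        fix i j assume ij: "i \<in> F ` P'" "j \<in> F ` P'" "i \<noteq> j"
        then obtain u v u' v' where *: "(u, v) \<in> P" "(u', v') \<in> P" "i = (u, min v c)" "j = (u', min v' c)"
          by (auto simp: F_def P'_def)
        show "{fst i<..<snd i} \<inter> {fst j<..<snd j} = {}"
        proof -
          have "{u<..<v} \<inter> {u'<..<v'} = {}" using ij(3) * by (intro dj) auto
          moreover have "{fst i<..<snd i} \<subseteq> {u<..<v}" "{fst j<..<snd j} \<subseteq> {u'<..<v'}" using * by auto
          ultimately show ?thesis by blast
        qed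
      qed
    qed (use fin in simp)
    have "(\<Sum>(u, v)\<in>F ` P'. v - u) = (\<Sum>(u, v)\<in>P'. min v c - u)"
      unfolding sum.reindex[OF inj] by (simp add: F_def o_def split_beta)
    also have "\<dots> \<le> (\<Sum>(u, v)\<in>P'. v - u)" by (intro sum_mono) auto
    also have "\<dots> \<le> (\<Sum>(u, v)\<in>P. v - u)"
      using Pb fin by (intro sum_mono2) (force simp: P'_def)+
    finally have "(\<Sum>(u, v)\<in>F ` P'. \<bar>g v - g u\<bar>) < \<epsilon>" using \<delta>(2)[OF fam] len by simp
    moreover have "(\<Sum>(u, v)\<in>F ` P'. \<bar>g v - g u\<bar>) = (\<Sum>(u, v)\<in>P'. \<bar>g (min v c) - g (min u c)\<bar>)"
      unfolding sum.reindex[OF inj] by (intro sum.cong) (auto simp: F_def P'_def)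
    moreover have "\<dots> = (\<Sum>(u, v)\<in>P. \<bar>g (min v c) - g (min u c)\<bar>)"
    proof (rule sum.mono_neutral_left)
      show "\<forall>i\<in>P - P'. (case i of (u, v) \<Rightarrow> \<bar>g (min v c) - g (min u c)\<bar>) = 0"
        using Pb by (fastforce simp: P'_def min_absorb2)
    qed (use fin in \<open>auto simp: P'_def\<close>)
    ultimately show ?thesis by simp
  qed
  then show "\<exists>\<delta>>0. \<forall>P. interval_family a b P \<longrightarrow> (\<Sum>(u, v)\<in>P. v - u) < \<delta> \<longrightarrow>
      (\<Sum>(u, v)\<in>P. \<bar>g (min v c) - g (min u c)\<bar>) < \<epsilon>" using \<delta>(1) by blast
qed

lemma abs_cont_add:
  assumes f: "abs_cont a b f" and g: "abs_cont a b g"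
  shows "abs_cont a b (\<lambda>t. f t + g t)"
  unfolding abs_cont_def
proof (intro allI impI)
  fix \<epsilon> :: real assume "\<epsilon> > 0"
  then have "\<epsilon> / 2 > 0" by simp
  obtain d1 where d1: "d1 > 0" "\<And>P. interval_family a b P \<Longrightarrow> (\<Sum>(u, v)\<in>P. v - u) < d1 \<Longrightarrow>
      (\<Sum>(u, v)\<in>P. \<bar>f v - f u\<bar>) < \<epsilon> / 2"
    using f \<open>\<epsilon> / 2 > 0\<close> unfolding abs_cont_def by meson
  obtain d2 where d2: "d2 > 0" "\<And>P. interval_family a b P \<Longrightarrow> (\<Sum>(u, v)\<in>P. v - u) < d2 \<Longrightarrow>
      (\<Sum>(u, v)\<in>P. \<bar>g v - g u\<bar>) < \<epsilon> / 2"
    using g \<open>\<epsilon> / 2 > 0\<close> unfolding abs_cont_def by meson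
  have "(\<Sum>(u, v)\<in>P. \<bar>f v + g v - (f u + g u)\<bar>) < \<epsilon>"
    if "interval_family a b P" "(\<Sum>(u, v)\<in>P. v - u) < min d1 d2" for P
  proof -
    have "(\<Sum>(u, v)\<in>P. \<bar>f v + g v - (f u + g u)\<bar>) \<le> (\<Sum>(u, v)\<in>P. \<bar>f v - f u\<bar> + \<bar>g v - g u\<bar>)"
      by (intro sum_mono) auto
    also have "\<dots> = (\<Sum>(u, v)\<in>P. \<bar>f v - f u\<bar>) + (\<Sum>(u, v)\<in>P. \<bar>g v - g u\<bar>)"
      by (simp add: split_beta sum.distrib)
    also have "\<dots> < \<epsilon>" using d1(2)[OF that(1)] d2(2)[OF that(1)] that(2) by simp
    finally show ?thesis .
  qed
  then show "\<exists>\<delta>>0. \<forall>P. interval_family a b P \<longrightarrow> (\<Sum>(u, v)\<in>P. v - u) < \<delta> \<longrightarrow>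
      (\<Sum>(u, v)\<in>P. \<bar>f v + g v - (f u + g u)\<bar>) < \<epsilon>"
    using d1(1) d2(1) by (intro exI[of _ "min d1 d2"]) auto
qed

lemma abs_cont_lipschitz:
  assumes "\<And>u v. \<bar>f v - f u\<bar> \<le> L * \<bar>v - u :: real\<bar>"
  shows "abs_cont a b f"
  unfolding abs_cont_def
proof (intro allI impI)
  fix \<epsilon> :: real assume "\<epsilon> > 0"
  define L' where "L' = \<bar>L\<bar> + 1"
  have "(\<Sum>(u, v)\<in>P. \<bar>f v - f u\<bar>) < \<epsilon>"
    if P: "interval_family a b P" "(\<Sum>(u, v)\<in>P. v - u) < \<epsilon> / L'" for P
  proof -
    have "(\<Sum>(u, v)\<in>P. \<bar>f v - f u\<bar>) \<le> (\<Sum>(u, v)\<in>P. L' * (v - u))"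
    proof (intro sum_mono, clarify)
      fix u v assume "(u, v) \<in> P"
      then have "u < v" using interval_family_bounds[OF P(1)] by blast
      have "\<bar>f v - f u\<bar> \<le> L * \<bar>v - u\<bar>" by (rule assms)
      also have "\<dots> \<le> L' * (v - u)" using \<open>u < v\<close> by (auto simp: L'_def intro!: mult_right_mono)
      finally show "\<bar>f v - f u\<bar> \<le> L' * (v - u)" .
    qed
    also have "\<dots> = L' * (\<Sum>(u, v)\<in>P. v - u)" by (simp add: split_beta sum_distrib_left)
    also have "\<dots> < \<epsilon>" using P(2) by (simp add: L'_def field_simps)
    finally show ?thesis .
  qed
  moreover have "\<epsilon> / L' > 0" using \<open>\<epsilon> > 0\<close> by (simp add: L'_def)
  ultimately show "\<exists>\<delta>>0. \<forall>P. interval_family a b P \<longrightarrow> (\<Sum>(u, v)\<in>P. v - u) < \<delta> \<longrightarrow>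
      (\<Sum>(u, v)\<in>P. \<bar>f v - f u\<bar>) < \<epsilon>" by blast
qed

subsection \<open>Competitors\<close>

text \<open>Competitors share only the terminal value; the condition \<open>h b = g b\<close> has no
  counterpart at \<open>a\<close> because the initial point is free.\<close>

locale scalar_minimizer = potential_profile +
  fixes a b \<beta> :: real and g k :: "real \<Rightarrow> real" and N :: "real set"
  assumes \<beta>: "\<beta> > 1" and ab: "a < b"
    and g_abs_cont: "abs_cont a b g"
    and negligible_N: "negligible N"
    and g_deriv: "\<And>t. t \<in> {a..b} - N \<Longrightarrow> (g has_real_derivative k t) (at t)"
    and k_has_integral: "\<And>s t. a \<le> s \<Longrightarrow> s \<le> t \<Longrightarrow> t \<le> b \<Longrightarrow> (k has_integral (g t - g s)) {s..t}"
    and k_integrable: "(\<lambda>t. \<bar>k t\<bar> powr \<beta>) integrable_on {a..b}"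
    and optimal: "\<And>h kh M. abs_cont a b h \<Longrightarrow> negligible M \<Longrightarrow>
      (\<And>t. t \<in> {a..b} - M \<Longrightarrow> (h has_real_derivative kh t) (at t)) \<Longrightarrow>
      (\<lambda>t. \<bar>kh t\<bar> powr \<beta>) integrable_on {a..b} \<Longrightarrow> h b = g b \<Longrightarrow>
      integral {a..b} (\<lambda>t. \<bar>k t\<bar> powr \<beta> / \<beta> - u (g t) t) \<le>
      integral {a..b} (\<lambda>t. \<bar>kh t\<bar> powr \<beta> / \<beta> - u (h t) t)"
begin

lemma u_integrable: "continuous_on {c..d} h \<Longrightarrow> (\<lambda>t. u (h t) t) integrable_on {c..d}"
  using u_absolutely_integrable absolutely_integrable_on_def by blast

lemma integral_u_le:
  assumes h: "continuous_on {c..d} h" and m: "c \<le> m" "m \<le> d"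
    and zero: "\<And>t. c < t \<Longrightarrow> t < m \<Longrightarrow> u (h t) t = 0"
  shows "integral {c..d} (\<lambda>t. u (h t) t) \<le> C * (d - m)"
proof -
  let ?f = "\<lambda>t. u (h t) t"
  have "integral {c..m} ?f = integral {c..m} (\<lambda>_. 0 :: real)"
    by (rule integral_spike[of "{c, m}"]) (use zero in auto)
  moreover have "integral {m..d} ?f \<le> integral {m..d} (\<lambda>_. C)"
    using m by (intro Henstock_Kurzweil_Integration.integral_le u_integrable continuous_on_subset[OF h] u_le
        integrable_continuous_interval) auto
  moreover have "integral {c..d} ?f = integral {c..m} ?f + integral {m..d} ?f"
    using Henstock_Kurzweil_Integration.integral_combine[OF m u_integrable[OF h]] by simp
  ultimately show ?thesis using m by (simp add: mult.commute)
qed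

lemma integral_u_ge:
  assumes h: "continuous_on {c..d} h" and m: "c \<le> m" "m \<le> m'" "m' \<le> d"
    and full: "\<And>t. m < t \<Longrightarrow> t < m' \<Longrightarrow> u (h t) t = C"
  shows "C * (m' - m) \<le> integral {c..d} (\<lambda>t. u (h t) t)"
proof -
  let ?f = "\<lambda>t. u (h t) t"
  have "integral {m..m'} ?f = integral {m..m'} (\<lambda>_. C)"
    by (rule integral_spike[of "{m, m'}"]) (use full in auto)
  moreover have "integral {m..m'} ?f \<le> integral {c..d} ?f"
    using m u_nonneg by (intro integral_subset_le u_integrable continuous_on_subset[OF h]) auto
  ultimately show ?thesis using m by (simp add: mult.commute)
qed

lemma k_powr_integrable: "a \<le> c \<Longrightarrow> d \<le> b \<Longrightarrow> (\<lambda>t. \<bar>k t\<bar> powr \<beta>) integrable_on {c..d}"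
  using integrable_on_subinterval[OF k_integrable] by simp

lemma g_continuous: "a \<le> c \<Longrightarrow> d \<le> b \<Longrightarrow> continuous_on {c..d} g"
  using abs_cont_continuous_on[OF g_abs_cont] by (rule continuous_on_subset) auto

text \<open>Since \<open>v\<close> is the mean velocity on \<open>[c, b]\<close>, the linear term of
  the tangent integrates to 0. Integrating the tangent inequality then gives Jensen's
  inequality.\<close>

lemma tangent_has_integral:
  assumes c: "a \<le> c" "c \<le> b" and v: "g b - g c = v * (b - c)"
  shows "((\<lambda>t. \<bar>v\<bar> powr \<beta> + \<beta> * \<bar>v\<bar> powr (\<beta> - 1) * sgn v * (k t - v)) has_integral
    (b - c) * \<bar>v\<bar> powr \<beta>) {c..b}"
proof -
  have "((\<lambda>t. k t - v) has_integral (g b - g c - (b - c) *\<^sub>R v)) {c..b}"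
    using c has_integral_const_real[of v c b] by (intro has_integral_diff k_has_integral) auto
  then have "((\<lambda>t. \<beta> * \<bar>v\<bar> powr (\<beta> - 1) * sgn v * (k t - v)) has_integral
      \<beta> * \<bar>v\<bar> powr (\<beta> - 1) * sgn v * 0) {c..b}"
    using v by (intro has_integral_mult_right) (simp add: mult.commute)
  from has_integral_add[OF has_integral_const_real[of "\<bar>v\<bar> powr \<beta>" c b] this]
  show ?thesis using c by simp
qed

lemma kinetic_lower:
  assumes c: "a \<le> c" "c \<le> b" and v: "g b - g c = v * (b - c)"
  shows "(b - c) * \<bar>v\<bar> powr \<beta> \<le> integral {c..b} (\<lambda>t. \<bar>k t\<bar> powr \<beta>)"
  using has_integral_le[OF tangent_has_integral[OF assms] integrable_integral[OF k_powr_integrable]]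
    powr_tangent[OF \<beta>] c by simp

text \<open>Equality case of Jensen: the excess over the tangent is nonnegative with integral at
  most 0, hence zero almost everywhere, and strict convexity gives \<open>k s = v\<close>
  there.\<close>

lemma kinetic_equality_affine:
  assumes c: "a \<le> c" "c < b" and v: "g b - g c = v * (b - c)"
    and eq: "integral {c..b} (\<lambda>t. \<bar>k t\<bar> powr \<beta>) \<le> (b - c) * \<bar>v\<bar> powr \<beta>"
    and t: "t \<in> {c..b}"
  shows "g t = g b - v * (b - t)"
proof -
  define f where "f = (\<lambda>t. \<bar>k t\<bar> powr \<beta> - (\<bar>v\<bar> powr \<beta> + \<beta> * \<bar>v\<bar> powr (\<beta> - 1) * sgn v * (k t - v)))"
  have f0: "f t \<ge> 0" for t using powr_tangent[OF \<beta>, of v "k t"] by (simp add: f_def)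
  have "(f has_integral (integral {c..b} (\<lambda>t. \<bar>k t\<bar> powr \<beta>) - (b - c) * \<bar>v\<bar> powr \<beta>)) {c..b}"
    unfolding f_def using c v
    by (intro has_integral_diff tangent_has_integral integrable_integral k_powr_integrable) auto
  then have f: "f integrable_on {c..b}" "integral {c..b} f \<le> 0"
    using eq by (auto simp: has_integral_iff)
  then have "f absolutely_integrable_on {c..b}"
    using f0 by (intro nonnegative_absolutely_integrable_1) auto
  moreover have "integral {c..b} f = 0"
    using f f0 by (intro antisym Henstock_Kurzweil_Integration.integral_nonneg) auto
  ultimately have Z: "negligible {x \<in> {c..b}. f x \<noteq> 0}" (is "negligible ?Z")
    using f0 by (intro negligible_nonzero_of_integral_0) auto
  have "(k has_integral (g b - g t)) {t..b}" using c t by (intro k_has_integral) auto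
  moreover have "(k has_integral ((b - t) *\<^sub>R v)) {t..b}"
  proof (rule has_integral_spike[OF Z])
    show "((\<lambda>_. v) has_integral (b - t) *\<^sub>R v) {t..b}" using has_integral_const_real[of v t b] t by simp
    show "k s = v" if "s \<in> {t..b} - ?Z" for s
    proof -
      have "f s = 0" using that t by auto
      then show ?thesis using powr_strict_tangent[OF \<beta>, of "k s" v] by (auto simp: f_def)
    qed
  qed
  ultimately have "g b - g t = (b - t) *\<^sub>R v" by (rule has_integral_unique)
  then show ?thesis by (simp add: algebra_simps)
qed

text \<open>The competitor follows \<open>g'\<close> up to \<open>c\<close>, then has slope
  \<open>v1\<close> up to \<open>c'\<close> and slope \<open>v0\<close> up to \<open>b\<close>. The
  base curve \<open>g'\<close> is a parameter because both the minimizer itself and a constant are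
  used.\<close>

lemma piecewise_competitor:
  assumes c: "a \<le> c" "c \<le> c'" "c' \<le> b"
    and base: "abs_cont a b g'" "negligible N'"
      "\<And>t. t \<in> {a..b} - N' \<Longrightarrow> (g' has_real_derivative k' t) (at t)"
      "(\<lambda>t. \<bar>k' t\<bar> powr \<beta>) integrable_on {a..b}"
    and "end": "g' c + v1 * (c' - c) + v0 * (b - c') = g b"
  shows "integral {a..b} (\<lambda>t. \<bar>k t\<bar> powr \<beta> / \<beta> - u (g t) t) \<le>
    integral {a..c} (\<lambda>t. \<bar>k' t\<bar> powr \<beta> / \<beta> - u (g' t) t) +
    ((c' - c) * \<bar>v1\<bar> powr \<beta> + (b - c') * \<bar>v0\<bar> powr \<beta>) / \<beta> -
    integral {c..b} (\<lambda>t. u (g' c + v1 * (min t c' - c) + v0 * max 0 (t - c')) t)"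
proof -
  \<comment> \<open>Clipping writes the spliced curve as a sum of a frozen copy of \<open>g'\<close>
    and a Lipschitz function, from which absolute continuity is immediate.\<close>
  define h where "h = (\<lambda>t. g' (min t c) + (v1 * (max c (min t c') - c) + v0 * max 0 (t - c')))"
  define kh where "kh = (\<lambda>t. if t < c then k' t else if t < c' then v1 else v0)"
  define M where "M = N' \<union> {c, c'}"
  have M: "negligible M" using base(2) by (simp add: M_def)
  have "abs_cont a b (\<lambda>t. v1 * (max c (min t c') - c) + v0 * max 0 (t - c'))"
  proof (rule abs_cont_lipschitz[where L="\<bar>v1\<bar> + \<bar>v0\<bar>"])
    fix s t :: real
    have "\<bar>v1 * (max c (min t c') - max c (min s c')) + v0 * (max 0 (t - c') - max 0 (s - c'))\<bar> \<le>
        \<bar>v1\<bar> * \<bar>max c (min t c') - max c (min s c')\<bar> + \<bar>v0\<bar> * \<bar>max 0 (t - c') - max 0 (s - c')\<bar>"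
      by (rule order_trans[OF abs_triangle_ineq]) (simp add: abs_mult)
    also have "\<dots> \<le> \<bar>v1\<bar> * \<bar>t - s\<bar> + \<bar>v0\<bar> * \<bar>t - s\<bar>"
      by (intro add_mono mult_left_mono) (auto simp: max_def min_def)
    finally show "\<bar>v1 * (max c (min t c') - c) + v0 * max 0 (t - c') -
        (v1 * (max c (min s c') - c) + v0 * max 0 (s - c'))\<bar> \<le> (\<bar>v1\<bar> + \<bar>v0\<bar>) * \<bar>t - s\<bar>"
      by (simp add: algebra_simps)
  qed
  then have ach: "abs_cont a b h"
    unfolding h_def by (rule abs_cont_add[OF abs_cont_clip[OF base(1) c(1)]])
  have conth: "continuous_on {a..b} h" by (rule abs_cont_continuous_on[OF ach])
  have der: "(h has_real_derivative kh t) (at t)" if t: "t \<in> {a..b} - M" for t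
  proof -
    consider "t < c" | "c < t" "t < c'" | "c' < t" using t by (force simp: M_def)
    then show ?thesis
    proof cases
      case 1
      have "(g' has_real_derivative k' t) (at t)" using base(3) t by (auto simp: M_def)
      then have "(g' has_real_derivative kh t) (at t)" using 1 by (simp add: kh_def)
      then show ?thesis
        by (rule DERIV_cong_ev[THEN iffD1, rotated -1])
           (use 1 c in \<open>auto simp: h_def intro!: eventually_mono[OF eventually_nhds_in_open[of "{..<c}"]]\<close>)
    next
      case 2
      have "((\<lambda>t. g' c + v1 * (t - c)) has_real_derivative v1) (at t)"
        by (auto intro!: derivative_eq_intros)
      then have "((\<lambda>t. g' c + v1 * (t - c)) has_real_derivative kh t) (at t)" using 2 by (simp add: kh_def)
      then show ?thesis
        by (rule DERIV_cong_ev[THEN iffD1, rotated -1])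
           (use 2 c in \<open>auto simp: h_def intro!: eventually_mono[OF eventually_nhds_in_open[of "{c<..<c'}"]]\<close>)
    next
      case 3
      have "((\<lambda>t. g' c + v1 * (c' - c) + v0 * (t - c')) has_real_derivative v0) (at t)"
        by (auto intro!: derivative_eq_intros)
      then have "((\<lambda>t. g' c + v1 * (c' - c) + v0 * (t - c')) has_real_derivative kh t) (at t)"
        using 3 c by (simp add: kh_def)
      then show ?thesis
        by (rule DERIV_cong_ev[THEN iffD1, rotated -1])
           (use 3 c in \<open>auto simp: h_def intro!: eventually_mono[OF eventually_nhds_in_open[of "{c'<..}"]]\<close>)
    qed
  qed
  have k1: "(\<lambda>t. \<bar>k' t\<bar> powr \<beta>) integrable_on {a..c}"
    using integrable_on_subinterval[OF base(4)] c by simp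
  have "((\<lambda>t. \<bar>kh t\<bar> powr \<beta>) has_integral integral {a..c} (\<lambda>t. \<bar>k' t\<bar> powr \<beta>)) {a..c}"
    by (rule has_integral_spike[OF M _ integrable_integral[OF k1]]) (auto simp: kh_def M_def)
  then have khac: "(\<lambda>t. \<bar>kh t\<bar> powr \<beta>) integrable_on {a..c}" by (rule has_integral_integrable)
  have "((\<lambda>_. \<bar>v1\<bar> powr \<beta>) has_integral (c' - c) * (\<bar>v1\<bar> powr \<beta>)) {c..c'}"
    using has_integral_const_real[of "\<bar>v1\<bar> powr \<beta>" c c'] c by simp
  then have k2: "((\<lambda>t. \<bar>kh t\<bar> powr \<beta>) has_integral (c' - c) * (\<bar>v1\<bar> powr \<beta>)) {c..c'}"
    by (rule has_integral_spike[OF M, rotated]) (auto simp: kh_def M_def)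
  have "((\<lambda>_. \<bar>v0\<bar> powr \<beta>) has_integral (b - c') * (\<bar>v0\<bar> powr \<beta>)) {c'..b}"
    using has_integral_const_real[of "\<bar>v0\<bar> powr \<beta>" c' b] c by simp
  then have k3: "((\<lambda>t. \<bar>kh t\<bar> powr \<beta>) has_integral (b - c') * (\<bar>v0\<bar> powr \<beta>)) {c'..b}"
    by (rule has_integral_spike[OF M, rotated]) (use c in \<open>auto simp: kh_def M_def\<close>)
  have khcb: "((\<lambda>t. \<bar>kh t\<bar> powr \<beta>) has_integral
      ((c' - c) * (\<bar>v1\<bar> powr \<beta>) + (b - c') * (\<bar>v0\<bar> powr \<beta>))) {c..b}"
    by (rule has_integral_combine[OF c(2,3) k2 k3])
  have khi: "(\<lambda>t. \<bar>kh t\<bar> powr \<beta>) integrable_on {a..b}"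
    by (rule Henstock_Kurzweil_Integration.integrable_combine[OF c(1) _ khac])
       (use c has_integral_integrable[OF khcb] in auto)
  have "min b c = c" "max c (min b c') = c'" "max 0 (b - c') = b - c'" using c by auto
  then have hb: "h b = g b" using "end" by (simp add: h_def)
  have opt: "integral {a..b} (\<lambda>t. \<bar>k t\<bar> powr \<beta> / \<beta> - u (g t) t) \<le>
      integral {a..b} (\<lambda>t. \<bar>kh t\<bar> powr \<beta> / \<beta> - u (h t) t)"
    by (rule optimal[OF ach M der khi hb])
  have ii: "(\<lambda>t. \<bar>kh t\<bar> powr \<beta> / \<beta> - u (h t) t) integrable_on {a..b}"
    by (intro integrable_diff integrable_on_divide khi u_integrable conth)
  have split: "integral {a..b} (\<lambda>t. \<bar>kh t\<bar> powr \<beta> / \<beta> - u (h t) t) =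
      integral {a..c} (\<lambda>t. \<bar>kh t\<bar> powr \<beta> / \<beta> - u (h t) t) +
      integral {c..b} (\<lambda>t. \<bar>kh t\<bar> powr \<beta> / \<beta> - u (h t) t)"
    using Henstock_Kurzweil_Integration.integral_combine[OF _ _ ii, of c] c by simp
  have left: "integral {a..c} (\<lambda>t. \<bar>kh t\<bar> powr \<beta> / \<beta> - u (h t) t) =
      integral {a..c} (\<lambda>t. \<bar>k' t\<bar> powr \<beta> / \<beta> - u (g' t) t)"
    by (rule integral_spike[OF M]) (use c in \<open>auto simp: kh_def h_def M_def max_def min_def\<close>)
  have hcb: "continuous_on {c..b} h" using conth by (rule continuous_on_subset) (use c in auto)
  have "integral {c..b} (\<lambda>t. \<bar>kh t\<bar> powr \<beta> / \<beta> - u (h t) t) =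
      integral {c..b} (\<lambda>t. \<bar>kh t\<bar> powr \<beta> / \<beta>) - integral {c..b} (\<lambda>t. u (h t) t)"
    using khcb by (intro Henstock_Kurzweil_Integration.integral_diff integrable_on_divide u_integrable hcb) auto
  also have "integral {c..b} (\<lambda>t. \<bar>kh t\<bar> powr \<beta> / \<beta>) =
      ((c' - c) * \<bar>v1\<bar> powr \<beta> + (b - c') * \<bar>v0\<bar> powr \<beta>) / \<beta>"
    by (rule integral_unique[OF has_integral_divide[OF khcb]])
  also have "integral {c..b} (\<lambda>t. u (h t) t) =
      integral {c..b} (\<lambda>t. u (g' c + v1 * (min t c' - c) + v0 * max 0 (t - c')) t)"
    by (rule integral_cong) (use c in \<open>auto simp: h_def max_def min_def algebra_simps\<close>)
  finally show ?thesis using opt split left by linarith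
qed

lemma two_slope_competitor:
  assumes c: "a \<le> c" "c \<le> c'" "c' \<le> b"
    and "end": "g c + v1 * (c' - c) + v0 * (b - c') = g b"
  shows "integral {c..b} (\<lambda>t. \<bar>k t\<bar> powr \<beta>) / \<beta> - integral {c..b} (\<lambda>t. u (g t) t) \<le>
    ((c' - c) * \<bar>v1\<bar> powr \<beta> + (b - c') * \<bar>v0\<bar> powr \<beta>) / \<beta> -
    integral {c..b} (\<lambda>t. u (g c + v1 * (min t c' - c) + v0 * max 0 (t - c')) t)"
proof -
  let ?f = "\<lambda>t. \<bar>k t\<bar> powr \<beta> / \<beta> - u (g t) t"
  have "?f integrable_on {a..b}"
    by (intro integrable_diff integrable_on_divide k_integrable u_integrable g_continuous) auto
  from Henstock_Kurzweil_Integration.integral_combine[OF _ _ this, of c]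
  have "integral {a..b} ?f = integral {a..c} ?f + integral {c..b} ?f" using c by simp
  moreover have "integral {c..b} ?f =
      integral {c..b} (\<lambda>t. \<bar>k t\<bar> powr \<beta> / \<beta>) - integral {c..b} (\<lambda>t. u (g t) t)"
    using c by (intro Henstock_Kurzweil_Integration.integral_diff integrable_on_divide u_integrable
        g_continuous k_powr_integrable) auto
  moreover have "integral {c..b} (\<lambda>t. \<bar>k t\<bar> powr \<beta> / \<beta>) = integral {c..b} (\<lambda>t. \<bar>k t\<bar> powr \<beta>) / \<beta>"
    by simp
  ultimately show ?thesis
    using piecewise_competitor[OF c g_abs_cont negligible_N g_deriv k_integrable "end"] by linarith
qed

text \<open>With \<open>c = a\<close> and \<open>v1 = 0\<close> the competitor rests at an arbitrary
  point \<open>z\<close> until \<open>c'\<close>, which the free initial point permits. The kinetic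
  energy of \<open>g\<close> is discarded as nonnegative.\<close>

lemma constant_start_competitor:
  assumes c': "a \<le> c'" "c' \<le> b" and "end": "z + v0 * (b - c') = g b"
  shows "- integral {a..b} (\<lambda>t. u (g t) t) \<le>
    (b - c') * \<bar>v0\<bar> powr \<beta> / \<beta> - integral {a..b} (\<lambda>t. u (z + v0 * max 0 (t - c')) t)"
proof -
  have "abs_cont a b (\<lambda>_. z)" by (rule abs_cont_lipschitz[of _ 0]) simp
  from piecewise_competitor[OF order_refl c' this negligible_empty, of "\<lambda>_. 0" 0 v0] "end"
  have "integral {a..b} (\<lambda>t. \<bar>k t\<bar> powr \<beta> / \<beta> - u (g t) t) \<le>
     (b - c') * \<bar>v0\<bar> powr \<beta> / \<beta> - integral {a..b} (\<lambda>t. u (z + v0 * max 0 (t - c')) t)"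
    using \<beta> integrable_continuous_interval[of a b "\<lambda>_. 0 :: real"] by simp
  moreover have "integral {a..b} (\<lambda>t. \<bar>k t\<bar> powr \<beta> / \<beta> - u (g t) t) =
      integral {a..b} (\<lambda>t. \<bar>k t\<bar> powr \<beta> / \<beta>) - integral {a..b} (\<lambda>t. u (g t) t)"
    by (intro Henstock_Kurzweil_Integration.integral_diff integrable_on_divide u_integrable
        g_continuous k_integrable) auto
  moreover have "integral {a..b} (\<lambda>t. \<bar>k t\<bar> powr \<beta> / \<beta>) \<ge> 0"
    using \<beta> by (intro Henstock_Kurzweil_Integration.integral_nonneg integrable_on_divide k_integrable) auto
  ultimately show ?thesis by linarith
qed

end

subsection \<open>Following the windows\<close>

lemma quadrupling_positive:
  fixes s :: "nat \<Rightarrow> real"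
  assumes "s 0 > 0" "\<And>j. s (Suc j) = 4 * s j"
  shows "s j > 0"
  by (induction j) (simp_all add: assms)

lemma quadrupling_gap:
  fixes s :: "nat \<Rightarrow> real"
  assumes "s 0 > 0" "\<And>j. s (Suc j) = 4 * s j" "i < j"
  shows "4 * s i \<le> s j"
  using assms(3)
proof (induction j)
  case (Suc j)
  then show ?case
    using quadrupling_positive[OF assms(1,2), of j] by (cases "i = j") (auto simp: assms(2))
qed simp

text \<open>
  Windows are indexed by the remaining time: the \<open>j\<close>-th one consists of the times \<open>t\<close> with
  \<open>s j \<le> b - t \<le> 2 * s j\<close>.  The quantity \<open>z0 - g t\<close> is compared with the front \<open>w j * (b - t)\<close>.
\<close>

locale window_minimizer = scalar_minimizer +
  fixes s w :: "nat \<Rightarrow> real" and n :: nat and z0 :: real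
  assumes s_pos: "s 0 > 0" and s_Suc: "s (Suc j) = 4 * s j" and s_n: "2 * s n \<le> b - a"
    and w_pos: "j \<le> n \<Longrightarrow> w j > 0"
    and u_zero: "(\<And>j. j \<le> n \<Longrightarrow> s j \<le> b - t \<Longrightarrow> b - t \<le> 2 * s j \<Longrightarrow> z0 - z \<le> w j * (b - t)) \<Longrightarrow>
      u z t = 0"
    and u_full: "j \<le> n \<Longrightarrow> s j \<le> b - t \<Longrightarrow> b - t \<le> 2 * s j \<Longrightarrow> w j * (b - t) + 2 \<le> z0 - z \<Longrightarrow>
      u z t = C"
    and start: "z0 - g b \<ge> 2"
    and top_cost: "4 * w n powr \<beta> / \<beta> < C"
    and w_decreasing: "j < n \<Longrightarrow> w (Suc j) \<le> w j"
    and step_cost: "j < n \<Longrightarrow> \<exists>D. 2 * (w j - w (Suc j)) + 1 / s j \<le> D \<and> D < w j \<and>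
      4 * D * (w j powr (\<beta> - 1) - (w j - D) powr (\<beta> - 1)) < C"
begin

definition reached :: "nat \<Rightarrow> real \<Rightarrow> bool"
  where "reached j r \<longleftrightarrow> s j \<le> r \<and> r \<le> 2 * s j \<and> w j * r \<le> z0 - g (b - r)"

lemma s_gt_0: "s j > 0"
  by (rule quadrupling_positive[of s, OF s_pos s_Suc])

lemma s_less: "i < j \<Longrightarrow> 4 * s i \<le> s j"
  by (rule quadrupling_gap[of s, OF s_pos s_Suc])

lemma s_le: "i \<le> j \<Longrightarrow> s i \<le> s j"
  using s_less[of i j] s_gt_0[of i] by (cases "i = j") auto

lemma g_reversed_continuous: "c \<ge> 0 \<Longrightarrow> d \<le> b - a \<Longrightarrow> continuous_on {c..d} (\<lambda>r. g (b - r))"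
  by (rule continuous_on_compose2[OF g_continuous[OF order_refl order_refl]])
     (auto intro!: continuous_intros)

lemma first_reached:
  assumes j: "j \<le> n" and "reached j r"
  obtains \<tau> where "reached j \<tau>" "\<And>r. reached j r \<Longrightarrow> \<tau> \<le> r"
proof -
  let ?I = "{s j..2 * s j}"
  let ?f = "\<lambda>r. z0 - g (b - r) - w j * r"
  have "continuous_on ?I ?f"
    using s_gt_0[of j] s_le[OF j] s_n by (intro continuous_intros g_reversed_continuous) auto
  then have "closed (?I \<inter> ?f -` {0..})" by (rule continuous_closed_preimage) auto
  then have "compact (?I \<inter> (?I \<inter> ?f -` {0..}))" by (intro compact_Int_closed) auto
  moreover have "?I \<inter> (?I \<inter> ?f -` {0..}) = Collect (reached j)" by (auto simp: reached_def)
  ultimately have "compact (Collect (reached j))" by simp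
  from compact_attains_inf[OF this] show thesis using assms(2) that by auto
qed

text \<open>Both sides are affine in \<open>r\<close>, so it suffices to compare them at
  \<open>r = 0\<close>, where \<open>start\<close> applies, and at the far edge
  \<open>r = 2 * s j\<close>.\<close>

lemma competitor_inside:
  assumes j: "j \<le> n" and v: "2 * s j * w j + 2 \<le> z0 - g b + v * (2 * s j)"
    and r: "0 \<le> r" "r \<le> 2 * s j"
  shows "w j * r + 2 \<le> z0 - g b + v * r"
proof -
  define \<theta> where "\<theta> = r / (2 * s j)"
  have \<theta>: "0 \<le> \<theta>" "\<theta> \<le> 1" "r = \<theta> * (2 * s j)" using r s_gt_0[of j] by (auto simp: \<theta>_def)
  have "\<theta> * (2 * s j * w j + 2) + (1 - \<theta>) * 2 \<le> \<theta> * (z0 - g b + v * (2 * s j)) + (1 - \<theta>) * (z0 - g b)"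
    by (rule add_mono[OF mult_left_mono[OF v \<theta>(1)] mult_left_mono[OF start]]) (use \<theta> in simp)
  then show ?thesis unfolding \<theta>(3) by (simp add: algebra_simps)
qed

text \<open>Without meeting the top front, the minimizer can collect rewards only in remaining time
  below \<open>s n / 2\<close>. Resting far away and then crossing the whole top window ahead of its
  front collects \<open>C * s n\<close> and costs at most
  \<open>2 * s n * w n powr \<beta> / \<beta>\<close>; \<open>top_cost\<close> makes this
  profitable.\<close>

lemma reached_top: "\<exists>r. reached n r"
proof (rule ccontr)
  assume no: "\<nexists>r. reached n r"
  define c' where "c' = b - 2 * s n"
  \<comment> \<open>\<open>P\<close> is the distance from \<open>z0\<close> at the far edge of the
    window: 2 ahead of the front for full reward, and at least the terminal distance so that
    \<open>v\<close> is nonnegative. By \<open>start\<close> the summand 2 cancels and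
    \<open>v \<le> w n\<close>.\<close>
  define P where "P = max (2 * s n * w n + 2) (z0 - g b)"
  define v where "v = (P - (z0 - g b)) / (2 * s n)"
  note sn = s_gt_0[of n]
  have c': "a \<le> c'" "c' \<le> b" using s_n sn by (auto simp: c'_def)
  have v0: "0 \<le> v" using sn by (simp add: v_def P_def)
  have "0 \<le> w n * (2 * s n)" using sn w_pos[of n] by simp
  then have "P - (z0 - g b) \<le> w n * (2 * s n)" using start unfolding P_def by (auto simp: max_def mult.commute)
  then have vw: "v \<le> w n" using sn by (simp add: v_def pos_divide_le_eq)
  have v: "v * (2 * s n) = P - (z0 - g b)" using sn by (simp add: v_def)
  have "z0 - P + v * (b - c') = g b" using v by (simp add: c'_def algebra_simps)
  note comp = constant_start_competitor[OF c' this]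
  have "integral {a..b} (\<lambda>t. u (g t) t) \<le> C * (b - (b - s n / 2))"
  proof (rule integral_u_le[OF g_continuous])
    fix t assume t: "a < t" "t < b - s n / 2"
    show "u (g t) t = 0"
    proof (rule u_zero)
      fix j assume j: "j \<le> n" "s j \<le> b - t" "b - t \<le> 2 * s j"
      have "j = n" using s_less[of j n] j t by (cases "j = n") auto
      moreover have "\<not> reached n (b - t)" using no by blast
      ultimately show "z0 - g t \<le> w j * (b - t)" using j by (simp add: reached_def)
    qed
  qed (use s_n sn in auto)
  moreover have "C * ((b - s n) - (b - 2 * s n)) \<le>
      integral {a..b} (\<lambda>t. u (z0 - P + v * max 0 (t - c')) t)"
  proof (rule integral_u_ge)
    fix t assume t: "b - 2 * s n < t" "t < b - s n"
    show "u (z0 - P + v * max 0 (t - c')) t = C"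
    proof (rule u_full[of n])
      have "w n * (b - t) + 2 \<le> z0 - g b + v * (b - t)"
        using t sn by (intro competitor_inside) (auto simp: v P_def)
      also have "\<dots> = z0 - (z0 - P + v * max 0 (t - c'))"
        using t v by (simp add: c'_def algebra_simps)
      finally show "w n * (b - t) + 2 \<le> z0 - (z0 - P + v * max 0 (t - c'))" .
    qed (use t in auto)
  qed (use c' sn in \<open>auto simp: c'_def intro!: continuous_intros\<close>)
  moreover have e: "b - (b - s n / 2) = s n / 2" "(b - s n) - (b - 2 * s n) = s n" "b - c' = 2 * s n"
    by (simp_all add: c'_def)
  moreover have "C * s n = C * (s n / 2) + C * s n / 2" by simp
  ultimately have "C * s n / 2 \<le> (2 * s n) * \<bar>v\<bar> powr \<beta> / \<beta>"
    using comp unfolding e by linarith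
  also have "\<dots> \<le> (2 * s n) * w n powr \<beta> / \<beta>"
    using v0 vw \<beta> sn by (intro divide_right_mono mult_left_mono powr_mono2) auto
  also have "\<dots> = s n / 2 * (4 * w n powr \<beta> / \<beta>)" by simp
  also have "\<dots> < s n / 2 * C" using top_cost sn by (intro mult_strict_left_mono) auto
  finally show False by simp
qed

text \<open>From the last meeting with the front of window \<open>Suc i\<close> on, a minimizer
  missing window \<open>i\<close> collects at most \<open>C * (s i / 2)\<close>. Passing ahead of
  the front through window \<open>i\<close> collects at least \<open>C * s i\<close>. The extra
  kinetic energy, compared with the straight line by Jensen, is below the difference by
  \<open>step_cost\<close>.\<close>

lemma reached_step:
  assumes k: "i < n" and "reached (Suc i) r"
  shows "\<exists>r. reached i r"
proof (rule ccontr)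
  assume no: "\<nexists>r. reached i r"
  \<comment> \<open>The least remaining time is the latest moment: afterwards window
    \<open>Suc i\<close> pays nothing.\<close>
  obtain \<tau> where \<tau>: "reached (Suc i) \<tau>" and first: "\<And>r. reached (Suc i) r \<Longrightarrow> \<tau> \<le> r"
    using first_reached[OF _ assms(2)] k by auto
  obtain D where D: "2 * (w i - w (Suc i)) + 1 / s i \<le> D" "D < w i"
    "4 * D * (w i powr (\<beta> - 1) - (w i - D) powr (\<beta> - 1)) < C"
    using step_cost[OF k] by blast
  note sk = s_gt_0[of i]
  \<comment> \<open>\<open>\<sigma>\<close> is the far edge of window \<open>i\<close>, and
    \<open>\<rho>\<close> is the time available for getting there. The ratio 4 gives
    \<open>\<tau> \<ge> 2 * \<sigma>\<close>, hence \<open>\<rho> \<ge> \<sigma>\<close>.\<close>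
  define \<sigma> where "\<sigma> = 2 * s i"
  define \<rho> where "\<rho> = \<tau> - \<sigma>"
  have \<tau>4: "4 * s i \<le> \<tau>" "\<tau> \<le> 8 * s i" using \<tau> by (auto simp: reached_def s_Suc)
  have \<sigma>: "\<sigma> > 0" and \<rho>: "\<rho> \<ge> \<sigma>" using sk \<tau>4 by (auto simp: \<sigma>_def \<rho>_def)
  have \<tau>n: "\<tau> \<le> b - a" using \<tau> s_le[of "Suc i" n] k s_n by (auto simp: reached_def)
  define c where "c = b - \<tau>"
  define c' where "c' = b - \<sigma>"
  have c: "a \<le> c" "c \<le> c'" "c' \<le> b" using \<tau>n \<rho> \<sigma> by (auto simp: c_def c'_def \<rho>_def)
  define q0 where "q0 = z0 - g b"
  define Q where "Q = z0 - g c"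
  have Q: "w (Suc i) * \<tau> \<le> Q" using \<tau> by (simp add: reached_def Q_def c_def)
  have q0: "q0 \<ge> 2" using start by (simp add: q0_def)
  define v where "v = (Q - q0) / \<tau>"
  have \<tau>pos: "\<tau> > 0" using \<tau>4 sk by simp
  have v: "v * \<tau> = Q - q0" using \<tau>pos by (simp add: v_def)
  \<comment> \<open>The second alternative is the position of the straight line. If that is already
    far enough, the competitor is the straight line itself, with no extra kinetic cost.\<close>
  define P where "P = max (\<sigma> * w i + 2) (q0 + v * \<sigma>)"
  define v0 where "v0 = (P - q0) / \<sigma>"
  define v1 where "v1 = (Q - P) / \<rho>"
  have v0: "v0 * \<sigma> = P - q0" using \<sigma> by (simp add: v0_def)
  have v1: "v1 * \<rho> = Q - P" using \<rho> \<sigma> by (simp add: v1_def)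
  have "g c + v1 * (c' - c) + v0 * (b - c') = g b"
    using v0 v1 by (simp add: c_def c'_def \<rho>_def Q_def q0_def algebra_simps)
  note comp = two_slope_competitor[OF c this]
  have "integral {c..b} (\<lambda>t. u (g t) t) \<le> C * (b - (b - s i / 2))"
  proof (rule integral_u_le[OF g_continuous])
    fix t assume t: "c < t" "t < b - s i / 2"
    show "u (g t) t = 0"
    proof (rule u_zero)
      fix j assume j: "j \<le> n" "s j \<le> b - t" "b - t \<le> 2 * s j"
      \<comment> \<open>Windows below \<open>i\<close> end at remaining time \<open>s i / 2\<close>,
        and those above \<open>Suc i\<close> begin at \<open>16 * s i\<close>, beyond
        \<open>\<tau>\<close>.\<close>
      have "\<not> j < i" using s_less[of j i] j t by auto
      moreover have "\<not> Suc i < j" using s_less[of "Suc i" j] j t \<tau>4 sk by (auto simp: c_def s_Suc)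
      ultimately have "j = i \<or> j = Suc i" by auto
      then have "\<not> reached j (b - t)"
        using no first[of "b - t"] t by (auto simp: c_def)
      then show "z0 - g t \<le> w j * (b - t)" using j by (simp add: reached_def)
    qed
  qed (use c sk \<tau>4 in \<open>auto simp: c_def\<close>)
  moreover have "C * ((b - s i) - c') \<le>
      integral {c..b} (\<lambda>t. u (g c + v1 * (min t c' - c) + v0 * max 0 (t - c')) t)"
  proof (rule integral_u_ge)
    fix t assume t: "c' < t" "t < b - s i"
    show "u (g c + v1 * (min t c' - c) + v0 * max 0 (t - c')) t = C"
    proof (rule u_full[of i])
      have "w i * (b - t) + 2 \<le> z0 - g b + v0 * (b - t)"
        using t sk k v0 by (intro competitor_inside) (auto simp: \<sigma>_def[symmetric] c'_def P_def q0_def)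
      also have "\<dots> = z0 - (g c + v1 * (min t c' - c) + v0 * max 0 (t - c'))"
        using t v0 v1 by (simp add: c_def c'_def \<rho>_def Q_def q0_def algebra_simps)
      finally show "w i * (b - t) + 2 \<le> z0 - (g c + v1 * (min t c' - c) + v0 * max 0 (t - c'))" .
    qed (use t k in \<open>auto simp: c'_def \<sigma>_def\<close>)
  qed (use c sk in \<open>auto simp: c'_def \<sigma>_def intro!: continuous_intros\<close>)
  moreover have "\<tau> * \<bar>v\<bar> powr \<beta> \<le> integral {c..b} (\<lambda>t. \<bar>k t\<bar> powr \<beta>)"
    using kinetic_lower[of c v] c v by (simp add: c_def Q_def q0_def algebra_simps)
  then have "\<tau> * \<bar>v\<bar> powr \<beta> / \<beta> \<le> integral {c..b} (\<lambda>t. \<bar>k t\<bar> powr \<beta>) / \<beta>"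
    using \<beta> by (intro divide_right_mono) auto
  moreover have "c' - c = \<rho>" "b - c' = \<sigma>" "(b - s i) - c' = s i" "b - (b - s i / 2) = s i / 2"
    by (simp_all add: c_def c'_def \<rho>_def \<sigma>_def)
  ultimately have energy: "\<tau> * \<bar>v\<bar> powr \<beta> / \<beta> - C * (s i / 2) \<le>
      (\<rho> * \<bar>v1\<bar> powr \<beta> + \<sigma> * \<bar>v0\<bar> powr \<beta>) / \<beta> - C * s i"
    using comp by simp
  then have gain: "C * (s i / 2) \<le>
      (\<sigma> * \<bar>v0\<bar> powr \<beta> + \<rho> * \<bar>v1\<bar> powr \<beta> - (\<sigma> + \<rho>) * \<bar>v\<bar> powr \<beta>) / \<beta>"
  proof -
    have "\<sigma> + \<rho> = \<tau>" by (simp add: \<rho>_def)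
    moreover have "C * s i = C * (s i / 2) + C * (s i / 2)" by simp
    ultimately show ?thesis using energy by (simp only: diff_divide_distrib add.commute[of "\<rho> * \<bar>v1\<bar> powr \<beta>"])
  qed
  have "0 \<le> w n powr \<beta> / \<beta>" using \<beta> by simp
  then have Cpos: "C > 0" using top_cost by linarith
  show False
  proof (cases "\<sigma> * w i + 2 \<le> q0 + v * \<sigma>")
    case True
    then have P: "P = q0 + v * \<sigma>" by (simp add: P_def)
    have "v0 = v" using v0 \<sigma> unfolding P by simp
    moreover have "v1 * \<rho> = v * \<rho>" using v1 v unfolding P by (simp add: \<rho>_def algebra_simps)
    then have "v1 = v" using \<rho> \<sigma> by simp
    ultimately have "C * (s i / 2) \<le> 0" using gain by (simp add: algebra_simps)
    moreover have "C * (s i / 2) > 0" using Cpos sk by simp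
    ultimately show False by linarith
  next
    case False
    then have P: "P = \<sigma> * w i + 2" by (simp add: P_def)
    have "v * \<sigma> < v0 * \<sigma>" using False v0 unfolding P by simp
    then have vv0: "v < v0" using \<sigma> by simp
    have v0w: "v0 \<le> w i" using \<sigma> q0 by (simp add: v0_def P field_simps)
    have slopes: "(\<sigma> + \<rho>) * v = \<sigma> * v0 + \<rho> * v1"
      using v v0 v1 by (simp add: \<rho>_def algebra_simps)
    have "\<sigma> * v < \<sigma> * v0" using vv0 \<sigma> by simp
    then have "\<rho> * v1 < \<rho> * v" using slopes by (simp add: algebra_simps)
    then have v1v: "v1 < v" using \<rho> \<sigma> by simp
    have "(w i - D) * \<rho> \<le> v1 * \<rho>"
    proof -
      \<comment> \<open>Here \<open>v1 * \<rho>\<close> is at least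
        \<open>w i * \<rho> - \<Delta> * \<tau> - 2\<close>. With
        \<open>\<tau> \<le> 2 * \<rho>\<close> and \<open>2 * s i \<le> \<rho>\<close> the loss in
        slope is at most \<open>2 * \<Delta> + 1 / s i\<close>, the lower bound on \<open>D\<close>
        in \<open>step_cost\<close>.\<close>
      define \<Delta> where "\<Delta> = w i - w (Suc i)"
      have \<Delta>: "\<Delta> \<ge> 0" using w_decreasing[OF k] by (simp add: \<Delta>_def)
      have "(2 * \<Delta> + 1 / s i) * \<rho> \<le> D * \<rho>"
        using D(1) \<rho> \<sigma> by (intro mult_right_mono) (auto simp: \<Delta>_def)
      moreover have "\<Delta> * \<tau> \<le> \<Delta> * (2 * \<rho>)"
        using \<Delta> \<rho> by (intro mult_left_mono) (auto simp: \<rho>_def)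
      moreover have "1 / s i * \<sigma> \<le> 1 / s i * \<rho>" using \<rho> sk by (intro mult_left_mono) auto
      then have "2 \<le> 1 / s i * \<rho>" using sk by (simp add: \<sigma>_def)
      ultimately have "\<Delta> * \<tau> + 2 \<le> D * \<rho>" by (simp add: algebra_simps)
      then show ?thesis using Q unfolding v1 P by (simp add: \<Delta>_def \<rho>_def algebra_simps)
    qed
    then have v1D: "w i - D \<le> v1" using \<rho> \<sigma> by simp
    have v1pos: "0 < v1" using v1D D(2) by linarith
    have "\<sigma> * v0 powr \<beta> + \<rho> * v1 powr \<beta> - (\<sigma> + \<rho>) * v powr \<beta> \<le>
        \<beta> * \<sigma> * (v0 - v1) * (v0 powr (\<beta> - 1) - v1 powr (\<beta> - 1))"
      using \<rho> \<sigma> v1pos v1v vv0 slopes by (intro powr_two_slope_gap \<beta>) auto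
    also have "\<dots> \<le> \<beta> * \<sigma> * D * (w i powr (\<beta> - 1) - (w i - D) powr (\<beta> - 1))"
    proof -
      \<comment> \<open>Both factors grow when \<open>v0\<close> is raised to \<open>w i\<close> and
        \<open>v1\<close> is lowered to \<open>w i - D\<close>.\<close>
      have "v0 powr (\<beta> - 1) \<le> w i powr (\<beta> - 1)" "(w i - D) powr (\<beta> - 1) \<le> v1 powr (\<beta> - 1)"
        "v1 powr (\<beta> - 1) \<le> v0 powr (\<beta> - 1)"
        using v0w v1D v1v vv0 v1pos D(2) \<beta> by (simp_all add: powr_mono2)
      moreover have "v0 - v1 \<le> D" "0 \<le> v0 - v1" using v0w v1D v1v vv0 by linarith+
      ultimately have "(v0 - v1) * (v0 powr (\<beta> - 1) - v1 powr (\<beta> - 1)) \<le>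
          D * (w i powr (\<beta> - 1) - (w i - D) powr (\<beta> - 1))"
        by (intro mult_mono) linarith+
      then have "(\<beta> * \<sigma>) * ((v0 - v1) * (v0 powr (\<beta> - 1) - v1 powr (\<beta> - 1))) \<le>
          (\<beta> * \<sigma>) * (D * (w i powr (\<beta> - 1) - (w i - D) powr (\<beta> - 1)))"
        using \<beta> \<sigma> by (intro mult_left_mono) auto
      then show ?thesis by (simp only: mult.assoc)
    qed
    finally have "\<sigma> * \<bar>v0\<bar> powr \<beta> + \<rho> * \<bar>v1\<bar> powr \<beta> - (\<sigma> + \<rho>) * \<bar>v\<bar> powr \<beta> \<le>
        \<beta> * \<sigma> * D * (w i powr (\<beta> - 1) - (w i - D) powr (\<beta> - 1))"
      using v1pos v1v vv0 by simp
    from order_trans[OF gain divide_right_mono[OF this]]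
    have "C * (s i / 2) \<le> \<beta> * \<sigma> * D * (w i powr (\<beta> - 1) - (w i - D) powr (\<beta> - 1)) / \<beta>"
      using \<beta> by simp
    also have "\<dots> = s i / 2 * (4 * D * (w i powr (\<beta> - 1) - (w i - D) powr (\<beta> - 1)))"
      using \<beta> by (simp add: \<sigma>_def)
    also have "\<dots> < s i / 2 * C" using D(3) sk by (intro mult_strict_left_mono) auto
    finally show False by simp
  qed
qed

lemma reached_all: "i \<le> n \<Longrightarrow> \<exists>r. reached i r"
proof (induction rule: inc_induct)
  case base
  show ?case by (rule reached_top)
next
  case (step m)
  from step(3) obtain r where "reached (Suc m) r" ..
  with step(2) show ?case by (rule reached_step)
qed

text \<open>After the last meeting with the front of window 0 the minimizer collects nothing, while
  the straight line collects a nonnegative reward. Optimality then yields the equality case of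
  Jensen.\<close>

lemma affine_near_end:
  obtains \<tau> v where "s 0 \<le> \<tau>" "\<tau> \<le> b - a" "w 0 * \<tau> - (z0 - g b) \<le> v * \<tau>"
    "\<And>t. t \<in> {b - \<tau>..b} \<Longrightarrow> g t = g b - v * (b - t)"
proof -
  obtain r where "reached 0 r" using reached_all[of 0] by auto
  then obtain \<tau> where \<tau>: "reached 0 \<tau>" and first: "\<And>r. reached 0 r \<Longrightarrow> \<tau> \<le> r"
    using first_reached by blast
  have \<tau>pos: "\<tau> > 0" and \<tau>n: "\<tau> \<le> b - a"
    using \<tau> s_pos s_le[of 0 n] s_n by (auto simp: reached_def)
  define c where "c = b - \<tau>"
  define v where "v = (g b - g c) / \<tau>"
  have c: "a \<le> c" "c < b" using \<tau>n \<tau>pos by (auto simp: c_def)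
  have v: "g b - g c = v * (b - c)" using \<tau>pos by (simp add: v_def c_def)
  \<comment> \<open>The degenerate bound expresses that the reward vanishes on all of
    \<open>(c, b)\<close>.\<close>
  have "integral {c..b} (\<lambda>t. u (g t) t) \<le> C * (b - b)"
  proof (rule integral_u_le[OF g_continuous])
    fix t assume t: "c < t" "t < b"
    show "u (g t) t = 0"
    proof (rule u_zero)
      fix j assume j: "j \<le> n" "s j \<le> b - t" "b - t \<le> 2 * s j"
      have "j = 0" using s_less[of 0 j] j t \<tau> s_pos by (cases "j = 0") (auto simp: c_def reached_def)
      then have "\<not> reached j (b - t)" using first[of "b - t"] t by (auto simp: c_def)
      then show "z0 - g t \<le> w j * (b - t)" using j by (simp add: reached_def)
    qed
  qed (use c in auto)
  moreover have "0 \<le> integral {c..b} (\<lambda>t. u (g c + v * (min t b - c) + v * max 0 (t - b)) t)"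
    using u_nonneg by (intro Henstock_Kurzweil_Integration.integral_nonneg u_integrable continuous_intros) auto
  \<comment> \<open>The straight competitor is the two-slope one with its break moved to
    \<open>b\<close> and both slopes equal to \<open>v\<close>.\<close>
  moreover have "integral {c..b} (\<lambda>t. \<bar>k t\<bar> powr \<beta>) / \<beta> - integral {c..b} (\<lambda>t. u (g t) t) \<le>
    ((b - c) * \<bar>v\<bar> powr \<beta> + (b - b) * \<bar>v\<bar> powr \<beta>) / \<beta> -
    integral {c..b} (\<lambda>t. u (g c + v * (min t b - c) + v * max 0 (t - b)) t)"
    using c v by (intro two_slope_competitor) auto
  ultimately have "integral {c..b} (\<lambda>t. \<bar>k t\<bar> powr \<beta>) / \<beta> \<le> (b - c) * \<bar>v\<bar> powr \<beta> / \<beta>" by simp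
  then have "integral {c..b} (\<lambda>t. \<bar>k t\<bar> powr \<beta>) \<le> (b - c) * \<bar>v\<bar> powr \<beta>"
    using \<beta> by (simp add: divide_le_cancel)
  note affine = kinetic_equality_affine[OF c v this]
  show thesis
  proof (rule that[of \<tau> v])
    show "s 0 \<le> \<tau>" using \<tau> by (simp add: reached_def)
    have "w 0 * \<tau> \<le> z0 - g c" using \<tau> by (simp add: reached_def c_def)
    then show "w 0 * \<tau> - (z0 - g b) \<le> v * \<tau>" using v by (simp add: c_def)
    show "g t = g b - v * (b - t)" if "t \<in> {b - \<tau>..b}" for t using affine[of t] that by (simp add: c_def)
  qed (fact \<tau>n)
qed

end

subsection \<open>The potential\<close>

text \<open>The quadratic spline whose derivative is the hat function with support \<open>[0, 2]\<close> and height 1.\<close>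

definition ramp :: "real \<Rightarrow> real"
  where "ramp x = (max 0 x)\<^sup>2 / 2 - (max 0 (x - 1))\<^sup>2 + (max 0 (x - 2))\<^sup>2 / 2"

definition ramp_deriv :: "real \<Rightarrow> real"
  where "ramp_deriv x = max 0 x - 2 * max 0 (x - 1) + max 0 (x - 2)"

lemma has_real_derivative_max_0_power2:
  "((\<lambda>x. (max 0 x)\<^sup>2) has_real_derivative 2 * max 0 x) (at (x :: real))"
proof -
  consider "x > 0" | "x = 0" | "x < 0" by linarith
  then show ?thesis
  proof cases
    case 1
    have "((\<lambda>x. x\<^sup>2) has_real_derivative 2 * max 0 x) (at x)"
      using 1 by (auto intro!: derivative_eq_intros)
    then show ?thesis
      by (rule has_field_derivative_transform_within_open[where S="{0<..}"]) (use 1 in auto)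
  next
    case 2
    have "((\<lambda>h. max 0 h) \<longlongrightarrow> max 0 0) (at (0::real))" by (intro tendsto_intros)
    moreover have "\<forall>\<^sub>F h in at (0::real). max 0 h = ((max 0 h)\<^sup>2 - 0) / h"
      by (auto simp: eventually_at_filter max_def power2_eq_square)
    ultimately have "((\<lambda>h::real. ((max 0 h)\<^sup>2 - 0) / h) \<longlongrightarrow> max 0 0) (at 0)"
      by (rule Lim_transform_eventually)
    then show ?thesis unfolding DERIV_def using 2 by simp
  next
    case 3
    have "((\<lambda>x. 0) has_real_derivative 2 * max 0 x) (at x)"
      using 3 by (auto intro!: derivative_eq_intros)
    then show ?thesis
      by (rule has_field_derivative_transform_within_open[where S="{..<0}"]) (use 3 in auto)
  qed
qed

lemma ramp_has_derivative: "(ramp has_real_derivative ramp_deriv x) (at x)"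
proof -
  have shift: "((\<lambda>x. (max 0 (x - c))\<^sup>2) has_real_derivative 2 * max 0 (x - c)) (at x)" for c
  proof -
    have "((\<lambda>x. x - c) has_real_derivative 1) (at x)" by (auto intro!: derivative_eq_intros)
    from DERIV_chain2[OF has_real_derivative_max_0_power2 this] show ?thesis by simp
  qed
  have "((\<lambda>x. (max 0 x)\<^sup>2 / 2 - (max 0 (x - 1))\<^sup>2 + (max 0 (x - 2))\<^sup>2 / 2) has_real_derivative
      (2 * max 0 x / 2 - 2 * max 0 (x - 1) + 2 * max 0 (x - 2) / 2)) (at x)"
    by (intro DERIV_add DERIV_diff DERIV_cdivide shift has_real_derivative_max_0_power2)
  then show ?thesis unfolding ramp_def ramp_deriv_def by simp
qed

lemma continuous_on_ramp: "continuous_on S ramp"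
  by (rule DERIV_continuous_on[OF has_field_derivative_at_within[OF ramp_has_derivative]])

lemma continuous_on_ramp_deriv: "continuous_on S ramp_deriv"
  unfolding ramp_deriv_def by (intro continuous_intros)

lemma ramp_eq_0: "x \<le> 0 \<Longrightarrow> ramp x = 0"
  by (simp add: ramp_def)

lemma ramp_eq_1: "x \<ge> 2 \<Longrightarrow> ramp x = 1"
  by (simp add: ramp_def power2_eq_square field_simps)

lemma ramp_deriv_bounds: "0 \<le> ramp_deriv x" "ramp_deriv x \<le> 1"
  by (auto simp: ramp_deriv_def max_def)

lemma ramp_mono: "x \<le> y \<Longrightarrow> ramp x \<le> ramp y"
  by (rule DERIV_nonneg_imp_nondecreasing) (use ramp_has_derivative ramp_deriv_bounds in blast)+

lemma ramp_bounds: "0 \<le> ramp x" "ramp x \<le> 1"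
  using ramp_mono[of "min x 0" x] ramp_eq_0[of "min x 0"]
    ramp_mono[of x "max x 2"] ramp_eq_1[of "max x 2"] by auto

lemma borel_measurable_ramp [measurable]: "ramp \<in> borel_measurable borel"
  using continuous_on_ramp by (rule borel_measurable_continuous_onI)

lemma first_coordinate_potential:
  assumes d: "1 \<le> d" and f: "\<And>z. (f has_real_derivative f' z) (at z)" and cont: "continuous_on UNIV f'"
  shows "C1_on_Rd d (\<lambda>x. f (x 0))" and "enorm d (gradient d (\<lambda>x. f (x 0)) x) = \<bar>f' (x 0)\<bar>"
proof -
  have grad0: "gradient d (\<lambda>x. f (x 0)) x 0 = f' (x 0)" for x
    using d DERIV_imp_deriv[OF f] by (simp add: gradient_def)
  have grad: "gradient d (\<lambda>x. f (x 0)) x i = 0" if "i \<noteq> 0" for x i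
    using that by (simp add: gradient_def)
  show "enorm d (gradient d (\<lambda>x. f (x 0)) x) = \<bar>f' (x 0)\<bar>"
    using grad by (subst enorm_eq_abs_first[OF d]) (auto simp: grad0)
  have "(\<lambda>h. f ((x(i := h)) 0)) field_differentiable at (x i)" for x i
    using f[of "x i"] by (cases "i = 0") (auto simp: field_differentiable_def)
  moreover have "continuous_on (Rd d) (\<lambda>x. gradient d (\<lambda>x. f (x 0)) x i)" for i
  proof (cases "i = 0")
    case True
    have "continuous_on (Rd d) (\<lambda>x. f' (x 0))"
      by (rule continuous_on_compose2[OF cont]) (auto intro: continuous_on_product_coordinates continuous_on_subset)
    then show ?thesis by (simp add: True grad0)
  qed (simp add: grad)
  ultimately show "C1_on_Rd d (\<lambda>x. f (x 0))" unfolding C1_on_Rd_def by blast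
qed

section \<open>Windows and their rewards\<close>

locale reward_windows =
  fixes C z0 b :: real and s w :: "nat \<Rightarrow> real" and n :: nat
  assumes C_pos: "C > 0" and s0_pos: "s 0 > 0" and s_step: "s (Suc j) = 4 * s j"
begin

definition active :: "real \<Rightarrow> real"
  where "active r = indicator (\<Union>j\<le>n. {s j..2 * s j}) r"

definition front :: "real \<Rightarrow> real"
  where "front r = (\<Sum>j\<le>n. w j * r * indicator {s j..2 * s j} r)"

text \<open>The cut-offs in time are sharp, since smoothness is required in space only. In space
  \<open>ramp\<close> has values and slopes in \<open>[0, 1]\<close>, so the factor \<open>C\<close>
  meets both bounds at once; it saturates at distance 2 beyond the front, which is the origin of
  every 2 added to a front.\<close>

definition reward :: "real \<Rightarrow> real \<Rightarrow> real"
  where "reward z t = C * active (b - t) * ramp (z0 - z - front (b - t))"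

lemma s_positive: "s j > 0"
  by (rule quadrupling_positive[of s, OF s0_pos s_step])

lemma s_gap: "i < j \<Longrightarrow> 4 * s i \<le> s j"
  by (rule quadrupling_gap[of s, OF s0_pos s_step])

lemma front_eq:
  assumes "j \<le> n" "s j \<le> r" "r \<le> 2 * s j"
  shows "front r = w j * r"
proof -
  have "indicator {s i..2 * s i} r = (0 :: real)" if "i \<noteq> j" for i
    using that s_gap[of i j] s_gap[of j i] s_positive[of i] s_positive[of j] assms
    by (cases "i < j") (auto simp: indicator_def)
  then have "front r = (\<Sum>i\<in>{j}. w i * r * indicator {s i..2 * s i} r)"
    unfolding front_def using assms(1) by (intro sum.mono_neutral_right) auto
  then show ?thesis using assms by simp
qed

lemma active_eq_1: "j \<le> n \<Longrightarrow> s j \<le> r \<Longrightarrow> r \<le> 2 * s j \<Longrightarrow> active r = 1"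
  by (auto simp: active_def indicator_def)

lemma active_bounds: "0 \<le> active r" "active r \<le> 1"
  by (auto simp: active_def indicator_def)

lemma reward_measurable: "(\<lambda>(z, t). reward z t) \<in> borel_measurable borel"
proof -
  have [measurable]: "active \<in> borel_measurable borel" "front \<in> borel_measurable borel"
    unfolding active_def[abs_def] front_def[abs_def] by measurable
  have "(\<lambda>(z, t). reward z t) \<in> borel_measurable (borel \<Otimes>\<^sub>M borel)"
    unfolding reward_def by measurable
  then show ?thesis by (simp add: borel_prod)
qed

lemma reward_bounds: "0 \<le> reward z t" "reward z t \<le> C"
proof -
  show "0 \<le> reward z t"
    using C_pos active_bounds ramp_bounds by (simp add: reward_def)
  have "active (b - t) * ramp (z0 - z - front (b - t)) \<le> 1 * 1"
    using active_bounds ramp_bounds by (intro mult_mono) auto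
  then show "reward z t \<le> C" using C_pos by (simp add: reward_def mult.assoc)
qed

lemma reward_has_derivative:
  "((\<lambda>z. reward z t) has_real_derivative
    - (C * active (b - t) * ramp_deriv (z0 - z - front (b - t)))) (at z)"
proof -
  have "((\<lambda>z. ramp (z0 - z - front (b - t))) has_real_derivative
      ramp_deriv (z0 - z - front (b - t)) * (- 1)) (at z)"
    by (rule DERIV_chain2[OF ramp_has_derivative]) (auto intro!: derivative_eq_intros)
  from DERIV_cmult[OF this, of "C * active (b - t)"] show ?thesis by (simp add: reward_def)
qed

lemma reward_deriv_bound: "\<bar>C * active (b - t) * ramp_deriv (z0 - z - front (b - t))\<bar> \<le> C"
proof -
  have "active (b - t) * ramp_deriv (z0 - z - front (b - t)) \<le> 1 * 1"
    using active_bounds ramp_deriv_bounds by (intro mult_mono) auto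
  then show ?thesis using C_pos active_bounds ramp_deriv_bounds
    by (simp add: mult.assoc abs_mult)
qed

lemma reward_C1:
  assumes "1 \<le> d"
  shows "C1_on_Rd d (\<lambda>x. reward (x 0) t)" and "enorm d (gradient d (\<lambda>x. reward (x 0) t) x) \<le> C"
proof -
  have "continuous_on UNIV (\<lambda>z. - (C * active (b - t) * ramp_deriv (z0 - z - front (b - t))))"
    by (intro continuous_intros continuous_on_compose2[OF continuous_on_ramp_deriv[of UNIV]]) auto
  note * = first_coordinate_potential[OF assms reward_has_derivative this]
  show "C1_on_Rd d (\<lambda>x. reward (x 0) t)" by (rule *(1))
  show "enorm d (gradient d (\<lambda>x. reward (x 0) t) x) \<le> C"
    unfolding *(2) using reward_deriv_bound by simp
qed

lemma reward_first_coordinate_measurable: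
  "(\<lambda>(x, t). reward (x 0) t) \<in> borel_measurable (restrict_space borel (A :: ((nat \<Rightarrow> real) \<times> real) set))"
proof -
  have "continuous_on UNIV (\<lambda>p :: (nat \<Rightarrow> real) \<times> real. (fst p 0, snd p))"
    by (intro continuous_intros continuous_on_compose2[OF continuous_on_product_coordinates]) auto
  from measurable_compose[OF borel_measurable_continuous_onI[OF this] reward_measurable]
  have "(\<lambda>p :: (nat \<Rightarrow> real) \<times> real. reward (fst p 0) (snd p)) \<in> borel_measurable borel" by simp
  then show ?thesis by (simp add: split_beta measurable_restrict_space1)
qed

lemma reward_eq_0:
  assumes "\<And>j. j \<le> n \<Longrightarrow> s j \<le> b - t \<Longrightarrow> b - t \<le> 2 * s j \<Longrightarrow> z0 - z \<le> w j * (b - t)"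
  shows "reward z t = 0"
proof (cases "\<exists>j\<le>n. s j \<le> b - t \<and> b - t \<le> 2 * s j")
  case True
  then obtain j where j: "j \<le> n" "s j \<le> b - t" "b - t \<le> 2 * s j" by blast
  then show ?thesis using assms[OF j] by (simp add: reward_def front_eq ramp_eq_0)
next
  case False
  then show ?thesis by (auto simp: reward_def active_def indicator_def)
qed

lemma reward_eq_C:
  assumes "j \<le> n" "s j \<le> b - t" "b - t \<le> 2 * s j" "w j * (b - t) + 2 \<le> z0 - z"
  shows "reward z t = C"
  using assms front_eq[of j "b - t"] active_eq_1[of j "b - t"] by (simp add: reward_def ramp_eq_1)

sublocale potential_profile reward C
  by unfold_locales (rule reward_measurable reward_bounds)+

end

subsection \<open>Constants\<close>

text \<open>The lower bound makes room for windows from \<open>4 ^ m\<close> up to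
  \<open>2 * 4 ^ (2 * m)\<close>; the upper bound makes \<open>m\<close> comparable to
  \<open>ln T\<close>.\<close>

lemma ex_power4_scale:
  fixes T :: real
  assumes "4 ^ (2 * m0 + 1) \<le> T"
  obtains m where "m0 \<le> m" "4 ^ (2 * m + 1) \<le> T" "T < 4 ^ (2 * m + 3)"
proof -
  define m where "m = (LEAST m. T < 4 ^ (2 * m + 3))"
  obtain k where "T < 4 ^ k" using real_arch_pow[of 4 T] by auto
  also have "(4::real) ^ k \<le> 4 ^ (2 * k + 3)" by (rule power_increasing) auto
  finally have less: "T < 4 ^ (2 * m + 3)" unfolding m_def by (rule LeastI)
  have "m0 \<le> m"
  proof (rule ccontr)
    assume "\<not> m0 \<le> m"
    then have "(4::real) ^ (2 * m + 3) \<le> 4 ^ (2 * m0 + 1)" by (intro power_increasing) auto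
    then show False using less assms by linarith
  qed
  moreover have "4 ^ (2 * m + 1) \<le> T"
  proof (cases m)
    case 0
    have "(4::real) ^ (2 * 0 + 1) \<le> 4 ^ (2 * m0 + 1)" by (intro power_increasing) auto
    from order_trans[OF this assms] show ?thesis by (simp add: 0)
  next
    case (Suc m')
    then have "\<not> T < 4 ^ (2 * m' + 3)" using not_less_Least[of m' "\<lambda>m. T < 4 ^ (2 * m + 3)"] by (simp add: m_def)
    moreover have "2 * m' + 3 = 2 * m + 1" using Suc by simp
    ultimately show ?thesis by (metis not_less)
  qed
  ultimately show thesis using less that by blast
qed

lemma le_power2_of_ge_3:
  assumes "3 \<le> m"
  shows "real m + 5 \<le> 2 ^ m"
proof -
  have "real (3 + k) + 5 \<le> 2 ^ (3 + k)" for k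
  proof (induction k)
    case (Suc k)
    have "1 \<le> (2::real) ^ (3 + k)" by simp
    then have "real (3 + k) + 5 + 1 \<le> 2 ^ (3 + k) + 2 ^ (3 + k)" using Suc by linarith
    then show ?case by (simp add: power_add)
  qed simp
  from this[of "m - 3"] show ?thesis using assms by simp
qed

lemma terminal_slope:
  assumes b: "a < b" and d: "1 \<le> d" and \<tau>: "\<tau> > 0"
    and affine: "\<And>t. t \<in> {b - \<tau>..b} \<Longrightarrow> \<gamma> t 0 = \<gamma> b 0 - v * (b - t)"
    and perp: "\<And>i t. 0 < i \<Longrightarrow> i < d \<Longrightarrow> t \<in> {a..b} \<Longrightarrow> \<gamma> t i = x i"
  shows "velocity_exists d a b \<gamma> b" "v \<le> enorm d (velocity d a b \<gamma> b)"
proof -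
  have "((\<lambda>t. \<gamma> b 0 - v * (b - t)) has_real_derivative v) (at b within {a..b})"
    by (auto intro!: derivative_eq_intros)
  then have "((\<lambda>t. \<gamma> b 0 - v * (b - t)) has_vector_derivative v) (at b within {a..b})"
    by (simp only: has_real_derivative_iff_has_vector_derivative)
  then have 0: "((\<lambda>r. \<gamma> r 0) has_vector_derivative v) (at b within {a..b})"
    by (rule has_vector_derivative_transform_within[OF _ \<tau>])
       (use b in \<open>auto intro!: affine[symmetric] simp: dist_real_def\<close>)
  have i: "((\<lambda>r. \<gamma> r i) has_vector_derivative 0) (at b within {a..b})" if "0 < i" "i < d" for i
    by (rule has_vector_derivative_transform_within[OF has_vector_derivative_const[of "x i"] zero_less_one])
       (use b perp that in auto)
  show "velocity_exists d a b \<gamma> b"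
    unfolding velocity_exists_def
  proof (intro allI impI)
    fix i assume "i < d"
    then show "(\<lambda>r. \<gamma> r i) differentiable (at b within {a..b})"
      using differentiableI_vector[OF 0] differentiableI_vector[OF i] by (cases "i = 0") auto
  qed
  have "velocity d a b \<gamma> b 0 = v"
    using vector_derivative_within_closed_interval[OF b _ 0] b d by (simp add: velocity_def)
  then show "v \<le> enorm d (velocity d a b \<gamma> b)"
    using abs_component_le_enorm[of 0 d "velocity d a b \<gamma> b"] d by simp
qed

section \<open>Front speeds and the cost conditions\<close>

locale speed_profile =
  fixes \<beta> C :: real
  assumes \<beta>: "\<beta> > 1" and C: "C > 0"
begin

text \<open>Chosen so that \<open>speed l powr \<beta> = C / (200 * \<beta>) * l\<^sup>2\<close>. A
  step costs \<open>100 * \<beta> * speed l powr \<beta> / l\<^sup>2\<close>, with 100 arising as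
  \<open>4 * 5 * 5\<close>, and this becomes \<open>C / 2\<close>.\<close>

definition K :: real
  where "K = (C / (200 * \<beta>)) powr (1 / \<beta>)"

definition speed :: "real \<Rightarrow> real"
  where "speed l = K * l powr (2 / \<beta>)"

lemma K_pos: "K > 0"
  using \<beta> C by (simp add: K_def)

lemma speed_powr: "l > 0 \<Longrightarrow> speed l powr \<beta> = C / (200 * \<beta>) * l\<^sup>2"
  using \<beta> C K_pos by (simp add: speed_def powr_mult K_def powr_powr powr_numeral)

lemma speed_pos: "l > 0 \<Longrightarrow> speed l > 0"
  using K_pos by (simp add: speed_def)

lemma speed_ge_K: "l \<ge> 1 \<Longrightarrow> K \<le> speed l"
  using K_pos \<beta> ge_one_powr_ge_zero[of l "2 / \<beta>"] by (simp add: speed_def)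

lemma speed_mono: "0 < l \<Longrightarrow> l \<le> l' \<Longrightarrow> speed l \<le> speed l'"
  using K_pos \<beta> by (auto simp: speed_def intro!: mult_left_mono powr_mono2)

lemma exponent_less_2: "2 / \<beta> < 2"
  using \<beta> by (simp add: divide_less_eq)

text \<open>As the exponent \<open>2 / \<beta>\<close> is below 2,
  \<open>(1 - 1 / l) powr (2 / \<beta>)\<close> is at least \<open>(1 - 1 / l)\<^sup>2\<close>,
  hence at least \<open>1 - 2 / l\<close>.\<close>

lemma speed_drop:
  assumes "l > 1"
  shows "speed l - speed (l - 1) \<le> 2 * speed l / l"
proof -
  have "1 - 2 / l \<le> (1 - 1 / l)\<^sup>2" by (simp add: power2_eq_square algebra_simps)
  also have "\<dots> = (1 - 1 / l) powr 2" using assms by (simp add: powr_numeral)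
  also have "\<dots> \<le> (1 - 1 / l) powr (2 / \<beta>)"
    using assms exponent_less_2 by (intro powr_mono') auto
  finally have "speed l * (1 - 2 / l) \<le> speed l * (1 - 1 / l) powr (2 / \<beta>)"
    using speed_pos[of l] assms by (intro mult_left_mono) auto
  also have "\<dots> = K * (l * (1 - 1 / l)) powr (2 / \<beta>)"
    using assms by (simp add: speed_def powr_mult[symmetric])
  also have "l * (1 - 1 / l) = l - 1" using assms by (simp add: field_simps)
  finally show ?thesis by (simp add: speed_def algebra_simps)
qed

text \<open>The 5 in \<open>D\<close> is made of 4, twice the drop of speed between neighbouring
  windows, and 1 for the layer of width 2. The condition \<open>l \<ge> 6\<close> keeps
  \<open>D\<close> below \<open>speed l\<close>.\<close>

lemma step_cost_bound:
  assumes l: "l \<ge> 6"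
  defines "D \<equiv> 5 * speed l / l"
  shows "D < speed l" "4 * D * (speed l powr (\<beta> - 1) - (speed l - D) powr (\<beta> - 1)) < C"
proof -
  define w where "w = speed l"
  have w: "w > 0" using speed_pos[of l] l by (simp add: w_def)
  have D: "0 \<le> D" "D < w" "D / w = 5 / l" using w l by (auto simp: D_def w_def[symmetric] field_simps)
  then show "D < speed l" by (simp add: w_def)
  have "4 * D * (w powr (\<beta> - 1) - (w - D) powr (\<beta> - 1)) \<le> 4 * D * (w powr (\<beta> - 1) * (\<beta> * (5 / l)))"
    using powr_diff_le[OF \<beta> D(1,2)] D by (intro mult_left_mono) auto
  also have "\<dots> = 100 * \<beta> * (w * w powr (\<beta> - 1)) / l\<^sup>2"
    unfolding D_def w_def[symmetric] by (simp add: power2_eq_square)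
  also have "w * w powr (\<beta> - 1) = w powr \<beta>" using w by (simp add: powr_mult_base)
  also have "w powr \<beta> = C / (200 * \<beta>) * l\<^sup>2" using speed_powr[of l] l by (simp add: w_def)
  also have "100 * \<beta> * (C / (200 * \<beta>) * l\<^sup>2) / l\<^sup>2 = C / 2" using l \<beta> by (simp add: field_simps)
  finally show "4 * D * (speed l powr (\<beta> - 1) - (speed l - D) powr (\<beta> - 1)) < C"
    using C by (simp add: w_def)
qed

lemma top_cost_bound: "4 * speed 5 powr \<beta> / \<beta> < C"
proof -
  have "4 * speed 5 powr \<beta> / \<beta> = C / (2 * (\<beta> * \<beta>))"
    using speed_powr[of 5] by (simp add: field_simps)
  also have "\<dots> < C"
  proof -
    have "1 < \<beta> * \<beta>" by (rule less_1_mult[OF \<beta> \<beta>])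
    then have "C * 1 < C * (2 * (\<beta> * \<beta>))" using C by (intro mult_strict_left_mono) auto
    then show ?thesis using \<beta> by (simp add: divide_less_eq)
  qed
  finally show ?thesis .
qed

end

section \<open>Choice of the constants and conclusion\<close>

theorem theorem2:
  fixes \<beta> C :: real
  assumes "\<beta> > 1" and "C > 0"
  shows "\<exists>K2 > 0. \<exists>T0 > 1. \<forall>d::nat. d \<ge> 1 \<longrightarrow>
    (\<forall>t1 t2 :: real. t2 - t1 \<ge> T0 \<longrightarrow>
      (\<forall>y \<in> Rd d. \<exists>U :: (nat \<Rightarrow> real) \<Rightarrow> real \<Rightarrow> real.
        (\<lambda>(x, t). U x t) \<in> borel_measurable (restrict_space borel (Rd d \<times> {t1..t2})) \<and>
        (\<forall>t \<in> {t1..t2}. C1_on_Rd d (\<lambda>x. U x t)) \<and>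
        (\<forall>x \<in> Rd d. \<forall>t \<in> {t1..t2}.
           0 \<le> U x t \<and> U x t \<le> C \<and> enorm d (gradient d (\<lambda>x'. U x' t) x) \<le> C) \<and>
        (\<forall>x \<in> Rd d. edist d x y \<le> K2 / 2 * ln (t2 - t1) powr (2 / \<beta>) \<longrightarrow>
           (\<forall>\<gamma>. is_minimizer d \<beta> t1 t2 U x \<gamma> \<longrightarrow>
              velocity_exists d t1 t2 \<gamma> t2 \<and>
              enorm d (velocity d t1 t2 \<gamma> t2) \<ge>
                K2 * ln (t2 - t1) powr (2 / \<beta>) / 2 powr (\<beta> / (\<beta> - 1))))))"
proof -
  interpret speed_profile \<beta> C by unfold_locales (rule assms)+
  obtain j0 where j0: "1 / K < 2 ^ j0" using real_arch_pow[of 2 "1 / K"] by auto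
  \<comment> \<open>For \<open>m \<ge> m0\<close> both \<open>1 / K \<le> 2 ^ m\<close> and
    \<open>m + 5 \<le> 2 ^ m\<close> hold, the latter with equality at 3. Their product gives
    \<open>m + 5 \<le> K * 4 ^ m\<close>, as needed for \<open>scale\<close> below.\<close>
  define m0 where "m0 = max 3 j0"
  define T0 where "T0 = (4::real) ^ (2 * m0 + 1)"
  \<comment> \<open>Here \<open>36 = 4 * 9\<close>: the logarithm of \<open>t2 - t1\<close> is at
    most \<open>3 * (m + 5)\<close>, raising 3 to the exponent \<open>2 / \<beta>\<close> gives at
    most 9, and the 4 produces \<open>K2 * L \<le> w 0 / 4\<close>.\<close>
  define K2 where "K2 = K / 36"
  have K2: "K2 > 0" using K_pos by (simp add: K2_def)
  have T0: "T0 > 1" unfolding T0_def by (rule one_less_power) auto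
  show ?thesis
  proof (rule exI[of _ K2], intro conjI K2, rule exI[of _ T0], intro conjI T0 allI impI ballI)
    fix d :: nat and t1 t2 :: real and y :: "nat \<Rightarrow> real"
    assume d: "1 \<le> d" and T: "T0 \<le> t2 - t1"
    obtain m where m: "m0 \<le> m" "4 ^ (2 * m + 1) \<le> t2 - t1" "t2 - t1 < 4 ^ (2 * m + 3)"
      using ex_power4_scale[of m0 "t2 - t1"] T unfolding T0_def by blast
    define s where "s = (\<lambda>j. (4::real) ^ (m + j))"
    \<comment> \<open>The shift by 5 makes the argument at least 6 in every step
      \<open>j < m\<close>, and exactly 5 at the top window. Truncated subtraction keeps
      \<open>w\<close> positive for \<open>j > m\<close> as well.\<close>
    define w where "w = (\<lambda>j. speed (real (m - j) + 5))"
    define L where "L = ln (t2 - t1) powr (2 / \<beta>)"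
    define R where "R = K2 / 2 * L"
    \<comment> \<open>For every end point within \<open>R\<close> of \<open>y\<close> the distance
      \<open>z0 - x 0\<close> lies between 2 and \<open>2 * R + 2\<close>, so one potential serves
      the whole ball.\<close>
    define z0 where "z0 = y 0 + R + 2"
    have m3: "3 \<le> m" "j0 \<le> m" using m(1) by (auto simp: m0_def)
    have t12: "t1 < t2" using T T0 by linarith
    have Ls: "K2 * L \<le> w 0 / 4"
    proof -
      have "1 \<le> t2 - t1" using T T0 by linarith
      then have ln0: "0 \<le> ln (t2 - t1)" by simp
      have "ln (t2 - t1) \<le> ln (4 ^ (2 * m + 3))"
        using m(3) t12 by (intro ln_mono) auto
      also have "\<dots> = real (2 * m + 3) * ln 4" by (rule ln_realpow)
      also have "ln (4 :: real) = 2 * ln 2" using ln_realpow[of 2 2] by simp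
      also have "real (2 * m + 3) * (2 * ln 2) \<le> real (2 * m + 3) * (3 / 2)"
        using ln2_le_25_over_36 by (intro mult_left_mono) auto
      also have "\<dots> \<le> 3 * (real m + 5)" by simp
      finally have "L \<le> (3 * (real m + 5)) powr (2 / \<beta>)"
        unfolding L_def using ln0 \<beta> by (intro powr_mono2) auto
      also have "\<dots> = 3 powr (2 / \<beta>) * (real m + 5) powr (2 / \<beta>)" by (rule powr_mult)
      also have "\<dots> \<le> 3 powr 2 * (real m + 5) powr (2 / \<beta>)"
        using exponent_less_2 by (intro mult_right_mono powr_mono) auto
      finally have "K2 * L \<le> K2 * (9 * (real m + 5) powr (2 / \<beta>))"
        using K2 by (intro mult_left_mono) auto
      then show ?thesis by (simp add: w_def speed_def K2_def)
    qed
    have L0: "0 \<le> K2 * L" using K2 by (simp add: L_def)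
    have wpos: "w j > 0" for j unfolding w_def by (intro speed_pos) simp
    have spos: "s j > 0" for j by (simp add: s_def)
    \<comment> \<open>The velocity cost of the layer of width 2 is at most one unit
      \<open>w i / l\<close>; here it matters that all \<open>s j\<close> are at least
      \<open>4 ^ m\<close>.\<close>
    have scale: "1 / s j \<le> w i / (real (m - i) + 5)" for i j
    proof -
      have "1 / K \<le> 2 ^ j0" using j0 by simp
      also have "\<dots> \<le> (2::real) ^ m" using m3 by (intro power_increasing) auto
      finally have "(1 / K) * (real m + 5) \<le> 2 ^ m * 2 ^ m"
        using le_power2_of_ge_3[OF m3(1)] K_pos by (intro mult_mono) auto
      also have "\<dots> = (4::real) ^ m" by (simp add: power_mult_distrib[symmetric])
      also have "\<dots> \<le> s j" unfolding s_def by (intro power_increasing) auto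
      finally have "real m + 5 \<le> K * s j" using K_pos by (simp add: field_simps)
      moreover have "K * s j \<le> w i * s j"
        using speed_ge_K[of "real (m - i) + 5"] spos[of j]
        unfolding w_def by (intro mult_right_mono) auto
      moreover have "real (m - i) + 5 \<le> real m + 5" by simp
      ultimately have "real (m - i) + 5 \<le> w i * s j" by linarith
      then show ?thesis using spos[of j] by (simp add: field_simps)
    qed
    interpret reward_windows C z0 t2 s w m
      by unfold_locales (use C in \<open>auto simp: s_def\<close>)
    have main: "velocity_exists d t1 t2 \<gamma> t2 \<and>
        enorm d (velocity d t1 t2 \<gamma> t2) \<ge> K2 * L / 2 powr (\<beta> / (\<beta> - 1))"
      if x: "x \<in> Rd d" "edist d x y \<le> R"
        and min: "is_minimizer d \<beta> t1 t2 (\<lambda>x t. reward (x 0) t) x \<gamma>" for x \<gamma>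
    proof -
      have "\<bar>x 0 - y 0\<bar> \<le> R"
        using abs_component_le_enorm[of 0 d "\<lambda>i. x i - y i"] d x(2) by (simp add: edist_def)
      then have q0: "2 \<le> z0 - x 0" "z0 - x 0 \<le> 2 * R + 2" by (auto simp: z0_def)
      obtain k N where k:
        "\<And>s t. t1 \<le> s \<Longrightarrow> s \<le> t \<Longrightarrow> t \<le> t2 \<Longrightarrow> (k has_integral (\<gamma> t 0 - \<gamma> s 0)) {s..t}"
        "(\<lambda>t. \<bar>k t\<bar> powr \<beta>) integrable_on {t1..t2}"
        "negligible N" "\<And>t. t \<in> {t1..t2} - N \<Longrightarrow> ((\<lambda>t. \<gamma> t 0) has_real_derivative k t) (at t)"
        and perp: "\<And>i t. 0 < i \<Longrightarrow> i < d \<Longrightarrow> t \<in> {t1..t2} \<Longrightarrow> \<gamma> t i = x i"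
        and ac: "abs_cont t1 t2 (\<lambda>t. \<gamma> t 0)" and \<gamma>: "\<gamma> t2 0 = x 0"
        and opt: "\<And>h kh M. abs_cont t1 t2 h \<Longrightarrow> negligible M \<Longrightarrow>
          (\<And>t. t \<in> {t1..t2} - M \<Longrightarrow> (h has_real_derivative kh t) (at t)) \<Longrightarrow>
          (\<lambda>t. \<bar>kh t\<bar> powr \<beta>) integrable_on {t1..t2} \<Longrightarrow> h t2 = x 0 \<Longrightarrow>
          integral {t1..t2} (\<lambda>t. \<bar>k t\<bar> powr \<beta> / \<beta> - reward (\<gamma> t 0) t) \<le>
          integral {t1..t2} (\<lambda>t. \<bar>kh t\<bar> powr \<beta> / \<beta> - reward (h t) t)"
        using minimizer_reduction[OF min d \<beta> t12 x(1)] by blast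
      interpret window_minimizer reward C t1 t2 \<beta> "\<lambda>t. \<gamma> t 0" k N s w m z0
      proof unfold_locales
        have "4 * s m \<le> t2 - t1" using m(2) by (simp add: s_def mult_2[symmetric])
        then show "2 * s m \<le> t2 - t1" using spos[of m] by linarith
        show "4 * w m powr \<beta> / \<beta> < C" using top_cost_bound by (simp add: w_def)
        show "w (Suc j) \<le> w j" if "j < m" for j
          unfolding w_def by (intro speed_mono) auto
        show "\<exists>D. 2 * (w j - w (Suc j)) + 1 / s j \<le> D \<and> D < w j \<and>
            4 * D * (w j powr (\<beta> - 1) - (w j - D) powr (\<beta> - 1)) < C" if j: "j < m" for j
        proof -
          define l where "l = real (m - j) + 5"
          have l: "l \<ge> 6" "l - 1 = real (m - Suc j) + 5" using j by (auto simp: l_def of_nat_diff)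
          have wl: "w j = speed l" "w (Suc j) = speed (l - 1)" using l(2) by (simp_all add: w_def l_def)
          have "2 * (w j - w (Suc j)) + 1 / s j \<le> 5 * speed l / l"
          proof -
            have "1 / s j \<le> speed l / l" using scale[of j j] unfolding wl l_def[symmetric] .
            moreover have "speed l - speed (l - 1) \<le> 2 * (speed l / l)" using speed_drop[of l] l(1) by simp
            ultimately have "2 * (speed l - speed (l - 1)) + 1 / s j \<le> 2 * (2 * (speed l / l)) + speed l / l"
              by (intro add_mono mult_left_mono) auto
            then show ?thesis unfolding wl by simp
          qed
          then show ?thesis using step_cost_bound[OF l(1)] unfolding wl by blast
        qed
        show "h t2 = \<gamma> t2 0 \<Longrightarrow> integral {t1..t2} (\<lambda>t. \<bar>k t\<bar> powr \<beta> / \<beta> - reward (\<gamma> t 0) t) \<le>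
          integral {t1..t2} (\<lambda>t. \<bar>kh t\<bar> powr \<beta> / \<beta> - reward (h t) t)"
          if "abs_cont t1 t2 h" "negligible M"
          "\<And>t. t \<in> {t1..t2} - M \<Longrightarrow> (h has_real_derivative kh t) (at t)"
          "(\<lambda>t. \<bar>kh t\<bar> powr \<beta>) integrable_on {t1..t2}" for h kh M
          using opt[OF that] \<gamma> by simp
        show "2 \<le> z0 - \<gamma> t2 0" using q0 \<gamma> by simp
        show "reward z t = 0" if "\<And>j. j \<le> m \<Longrightarrow> s j \<le> t2 - t \<Longrightarrow> t2 - t \<le> 2 * s j \<Longrightarrow>
            z0 - z \<le> w j * (t2 - t)" for z t
          by (rule reward_eq_0[OF that])
        show "reward z t = C" if "j \<le> m" "s j \<le> t2 - t" "t2 - t \<le> 2 * s j"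
            "w j * (t2 - t) + 2 \<le> z0 - z" for j z t
          by (rule reward_eq_C[OF that])
        show "0 < w j" for j by (rule wpos)
      qed (fact \<beta> t12 ac k s0_pos s_step)+
      obtain \<tau> v where \<tau>: "s 0 \<le> \<tau>" "\<tau> \<le> t2 - t1" and v: "w 0 * \<tau> - (z0 - \<gamma> t2 0) \<le> v * \<tau>"
        and affine: "\<And>t. t \<in> {t2 - \<tau>..t2} \<Longrightarrow> \<gamma> t 0 = \<gamma> t2 0 - v * (t2 - t)"
        using affine_near_end by blast
      have \<tau>pos: "\<tau> > 0" using \<tau>(1) spos[of 0] by linarith
      note slope = terminal_slope[of t1 t2 d \<tau> \<gamma> v x, OF t12 d \<tau>pos affine perp]
      \<comment> \<open>The terminal offset, at most \<open>2 * R + 2\<close>, takes away at most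
        half of \<open>w 0 * \<tau>\<close>, because \<open>2 * R \<le> w 0 / 4\<close> while
        \<open>s 0\<close> and \<open>w 0 * s 0\<close> are both at least 8. This leaves
        \<open>v \<ge> w 0 / 2\<close>.\<close>
      have "w 0 / 2 * \<tau> \<ge> z0 - x 0"
      proof -
        have s8: "8 \<le> s 0"
        proof -
          have "(4::real) ^ 3 \<le> s 0" unfolding s_def using m3 by (intro power_increasing) auto
          then show ?thesis by simp
        qed
        have "1 / s 0 \<le> w 0 / 8"
          using scale[of 0 0] m3 wpos[of 0]
          by (intro order_trans[OF scale[of 0 0]] divide_left_mono) auto
        then have "8 \<le> w 0 * s 0" using spos[of 0] by (simp add: field_simps)
        moreover have "w 0 * 8 \<le> w 0 * s 0" using s8 wpos[of 0] by (intro mult_left_mono) auto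
        moreover have "w 0 * s 0 \<le> w 0 * \<tau>" using \<tau>(1) wpos[of 0] by (intro mult_left_mono) auto
        moreover have "2 * R \<le> w 0 / 4" using Ls by (simp add: R_def)
        ultimately show ?thesis using q0(2) wpos[of 0] by linarith
      qed
      then have "w 0 / 2 * \<tau> \<le> v * \<tau>" using v \<gamma> by (simp add: algebra_simps)
      then have "w 0 / 2 \<le> v" using \<tau>pos by simp
      then have "K2 * L \<le> v" using Ls wpos[of 0] by linarith
      moreover have "K2 * L / 2 powr (\<beta> / (\<beta> - 1)) \<le> K2 * L"
      proof -
        have "1 \<le> 2 powr (\<beta> / (\<beta> - 1))" using \<beta> by (intro ge_one_powr_ge_zero) auto
        then show ?thesis using L0 by (simp add: divide_le_eq mult_left_le mult_le_cancel_left1)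
      qed
      ultimately show ?thesis using slope by linarith
    qed
    show "\<exists>U :: (nat \<Rightarrow> real) \<Rightarrow> real \<Rightarrow> real.
        (\<lambda>(x, t). U x t) \<in> borel_measurable (restrict_space borel (Rd d \<times> {t1..t2})) \<and>
        (\<forall>t \<in> {t1..t2}. C1_on_Rd d (\<lambda>x. U x t)) \<and>
        (\<forall>x \<in> Rd d. \<forall>t \<in> {t1..t2}.
           0 \<le> U x t \<and> U x t \<le> C \<and> enorm d (gradient d (\<lambda>x'. U x' t) x) \<le> C) \<and>
        (\<forall>x \<in> Rd d. edist d x y \<le> K2 / 2 * ln (t2 - t1) powr (2 / \<beta>) \<longrightarrow>
           (\<forall>\<gamma>. is_minimizer d \<beta> t1 t2 U x \<gamma> \<longrightarrow>
              velocity_exists d t1 t2 \<gamma> t2 \<and>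
              enorm d (velocity d t1 t2 \<gamma> t2) \<ge>
                K2 * ln (t2 - t1) powr (2 / \<beta>) / 2 powr (\<beta> / (\<beta> - 1))))"
    proof (rule exI[of _ "\<lambda>x t. reward (x 0) t"], intro conjI ballI impI allI)
      fix x \<gamma>
      assume x: "x \<in> Rd d" "edist d x y \<le> K2 / 2 * ln (t2 - t1) powr (2 / \<beta>)"
        and min: "is_minimizer d \<beta> t1 t2 (\<lambda>x t. reward (x 0) t) x \<gamma>"
      note concl = main[OF x(1) x(2)[folded L_def R_def] min]
      show "velocity_exists d t1 t2 \<gamma> t2" using concl ..
      show "K2 * ln (t2 - t1) powr (2 / \<beta>) / 2 powr (\<beta> / (\<beta> - 1)) \<le> enorm d (velocity d t1 t2 \<gamma> t2)"
        using concl unfolding L_def ..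
    qed (rule reward_first_coordinate_measurable reward_C1[OF d] reward_bounds)+
  qed
qed

end
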